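(* Consider stage $i$ ($1\le i\le s$) of the DG-IMEX scheme described in the context. Assume: 1. For all $\ell=1,\dots,d$, the $M_x$-point Legendre--Gauss--Lobatto (LGL) quadrature on $K^\ell$ is exact for computing the cell average of $\mathbf U_h^{(j)}$ over $K^\ell$. 2. The $M_\varepsilon$-point LGL quadrature on $K_\varepsilon$ is exact for computing the ($\varepsilon^2$-weighted) cell average of $\mathbf U_h^{(j)}$ over $K_\varepsilon$. 3. For all $0\le j\le i-1<s$, the values of $\mathbf U_h^{(j)}$ at all points of $\widetilde S_\otimes(\mathbf K)$, for all elements $\mathbf K$, lie in $\mathcal R$. 4. $\displaystyle \Delta t\le \hat c\,\min_{K_\varepsilon,K^\ell}\Big\{\,W(1-v)\frac{\hat w^\varepsilon_{M_\varepsilon}\Delta\varepsilon}{(d+1)\,\varepsilon_{\rm H}\,a^\varepsilon},\ \frac{\hat w^\ell_{M_x}\Delta x^\ell}{(d+1)\,a^\ell}\Big\}$ with $a^\varepsilon\ge|q|$, $a^\ell\ge1$, $\hat c=\min_{i,j}1/\hat c_{ij}$ (so that $\mathbf U^{(i)}_{\rm Ex}\in\mathcal R$). Let $\mathbf U^{(i)}_{\mathbf K}$, solving $\mathbf U_{\mathbf K}^{(i)}=\mathbf U^{(i)}_{\rm Ex}+a_{ii}\Delta t\,\boldsymbol{\mathcal C}(\mathbf U_{\mathbf K}^{(i)})$, be obtained by the modified Richardson iteration of the context with $0<\lambda\le(1+v)^{-1}$. Then $\mathbf U_{\mathbf K}^{(i)}\in\mathcal R$.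
   Context: **Kinematics.** Units $c=1$, metric $\eta=\mathrm{diag}(-1,1,1,1)$. The three-velocity $v^i(\boldsymbol x)$ is time independent, $v=\sqrt{v_iv^i}<1$, $W=(1-v^2)^{-1/2}$, $u^\mu=W(1,v^i)$, $n^\mu=(1,0,0,0)$, $v^\mu=(0,v^i)$. For $\omega=(\vartheta,\varphi)\in\mathbb S^2$ put $\ell^{\hat\imath}=(\cos\vartheta,\sin\vartheta\cos\varphi,\sin\vartheta\sin\varphi)$ and let $\ell^\mu$ be its Lorentz boost: $\ell^0=W v_j\ell^{\hat\jmath}$, $\ell^i=\ell^{\hat\imath}+(W-1)v^i(v_j\ell^{\hat\jmath})/v^2$ ($\ell^i=\ell^{\hat\imath}$ if $v=0$), so $u_\mu\ell^\mu=0$, $\ell_\mu\ell^\mu=1$. For $\varepsilon>0$: $p^\mu=\varepsilon(u^\mu+\ell^\mu)$, $E=-n_\mu p^\mu=\varepsilon(W+v_\mu\ell^\mu)>0$, and $L^\mu$ is defined by $p^\mu=E(n^\mu+L^\mu)$, so $L^0=0$, $L_iL^i=1$. Put $q=p^\nu p^\rho\partial_\nu u_\rho/\varepsilon^2$, with $\partial_\nu u_\rho$ replaced by the given (discrete) four-velocity gradient; $a^\varepsilon(\boldsymbol x)\ge|q|$ means for all $\omega$. **Realizability.** $\mathfrak R$ is the set of integrable $f\ge0$ on $\mathbb S^2$ with $\frac1{4\pi}\int_{\mathbb S^2}f\,d\omega>0$. A pair (scalar, covector) $(\mathscr J,\mathscr H_\mu)$ is in $\mathcal R$ (realizable) if $\mathscr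 J>0$ and $\mathscr J\ge\sqrt{\mathscr H_\mu\mathscr H^\mu}$. Eulerian pairs $\mathbf U=(\mathcal E,\mathcal F_j)$ have $\mathcal F_0=0$; Lagrangian pairs $\mathbf M=(\mathcal J,\mathcal H_i)$ and "hat" pairs $\widehat{\mathbf U}=(\widehat{\mathcal E},\widehat{\mathcal F}_i)$ have $\mathcal H_0=-v^i\mathcal H_i$, $\widehat{\mathcal F}_0=-v^i\widehat{\mathcal F}_i$. **Exact closure (standing assumption).** Each realizable moment value is closed by some $f\in\mathfrak R$ such that $\mathcal J=\frac{\varepsilon}{4\pi}\int f\,d\omega$, $\mathcal H_\mu=\frac{\varepsilon}{4\pi}\int f\ell_\mu d\omega$, $\mathcal K_{\mu\nu}=\frac{\varepsilon}{4\pi}\int f\ell_\mu\ell_\nu d\omega$ and $$\mathbf U=\tfrac1{4\pi}\!\int\tfrac{E^2}{\varepsilon}f\,(1,L_j)\,d\omega,\quad \mathbf F^i=\tfrac1{4\pi}\!\int\tfrac{E^2}{\varepsilon}fL^i(1,L_j)\,d\omega,$$ $$\widetilde{\mathbf U}=\tfrac1{4\pi}\!\int Ef\,(1,L_j)\,d\omega,\quad \mathbf F^\varepsilon=-\tfrac1{4\pi}\!\int qEf\,(1,L_j)\,d\omega .$$ **Mesh and quadrature.** $\Omega_\varepsilon\times\Omega_{\boldsymbol x}\subset\mathbb R^+\times\mathbb R^d$ is divided into elements $\mathbf K=K_\varepsilon\times\mathbf K_{\boldsymbol x}$, $\mathbf K_{\boldsymbol x}=K^1\times\dots\times K^d$,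 $K_\varepsilon=(\varepsilon_{\rm L},\varepsilon_{\rm H})$, $K^\ell=(x^\ell_{\rm L},x^\ell_{\rm H})$, $\Delta\varepsilon=\varepsilon_{\rm H}-\varepsilon_{\rm L}$, $\Delta x^\ell=x^\ell_{\rm H}-x^\ell_{\rm L}$; $|K_\varepsilon|=\int_{K_\varepsilon}\varepsilon^2d\varepsilon$, $|\mathbf K_{\boldsymbol x}|=\prod_\ell\Delta x^\ell$, $|\mathbf K|=|K_\varepsilon||\mathbf K_{\boldsymbol x}|$, $\widetilde{\mathbf K}^\ell=K_\varepsilon\times\prod_{j\ne\ell}K^j$. $\mathbf U_h$ is, on each element, a tensor-product polynomial of degree $\le k$ in each of $\varepsilon,x^1,\dots,x^d$. $M_\varepsilon\ge(k+5)/2$ and $M_x\ge(k+3)/2$ LGL points (element endpoints included) are used on $K_\varepsilon$ and $K^\ell$, with weights $\hat w^\varepsilon_q$, $\hat w^\ell_q$ normalized to sum to 1. $S_\otimes(\mathbf K)$ is the tensor product of $N$-point Legendre--Gauss (LG) points in all dimensions; $\hat S_{\varepsilon,\otimes}(\mathbf K)$ (resp. $\hat S_{\ell,\otimes}(\mathbf K)$) is the same set with LG points in the $\varepsilon$ (resp. $x^\ell$) dimension replaced by the LGL points; $\widetilde S_\otimes(\mathbf K)$ is the union of all these sets. Face integrals are evaluated with the tensor LG quadrature, taken exact for the polynomials in the cell averages. Traces exterior to the domain (boundary data) are realizable. **Fluxes.** $\widehat{\mathbf F}^\ell=\frac12[\mathbf F^\ell|_{x^-}+\mathbf F^\ell|_{x^+}-a^\ell(\mathbf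 U_h|_{x^+}-\mathbf U_h|_{x^-})]$ and $\widehat{\mathbf F}^\varepsilon=\frac12[\mathbf F^\varepsilon|_{\varepsilon^-}+\mathbf F^\varepsilon|_{\varepsilon^+}-a^\varepsilon(\widetilde{\mathbf U}|_{\varepsilon^+}-\widetilde{\mathbf U}|_{\varepsilon^-})]$, where $\pm$ denote one-sided traces. **Explicit update.** $\mathbf U_{\mathbf K}=\frac1{|\mathbf K|}\int_{\mathbf K}\mathbf U_h\varepsilon^2d\varepsilon\,d\boldsymbol x$. With $c_{ij}\ge0$, $\sum_{j=0}^{i-1}c_{ij}=1$, $\hat c_{ij}\ge0$, $a_{ii}\ge0$: $$\mathbf U^{(ij)}_{\mathbf K}=\mathbf U^{(j)}_{\mathbf K}+\hat c_{ij}\Delta t\,\mathbf T(\mathbf U_h^{(j)})_{\mathbf K},\qquad \mathbf U^{(i)}_{\rm Ex}=\sum_{j=0}^{i-1}c_{ij}\mathbf U^{(ij)}_{\mathbf K},$$ $$\mathbf T(\mathbf U_h)_{\mathbf K}=-\tfrac1{|\mathbf K|}\int_{\mathbf K_{\boldsymbol x}}[\varepsilon^3\widehat{\mathbf F}^\varepsilon|_{\varepsilon_{\rm H}}-\varepsilon^3\widehat{\mathbf F}^\varepsilon|_{\varepsilon_{\rm L}}]d\boldsymbol x-\sum_{\ell=1}^d\tfrac1{|\mathbf K|}\int_{\widetilde{\mathbf K}^\ell}[\widehat{\mathbf F}^\ell|_{x^\ell_{\rm H}}-\widehat{\mathbf F}^\ell|_{x^\ell_{\rm L}}]\varepsilon^2d\tilde{\boldsymbol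 z}^\ell,$$ where $\tilde{\boldsymbol z}^\ell$ are the coordinates on $\widetilde{\mathbf K}^\ell$. **Implicit update.** With $A\,(a,b)=(Wa+v^ib_i,\ b_i+Wv_ia)$, one has $\mathbf U=A\widehat{\mathbf U}$, and the closure relation is $\widehat{\mathbf U}(\mathbf M)=(W\mathcal J+v^i\mathcal H_i,\ W\mathcal H_j+v^i\mathcal K_{ij})$. The collision term is $\boldsymbol{\mathcal C}(\mathbf U)=A\widehat{\boldsymbol{\mathcal C}}(\mathbf M)$, $\widehat{\boldsymbol{\mathcal C}}(\mathbf M)=(\chi(\mathcal J_{\rm Eq}-\mathcal J),-\kappa\mathcal H_j)$, with $0\le\chi\le\kappa$, $\mathcal J_{\rm Eq}\ge0$. The modified Richardson iteration, with $\Delta\tau=a_{ii}\Delta t$ and $\widehat{\mathbf U}^{( * )}=A^{-1}\mathbf U^{(i)}_{\rm Ex}$, is $$\mathbf M^{[k+1]}=\mathbf M^{[k]}-\lambda\Lambda\big[\widehat{\mathbf U}(\mathbf M^{[k]})-\widehat{\mathbf U}^{( * )}-\Delta\tau\widehat{\boldsymbol{\mathcal C}}(\mathbf M^{[k]})\big],\qquad \mathbf M^{[0]}=\widehat{\mathbf U}^{( * )},$$ $\Lambda=\mathrm{diag}(\mu_\chi,\mu_\kappa,\mu_\kappa,\mu_\kappa)$, $\mu_\chi=(W+\lambda\Delta\tau\chi)^{-1}$, $\mu_\kappa=(W+\lambda\Delta\tau\kappa)^{-1}$. "Obtained by the iteration" means: the iteration converges to some $\mathbf M$ and $\mathbf U^{(i)}_{\mathbf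 K}=A\widehat{\mathbf U}(\mathbf M)$. *)

theory Defs
  imports "HOL-Analysis.Analysis" "HOL-Computational_Algebra.Polynomial"
begin

section \<open>Kinematics\<close>

text \<open>Four-vectors are (time component, spatial part).  The same product type carries moment pairs
  (scalar, spatial part of the covector); spatial indices are raised and lowered trivially.\<close>

type_synonym four = "real \<times> (real^3)"
type_synonym mom = "real \<times> (real^3)"

definition mink :: "four \<Rightarrow> four \<Rightarrow> real" where
  "mink a b = - fst a * fst b + snd a \<bullet> snd b"

definition lorentz :: "real^3 \<Rightarrow> real" where
  "lorentz v = 1 / sqrt (1 - (norm v)\<^sup>2)"

definition u4 :: "real^3 \<Rightarrow> four" where
  "u4 v = lorentz v *\<^sub>R (1, v)"

definition n4 :: four where
  "n4 = (1, 0)"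

definition lhat :: "real \<times> real \<Rightarrow> real^3" where
  "lhat \<omega> = vector [cos (fst \<omega>), sin (fst \<omega>) * cos (snd \<omega>), sin (fst \<omega>) * sin (snd \<omega>)]"

text \<open>For \<open>v = 0\<close> the second summand of the spatial part vanishes, as required.\<close>

definition ell4 :: "real^3 \<Rightarrow> real \<times> real \<Rightarrow> four" where
  "ell4 v \<omega> = (lorentz v * (v \<bullet> lhat \<omega>),
     lhat \<omega> + ((lorentz v - 1) * (v \<bullet> lhat \<omega>) / (norm v)\<^sup>2) *\<^sub>R v)"

definition p4 :: "real \<Rightarrow> real^3 \<Rightarrow> real \<times> real \<Rightarrow> four" where
  "p4 \<epsilon> v \<omega> = \<epsilon> *\<^sub>R (u4 v + ell4 v \<omega>)"

definition energy :: "real \<Rightarrow> real^3 \<Rightarrow> real \<times> real \<Rightarrow> real" where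
  "energy \<epsilon> v \<omega> = - mink n4 (p4 \<epsilon> v \<omega>)"

text \<open>The solution \<open>L\<close> of \<open>p = E (n + L)\<close>.\<close>

definition L4 :: "real \<Rightarrow> real^3 \<Rightarrow> real \<times> real \<Rightarrow> four" where
  "L4 \<epsilon> v \<omega> = (1 / energy \<epsilon> v \<omega>) *\<^sub>R p4 \<epsilon> v \<omega> - n4"

text \<open>The (discrete) four-velocity gradient enters as a bilinear form
  \<open>G a b = a^\<nu> b^\<rho> \<partial>_\<nu> u_\<rho>\<close>.\<close>

definition qfac :: "(four \<Rightarrow> four \<Rightarrow> real) \<Rightarrow> real \<Rightarrow> real^3 \<Rightarrow> real \<times> real \<Rightarrow> real" where
  "qfac G \<epsilon> v \<omega> = G (p4 \<epsilon> v \<omega>) (p4 \<epsilon> v \<omega>) / \<epsilon>\<^sup>2"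


section \<open>Distributions, moments, realizability\<close>

text \<open>The unit sphere in the angles \<open>(\<theta>, \<phi>)\<close> with \<open>d\<omega> = sin \<theta> d\<theta> d\<phi>\<close>.\<close>

definition sph :: "(real \<times> real) measure" where
  "sph = density (restrict_space lborel ({0..pi} \<times> {0..<2*pi})) (\<lambda>\<omega>. ennreal (sin (fst \<omega>)))"

definition sphavg :: "(real \<times> real \<Rightarrow> 'b::{banach, second_countable_topology}) \<Rightarrow> 'b" where
  "sphavg g = (1 / (4 * pi)) *\<^sub>R (\<integral>\<omega>. g \<omega> \<partial>sph)"

definition real_dist :: "(real \<times> real \<Rightarrow> real) set" where
  "real_dist = {f. integrable sph f \<and> (\<forall>\<omega> \<in> space sph. 0 \<le> f \<omega>) \<and> 0 < sphavg f}"

definition realizable :: "real \<Rightarrow> four \<Rightarrow> bool" where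
  "realizable J H \<longleftrightarrow> 0 < J \<and> sqrt (mink H H) \<le> J"

definition eul_real :: "mom set" where
  "eul_real = {U. realizable (fst U) (0, snd U)}"

definition lag_real :: "real^3 \<Rightarrow> mom set" where
  "lag_real v = {M. realizable (fst M) (- (v \<bullet> snd M), snd M)}"

definition lag_mom :: "real \<Rightarrow> real^3 \<Rightarrow> (real \<times> real \<Rightarrow> real) \<Rightarrow> mom" where
  "lag_mom \<epsilon> v f = \<epsilon> *\<^sub>R sphavg (\<lambda>\<omega>. f \<omega> *\<^sub>R (1, snd (ell4 v \<omega>)))"

definition K_mom :: "real \<Rightarrow> real^3 \<Rightarrow> (real \<times> real \<Rightarrow> real) \<Rightarrow> real^3^3" where
  "K_mom \<epsilon> v f = (\<chi> i j. \<epsilon> * sphavg (\<lambda>\<omega>. f \<omega> * (snd (ell4 v \<omega>) $ i) * (snd (ell4 v \<omega>) $ j)))"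

definition U_mom :: "real \<Rightarrow> real^3 \<Rightarrow> (real \<times> real \<Rightarrow> real) \<Rightarrow> mom" where
  "U_mom \<epsilon> v f = sphavg (\<lambda>\<omega>. ((energy \<epsilon> v \<omega>)\<^sup>2 / \<epsilon> * f \<omega>) *\<^sub>R (1, snd (L4 \<epsilon> v \<omega>)))"

definition F_mom :: "3 \<Rightarrow> real \<Rightarrow> real^3 \<Rightarrow> (real \<times> real \<Rightarrow> real) \<Rightarrow> mom" where
  "F_mom i \<epsilon> v f = sphavg (\<lambda>\<omega>. ((energy \<epsilon> v \<omega>)\<^sup>2 / \<epsilon> * f \<omega> * (snd (L4 \<epsilon> v \<omega>) $ i))
     *\<^sub>R (1, snd (L4 \<epsilon> v \<omega>)))"

definition Ut_mom :: "real \<Rightarrow> real^3 \<Rightarrow> (real \<times> real \<Rightarrow> real) \<Rightarrow> mom" where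
  "Ut_mom \<epsilon> v f = sphavg (\<lambda>\<omega>. (energy \<epsilon> v \<omega> * f \<omega>) *\<^sub>R (1, snd (L4 \<epsilon> v \<omega>)))"

definition Feps_mom ::
  "(four \<Rightarrow> four \<Rightarrow> real) \<Rightarrow> real \<Rightarrow> real^3 \<Rightarrow> (real \<times> real \<Rightarrow> real) \<Rightarrow> mom" where
  "Feps_mom G \<epsilon> v f = - sphavg (\<lambda>\<omega>. (qfac G \<epsilon> v \<omega> * energy \<epsilon> v \<omega> * f \<omega>)
     *\<^sub>R (1, snd (L4 \<epsilon> v \<omega>)))"

text \<open>A closure consists of \<open>cl\<close>, sending energy, velocity and Lagrangian moments to a
  distribution, and \<open>pr\<close>, sending energy, velocity and Eulerian moments to Lagrangian ones.
  That it is exact is stated value by value: an integrable \<open>f\<close> always has moments with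
  \<open>\<J> > |\<H>|\<close>, so asking for a closing \<open>f\<close> at every element of \<open>eul_real\<close> or
  \<open>lag_real v\<close>, which contain the boundary, would be contradictory.\<close>

type_synonym closure = "real \<Rightarrow> real^3 \<Rightarrow> mom \<Rightarrow> real \<times> real \<Rightarrow> real"
type_synonym conversion = "real \<Rightarrow> real^3 \<Rightarrow> mom \<Rightarrow> mom"

definition closed_lag :: "closure \<Rightarrow> real \<Rightarrow> real^3 \<Rightarrow> mom \<Rightarrow> bool" where
  "closed_lag cl \<epsilon> v M \<longleftrightarrow> cl \<epsilon> v M \<in> real_dist \<and> lag_mom \<epsilon> v (cl \<epsilon> v M) = M"

definition closed_eul :: "closure \<Rightarrow> conversion \<Rightarrow> real \<Rightarrow> real^3 \<Rightarrow> mom \<Rightarrow> bool" where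
  "closed_eul cl pr \<epsilon> v U \<longleftrightarrow>
     closed_lag cl \<epsilon> v (pr \<epsilon> v U) \<and> U_mom \<epsilon> v (cl \<epsilon> v (pr \<epsilon> v U)) = U"


section \<open>Legendre--Gauss and Legendre--Gauss--Lobatto quadrature\<close>

fun legendre :: "nat \<Rightarrow> real poly" where
  "legendre 0 = 1"
| "legendre (Suc 0) = [:0, 1:]"
| "legendre (Suc (Suc n)) = smult (1 / real (n + 2))
     (smult (real (2 * n + 3)) ([:0, 1:] * legendre (Suc n)) - smult (real (n + 1)) (legendre n))"

text \<open>Nodes on the reference interval \<open>[-1, 1]\<close> (all zeros of \<open>P_N\<close> and of \<open>P_(M-1)'\<close> lie in its
  interior), with the classical weights halved so that they sum to 1.\<close>

definition LG :: "nat \<Rightarrow> real set" where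
  "LG N = {y. -1 < y \<and> y < 1 \<and> poly (legendre N) y = 0}"

definition LG_wt :: "nat \<Rightarrow> real \<Rightarrow> real" where
  "LG_wt N y = 1 / ((1 - y\<^sup>2) * (poly (pderiv (legendre N)) y)\<^sup>2)"

definition LGL :: "nat \<Rightarrow> real set" where
  "LGL M = {-1, 1} \<union> {y. -1 < y \<and> y < 1 \<and> poly (pderiv (legendre (M - 1))) y = 0}"

definition LGL_wt :: "nat \<Rightarrow> real \<Rightarrow> real" where
  "LGL_wt M y = 1 / (real M * real (M - 1) * (poly (legendre (M - 1)) y)\<^sup>2)"

definition aff :: "real \<Rightarrow> real \<Rightarrow> real \<Rightarrow> real" where
  "aff a b y = (a + b) / 2 + (b - a) / 2 * y"

definition quad_exact ::
  "real set \<Rightarrow> (real \<Rightarrow> real) \<Rightarrow> real \<Rightarrow> real \<Rightarrow> (real \<Rightarrow> 'b::real_normed_vector) \<Rightarrow> bool" where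
  "quad_exact nodes w a b g \<longleftrightarrow>
     (1 / (b - a)) *\<^sub>R integral {a..b} g = (\<Sum>y\<in>nodes. w y *\<^sub>R g (aff a b y))"


section \<open>Mesh\<close>

record ('d::finite) cell =
  eL :: real
  eH :: real
  xL :: "real^'d"
  xH :: "real^'d"

definition cell_open :: "'d::finite cell \<Rightarrow> (real \<times> (real^'d)) set" where
  "cell_open K = {eL K<..<eH K} \<times> box (xL K) (xH K)"

definition cell_closed :: "'d::finite cell \<Rightarrow> (real \<times> (real^'d)) set" where
  "cell_closed K = {eL K..eH K} \<times> cbox (xL K) (xH K)"

definition de :: "'d::finite cell \<Rightarrow> real" where
  "de K = eH K - eL K"

definition dx :: "'d::finite cell \<Rightarrow> 'd \<Rightarrow> real" where
  "dx K l = xH K $ l - xL K $ l"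

definition vol_eps :: "'d::finite cell \<Rightarrow> real" where
  "vol_eps K = integral {eL K..eH K} (\<lambda>\<epsilon>. \<epsilon>\<^sup>2)"

definition vol :: "'d::finite cell \<Rightarrow> real" where
  "vol K = vol_eps K * (\<Prod>l\<in>UNIV. dx K l)"

text \<open>\<open>next_eps K K'\<close>: the two cells share the face at the upper energy of \<open>K\<close> and the lower
  energy of \<open>K'\<close>; \<open>next_x l K K'\<close> likewise in direction \<open>l\<close>.\<close>

definition next_eps :: "'d::finite cell \<Rightarrow> 'd cell \<Rightarrow> bool" where
  "next_eps K K' \<longleftrightarrow> eL K' = eH K \<and> xL K' = xL K \<and> xH K' = xH K"

definition next_x :: "'d::finite \<Rightarrow> 'd cell \<Rightarrow> 'd cell \<Rightarrow> bool" where
  "next_x l K K' \<longleftrightarrow> eL K' = eL K \<and> eH K' = eH K \<and> xL K' $ l = xH K $ l \<and>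
     (\<forall>j. j \<noteq> l \<longrightarrow> xL K' $ j = xL K $ j \<and> xH K' $ j = xH K $ j)"

text \<open>A conforming division of \<open>\<Omega>\<^sub>\<epsilon> \<times> \<Omega>\<^sub>x\<close>: every face is shared with a neighbour or lies on the
  boundary.  Cells are open boxes inside \<open>{0<..} \<times> \<Omega>\<^sub>x\<close>, so a cell may start at zero energy.\<close>

definition mesh :: "real set \<Rightarrow> (real^'d::finite) set \<Rightarrow> 'd cell set \<Rightarrow> bool" where
  "mesh \<Omega>e \<Omega>x T \<longleftrightarrow>
     finite T \<and> \<Omega>e \<subseteq> {0<..} \<and>
     (\<forall>K\<in>T. eL K < eH K \<and> (\<forall>l. xL K $ l < xH K $ l) \<and> cell_open K \<subseteq> \<Omega>e \<times> \<Omega>x) \<and>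
     (\<forall>K\<in>T. \<forall>K'\<in>T. K \<noteq> K' \<longrightarrow> cell_open K \<inter> cell_open K' = {}) \<and>
     (\<Union>K\<in>T. cell_closed K) = closure (\<Omega>e \<times> \<Omega>x) \<and>
     (\<forall>K\<in>T.
        ((\<exists>K'\<in>T. next_eps K K') \<or> {z \<in> cell_closed K. fst z = eH K} \<subseteq> frontier (\<Omega>e \<times> \<Omega>x)) \<and>
        ((\<exists>K'\<in>T. next_eps K' K) \<or> {z \<in> cell_closed K. fst z = eL K} \<subseteq> frontier (\<Omega>e \<times> \<Omega>x)) \<and>
        (\<forall>l.
          ((\<exists>K'\<in>T. next_x l K K') \<or>
             {z \<in> cell_closed K. snd z $ l = xH K $ l} \<subseteq> frontier (\<Omega>e \<times> \<Omega>x)) \<and>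
          ((\<exists>K'\<in>T. next_x l K' K) \<or>
             {z \<in> cell_closed K. snd z $ l = xL K $ l} \<subseteq> frontier (\<Omega>e \<times> \<Omega>x))))"

text \<open>A discrete field is given on each cell by a function defined up to and beyond the cell
  boundary; its values on the closed cell are the values inside and the one-sided traces.\<close>

type_synonym 'd field = "'d cell \<Rightarrow> real \<Rightarrow> real^'d \<Rightarrow> mom"

definition tensor_poly :: "nat \<Rightarrow> (real \<Rightarrow> real^'d::finite \<Rightarrow> mom) \<Rightarrow> bool" where
  "tensor_poly k g \<longleftrightarrow> (\<exists>c. \<forall>\<epsilon> x. g \<epsilon> x =
     (\<Sum>a\<le>k. \<Sum>\<alpha>\<in>{\<alpha>. \<forall>l. \<alpha> l \<le> k}. (\<epsilon> ^ a * (\<Prod>l\<in>UNIV. (x $ l) ^ \<alpha> l)) *\<^sub>R c a \<alpha>))"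

definition set_coord :: "real^'d::finite \<Rightarrow> 'd \<Rightarrow> real \<Rightarrow> real^'d" where
  "set_coord x l t = (\<chi> j. if j = l then t else x $ j)"

definition exact_eps ::
  "real set \<Rightarrow> (real \<Rightarrow> real) \<Rightarrow> 'd::finite cell \<Rightarrow> (real \<Rightarrow> real^'d \<Rightarrow> mom) \<Rightarrow> bool" where
  "exact_eps nodes w K g \<longleftrightarrow> (\<forall>x\<in>cbox (xL K) (xH K).
     quad_exact nodes w (eL K) (eH K) (\<lambda>\<epsilon>. \<epsilon>\<^sup>2 *\<^sub>R g \<epsilon> x))"

definition exact_x ::
  "real set \<Rightarrow> (real \<Rightarrow> real) \<Rightarrow> 'd::finite \<Rightarrow> 'd cell \<Rightarrow> (real \<Rightarrow> real^'d \<Rightarrow> mom) \<Rightarrow> bool" where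
  "exact_x nodes w l K g \<longleftrightarrow> (\<forall>(\<epsilon>, x)\<in>cell_closed K.
     quad_exact nodes w (xL K $ l) (xH K $ l) (\<lambda>t. g \<epsilon> (set_coord x l t)))"

definition tensor_nodes ::
  "'d::finite cell \<Rightarrow> real set \<Rightarrow> ('d \<Rightarrow> real set) \<Rightarrow> (real \<times> (real^'d)) set" where
  "tensor_nodes K A B = {(\<epsilon>, x). \<epsilon> \<in> aff (eL K) (eH K) ` A \<and>
     (\<forall>l. x $ l \<in> aff (xL K $ l) (xH K $ l) ` B l)}"

definition S_all :: "nat \<Rightarrow> nat \<Rightarrow> nat \<Rightarrow> 'd::finite cell \<Rightarrow> (real \<times> (real^'d)) set" where
  "S_all N Me Mx K =
     tensor_nodes K (LG N) (\<lambda>_. LG N) \<union>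
     tensor_nodes K (LGL Me) (\<lambda>_. LG N) \<union>
     (\<Union>l. tensor_nodes K (LG N) ((\<lambda>_. LG N)(l := LGL Mx)))"

definition cell_avg :: "'d::finite cell \<Rightarrow> (real \<Rightarrow> real^'d \<Rightarrow> mom) \<Rightarrow> mom" where
  "cell_avg K g = (1 / vol K) *\<^sub>R integral (cell_closed K) (\<lambda>(\<epsilon>, x). \<epsilon>\<^sup>2 *\<^sub>R g \<epsilon> x)"

text \<open>Tensor LG quadrature for the integral over \<open>K\<^sub>x\<close>, and for the integral with weight \<open>\<epsilon>\<^sup>2\<close>
  over the face of \<open>K\<close> on which the coordinate \<open>l\<close> equals \<open>t\<close>.\<close>

definition face_eps :: "nat \<Rightarrow> 'd::finite cell \<Rightarrow> (real^'d \<Rightarrow> mom) \<Rightarrow> mom" where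
  "face_eps N K g = (\<Prod>j\<in>UNIV. dx K j) *\<^sub>R
     (\<Sum>y\<in>(\<Pi>\<^sub>E j\<in>UNIV. LG N). (\<Prod>j\<in>UNIV. LG_wt N (y j)) *\<^sub>R
        g (\<chi> j. aff (xL K $ j) (xH K $ j) (y j)))"

definition face_x ::
  "nat \<Rightarrow> 'd::finite \<Rightarrow> 'd cell \<Rightarrow> real \<Rightarrow> (real \<Rightarrow> real^'d \<Rightarrow> mom) \<Rightarrow> mom" where
  "face_x N l K t g = (de K * (\<Prod>j\<in>UNIV - {l}. dx K j)) *\<^sub>R
     (\<Sum>y0\<in>LG N. \<Sum>y\<in>(\<Pi>\<^sub>E j\<in>UNIV - {l}. LG N).
        (LG_wt N y0 * (\<Prod>j\<in>UNIV - {l}. LG_wt N (y j))) *\<^sub>R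
        ((aff (eL K) (eH K) y0)\<^sup>2 *\<^sub>R
           g (aff (eL K) (eH K) y0)
             (\<chi> j. if j = l then t else aff (xL K $ j) (xH K $ j) (y j))))"


section \<open>Fluxes and explicit update\<close>

text \<open>Trace from the other side of a face of \<open>K\<close>: the value in the neighbour \<open>K'\<close> satisfying \<open>P\<close>
  (unique in a mesh) or, on the boundary of the domain, the boundary data \<open>B\<close>.\<close>

definition ext_trace ::
  "'d::finite cell set \<Rightarrow> 'd field \<Rightarrow> 'd field \<Rightarrow> 'd cell \<Rightarrow> ('d cell \<Rightarrow> bool)
     \<Rightarrow> real \<Rightarrow> real^'d \<Rightarrow> mom" where
  "ext_trace T U B K P \<epsilon> x =
     (if \<exists>K'\<in>T. P K' then U (SOME K'. K' \<in> T \<and> P K') \<epsilon> x else B K \<epsilon> x)"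

definition flux_x ::
  "closure \<Rightarrow> conversion \<Rightarrow> (real^'d::finite \<Rightarrow> real^3) \<Rightarrow> 3 \<Rightarrow> real \<Rightarrow> real \<Rightarrow> real^'d
     \<Rightarrow> mom \<Rightarrow> mom \<Rightarrow> mom" where
  "flux_x cl pr v i a \<epsilon> x Um Up =
     (let F = (\<lambda>U. F_mom i \<epsilon> (v x) (cl \<epsilon> (v x) (pr \<epsilon> (v x) U)))
      in (1/2) *\<^sub>R (F Um + F Up - a *\<^sub>R (Up - Um)))"

definition flux_eps ::
  "closure \<Rightarrow> conversion \<Rightarrow> (real^'d::finite \<Rightarrow> real^3) \<Rightarrow> (real^'d \<Rightarrow> four \<Rightarrow> four \<Rightarrow> real)
     \<Rightarrow> (real^'d \<Rightarrow> real) \<Rightarrow> real \<Rightarrow> real^'d \<Rightarrow> mom \<Rightarrow> mom \<Rightarrow> mom" where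
  "flux_eps cl pr v G a \<epsilon> x Um Up =
     (let f = (\<lambda>U. cl \<epsilon> (v x) (pr \<epsilon> (v x) U));
          F = (\<lambda>U. Feps_mom (G x) \<epsilon> (v x) (f U));
          Ut = (\<lambda>U. Ut_mom \<epsilon> (v x) (f U))
      in (1/2) *\<^sub>R (F Um + F Up - a x *\<^sub>R (Ut Up - Ut Um)))"

text \<open>The map \<open>dir\<close> tells which of the three spatial directions a mesh coordinate stands for.\<close>

definition transport ::
  "closure \<Rightarrow> conversion \<Rightarrow> (real^'d::finite \<Rightarrow> real^3) \<Rightarrow> (real^'d \<Rightarrow> four \<Rightarrow> four \<Rightarrow> real)
     \<Rightarrow> (real^'d \<Rightarrow> real) \<Rightarrow> ('d \<Rightarrow> real) \<Rightarrow> ('d \<Rightarrow> 3) \<Rightarrow> nat \<Rightarrow> 'd cell set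
     \<Rightarrow> 'd field \<Rightarrow> 'd field \<Rightarrow> 'd cell \<Rightarrow> mom" where
  "transport cl pr v G aeps ax dir N T B U K =
     - (1 / vol K) *\<^sub>R
         (face_eps N K (\<lambda>x. (eH K)^3 *\<^sub>R flux_eps cl pr v G aeps (eH K) x
              (U K (eH K) x) (ext_trace T U B K (\<lambda>K'. next_eps K K') (eH K) x))
        - face_eps N K (\<lambda>x. (eL K)^3 *\<^sub>R flux_eps cl pr v G aeps (eL K) x
              (ext_trace T U B K (\<lambda>K'. next_eps K' K) (eL K) x) (U K (eL K) x)))
     - (\<Sum>l\<in>UNIV. (1 / vol K) *\<^sub>R
         (face_x N l K (xH K $ l) (\<lambda>\<epsilon> x. flux_x cl pr v (dir l) (ax l) \<epsilon> x
              (U K \<epsilon> x) (ext_trace T U B K (\<lambda>K'. next_x l K K') \<epsilon> x))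
        - face_x N l K (xL K $ l) (\<lambda>\<epsilon> x. flux_x cl pr v (dir l) (ax l) \<epsilon> x
              (ext_trace T U B K (\<lambda>K'. next_x l K' K) \<epsilon> x) (U K \<epsilon> x))))"

text \<open>The argument \<open>TU j\<close> stands for the transport term of stage \<open>j\<close> on \<open>K\<close>.\<close>

definition explicit_stage ::
  "(nat \<Rightarrow> nat \<Rightarrow> real) \<Rightarrow> (nat \<Rightarrow> nat \<Rightarrow> real) \<Rightarrow> real \<Rightarrow> (nat \<Rightarrow> mom) \<Rightarrow> (nat \<Rightarrow> mom) \<Rightarrow> nat \<Rightarrow> mom"
  where
  "explicit_stage c ch dt UK TU i = (\<Sum>j<i. c i j *\<^sub>R (UK j + (ch i j * dt) *\<^sub>R TU j))"

text \<open>The time step restriction, cleared of denominators: a vanishing \<open>aeps\<close> or \<open>ch i j\<close>, for which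
  the corresponding quotient is \<open>\<infinity>\<close>, imposes no condition.  The velocity and \<open>aeps\<close> vary over
  the cell, so the minimum includes the points of \<open>K\<^sub>x\<close>.\<close>

definition time_step_ok ::
  "(real^'d::finite \<Rightarrow> real^3) \<Rightarrow> (real^'d \<Rightarrow> real) \<Rightarrow> ('d \<Rightarrow> real) \<Rightarrow> nat \<Rightarrow> nat \<Rightarrow> 'd cell set
     \<Rightarrow> (nat \<Rightarrow> nat \<Rightarrow> real) \<Rightarrow> nat \<Rightarrow> real \<Rightarrow> bool" where
  "time_step_ok v aeps ax Me Mx T ch s dt \<longleftrightarrow>
     (\<forall>i\<in>{1..s}. \<forall>j<i. \<forall>K\<in>T.
        (\<forall>x\<in>box (xL K) (xH K).
           ch i j * dt * (real (CARD('d) + 1) * eH K * aeps x)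
             \<le> lorentz (v x) * (1 - norm (v x)) * (LGL_wt Me 1 * de K)) \<and>
        (\<forall>l. ch i j * dt * (real (CARD('d) + 1) * ax l) \<le> LGL_wt Mx 1 * dx K l))"


section \<open>Implicit update\<close>

definition A_map :: "real^3 \<Rightarrow> mom \<Rightarrow> mom" where
  "A_map v U = (lorentz v * fst U + v \<bullet> snd U, snd U + (lorentz v * fst U) *\<^sub>R v)"

definition U_hat :: "closure \<Rightarrow> real \<Rightarrow> real^3 \<Rightarrow> mom \<Rightarrow> mom" where
  "U_hat cl \<epsilon> v M = (lorentz v * fst M + v \<bullet> snd M,
     lorentz v *\<^sub>R snd M + v v* K_mom \<epsilon> v (cl \<epsilon> v M))"

definition C_hat :: "real \<Rightarrow> real \<Rightarrow> real \<Rightarrow> mom \<Rightarrow> mom" where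
  "C_hat chi \<kappa> Jeq M = (chi * (Jeq - fst M), - \<kappa> *\<^sub>R snd M)"

definition precond :: "real^3 \<Rightarrow> real \<Rightarrow> real \<Rightarrow> real \<Rightarrow> real \<Rightarrow> mom \<Rightarrow> mom" where
  "precond v lam d\<tau> chi \<kappa> R =
     (fst R / (lorentz v + lam * d\<tau> * chi), (1 / (lorentz v + lam * d\<tau> * \<kappa>)) *\<^sub>R snd R)"

definition richardson ::
  "closure \<Rightarrow> real \<Rightarrow> real^3 \<Rightarrow> real \<Rightarrow> real \<Rightarrow> real \<Rightarrow> real \<Rightarrow> real \<Rightarrow> mom \<Rightarrow> nat \<Rightarrow> mom" where
  "richardson cl \<epsilon> v lam d\<tau> chi \<kappa> Jeq Ustar n =
     ((\<lambda>M. M - lam *\<^sub>R precond v lam d\<tau> chi \<kappa>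
         (U_hat cl \<epsilon> v M - Ustar - d\<tau> *\<^sub>R C_hat chi \<kappa> Jeq M)) ^^ n) Ustar"

end

theory Submission
  imports Defs
begin

text \<open>
  Let \<open>C\<close> be the closed cone of pairs \<open>(\<E>, \<F>)\<close> with \<open>|\<F>| \<le> \<E>\<close>; a pair is realizable if it lies in
  \<open>C\<close> and has \<open>\<E> > 0\<close>.  The average of \<open>f \<psi> (1, L)\<close> over the sphere lies in \<open>C\<close> whenever
  \<open>f, \<psi> \<ge> 0\<close>, because \<open>|L| = 1\<close>.

  For the explicit step, write \<open>d + 1\<close> copies of the cell average with LGL points in one dimension and
  LG points in the others, and give one copy to each pair of opposite faces.  On a face the CFL
  condition absorbs the flux into the endpoint value: by \<open>a\<^sup>\<epsilon> \<ge> |q|\<close>, \<open>a\<^sup>l \<ge> 1 \<ge> |L\<^sub>l|\<close> and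
  \<open>E \<ge> \<epsilon> W (1 - v)\<close>, what remains is an average of the above form.  The inequality may be tight at the
  endpoints, so positivity of \<open>\<E>\<close> comes from an interior LGL point in energy, which exists for
  \<open>M\<^sub>\<epsilon> \<ge> 3\<close>.

  For the implicit step, \<open>A\<close> carries Lagrangian pairs to Eulerian ones, preserving realizability in both
  directions, with \<open>A M\<close> the average of \<open>E f (1, L)\<close> and \<open>A U_hat M\<close> the average of
  \<open>E\<^sup>2 f (1, L) / \<epsilon>\<close>.  Since \<open>E \<le> \<epsilon> W (1 + v)\<close>, the bound on \<open>\<lambda>\<close> makes \<open>A (W M - \<lambda> U_hat M)\<close> an average
  with a nonnegative weight, so every iterate is realizable; its scalar part is bounded below by a
  positive constant, which keeps the limit realizable.
\<close>

section \<open>Legendre polynomials and quadrature nodes\<close>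

lemma poly_legendre_Suc_Suc:
  "real (n + 2) * poly (legendre (Suc (Suc n))) x
     = real (2 * n + 3) * x * poly (legendre (Suc n)) x - real (n + 1) * poly (legendre n) x"
  by (simp add: field_simps)

lemma poly_pderiv_legendre_Suc_Suc:
  "real (n + 2) * poly (pderiv (legendre (Suc (Suc n)))) x
     = real (2 * n + 3) * (poly (legendre (Suc n)) x + x * poly (pderiv (legendre (Suc n))) x)
       - real (n + 1) * poly (pderiv (legendre n)) x"
proof -
  have "smult (real (n + 2)) (legendre (Suc (Suc n)))
     = smult (real (2 * n + 3)) ([:0, 1:] * legendre (Suc n)) - smult (real (n + 1)) (legendre n)"
    by (simp del: of_nat_add)
  then have "poly (pderiv (smult (real (n + 2)) (legendre (Suc (Suc n))))) x
     = poly (pderiv (smult (real (2 * n + 3)) ([:0, 1:] * legendre (Suc n))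
         - smult (real (n + 1)) (legendre n))) x"
    by (simp only:)
  then show ?thesis
    by (simp only: pderiv_smult pderiv_diff pderiv_mult poly_smult poly_diff poly_mult poly_add
        pderiv_pCons) (simp add: algebra_simps)
qed

text \<open>The two relations share one induction. Differentiating the three-term recurrence
  expresses the next derivative through the two before it, and the second relation eliminates the
  older one; the second relation at the next degree then follows from the first.\<close>

lemma legendre_derivative_relations:
  "poly (pderiv (legendre (Suc n))) x
     = x * poly (pderiv (legendre n)) x + real (n + 1) * poly (legendre n) x"
  "x * poly (pderiv (legendre (Suc n))) x
     = poly (pderiv (legendre n)) x + real (n + 1) * poly (legendre (Suc n)) x"
proof (induction n)
  case 0
  show "poly (pderiv (legendre (Suc 0))) x
     = x * poly (pderiv (legendre 0)) x + real (0 + 1) * poly (legendre 0) x"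
    by (simp add: pderiv_pCons)
  show "x * poly (pderiv (legendre (Suc 0))) x
     = poly (pderiv (legendre 0)) x + real (0 + 1) * poly (legendre (Suc 0)) x"
    by (simp add: pderiv_pCons)
next
  case (Suc n)
  define P where "P m = poly (legendre m) x" for m
  define D where "D m = poly (pderiv (legendre m)) x" for m
  have A: "D (Suc n) = x * D n + real (n + 1) * P n"
    and B: "x * D (Suc n) = D n + real (n + 1) * P (Suc n)"
    using Suc by (simp_all only: P_def D_def)
  have R: "real (n + 2) * P (Suc (Suc n)) = real (2 * n + 3) * x * P (Suc n) - real (n + 1) * P n"
    unfolding P_def by (rule poly_legendre_Suc_Suc)
  have S: "real (n + 2) * D (Suc (Suc n))
      = real (2 * n + 3) * (P (Suc n) + x * D (Suc n)) - real (n + 1) * D n"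
    unfolding P_def D_def by (rule poly_pderiv_legendre_Suc_Suc)
  define m where "m = real n + 1"
  have A': "D (Suc n) = x * D n + m * P n" and B': "D n = x * D (Suc n) - m * P (Suc n)"
    and R': "(m + 1) * P (Suc (Suc n)) = (2 * m + 1) * x * P (Suc n) - m * P n"
    and S': "(m + 1) * D (Suc (Suc n)) = (2 * m + 1) * (P (Suc n) + x * D (Suc n)) - m * D n"
    using A B R S by (simp_all add: m_def algebra_simps)
  have "(m + 1) * D (Suc (Suc n)) = (m + 1) * (x * D (Suc n) + (m + 1) * P (Suc n))"
    unfolding S' B' by (simp add: algebra_simps)
  moreover have "m + 1 \<noteq> 0"
    by (simp add: m_def)
  ultimately have A2: "D (Suc (Suc n)) = x * D (Suc n) + (m + 1) * P (Suc n)"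
    by (metis mult_left_cancel)
  have "x * D (Suc (Suc n)) = D (Suc n) + (m + 1) * P (Suc (Suc n))"
    unfolding A2 R' using A' B' by algebra
  with A2 show "poly (pderiv (legendre (Suc (Suc n)))) x
       = x * poly (pderiv (legendre (Suc n))) x + real (Suc n + 1) * poly (legendre (Suc n)) x"
    and "x * poly (pderiv (legendre (Suc (Suc n)))) x
       = poly (pderiv (legendre (Suc n))) x + real (Suc n + 1) * poly (legendre (Suc (Suc n))) x"
    by (simp_all only: P_def D_def m_def) (simp_all add: algebra_simps)
qed

lemma legendre_pderiv_recurrence:
  "(x\<^sup>2 - 1) * poly (pderiv (legendre (Suc n))) x
     = real (n + 1) * (x * poly (legendre (Suc n)) x - poly (legendre n) x)"
  using legendre_derivative_relations(1)[of n x] legendre_derivative_relations(2)[of x n] by algebra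

text \<open>The Legendre equation in divergence form. By \<open>legendre_pderiv_recurrence\<close>
  the differentiated function is a combination of two neighbouring Legendre polynomials, so no
  second derivative occurs.\<close>

lemma legendre_ode:
  "((\<lambda>x. (x\<^sup>2 - 1) * poly (pderiv (legendre n)) x) has_real_derivative
     real (n * (n + 1)) * poly (legendre n) x) (at x)"
proof (cases n)
  case 0
  then show ?thesis by (simp add: pderiv_1)
next
  case (Suc m)
  have "((\<lambda>x. real (m + 1) * (x * poly (legendre (Suc m)) x - poly (legendre m) x))
      has_real_derivative real (m + 1) * (1 * poly (legendre (Suc m)) x
        + x * poly (pderiv (legendre (Suc m))) x - poly (pderiv (legendre m)) x)) (at x)"
    by (auto intro!: derivative_eq_intros)
  moreover have "real (m + 1) * (1 * poly (legendre (Suc m)) x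
        + x * poly (pderiv (legendre (Suc m))) x - poly (pderiv (legendre m)) x)
     = real (n * (n + 1)) * poly (legendre n) x"
    using legendre_derivative_relations(2)[of x m] by (simp add: Suc algebra_simps)
  ultimately show ?thesis
    by (simp only: legendre_pderiv_recurrence Suc)
qed

section \<open>Endpoint values and location of the roots\<close>

lemma legendre_one: "poly (legendre n) 1 = 1"
proof -
  have "poly (legendre n) 1 = 1 \<and> poly (legendre (Suc n)) 1 = 1"
    by (induction n) (simp_all add: field_simps)
  then show ?thesis by simp
qed

lemma legendre_minus_one: "poly (legendre n) (-1) = (-1) ^ n"
proof -
  have "poly (legendre n) (-1) = (-1) ^ n \<and> poly (legendre (Suc n)) (-1) = (-1) ^ Suc n"
    by (induction n) (simp_all add: field_simps)
  then show ?thesis by simp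
qed

text \<open>A common zero of two neighbours would descend along the three-term recurrence to the
  constant 1.\<close>

lemma legendre_no_common_root:
  "poly (legendre (Suc n)) x \<noteq> 0 \<or> poly (legendre n) x \<noteq> 0"
proof (induction n)
  case (Suc n)
  then show ?case using poly_legendre_Suc_Suc[of n x] by auto
qed simp

text \<open>If the derivative vanished too, \<open>legendre_pderiv_recurrence\<close> would make the
  preceding polynomial vanish at the same point. Simplicity keeps the denominators of the Gauss and
  Lobatto weights away from zero.\<close>

lemma legendre_simple_root:
  assumes "poly (legendre n) x = 0"
  shows "poly (pderiv (legendre n)) x \<noteq> 0"
proof (cases n)
  case 0
  with assms show ?thesis by simp
next
  case (Suc m)
  then show ?thesis
    using legendre_pderiv_recurrence[of x m] legendre_no_common_root[of m x] assms by auto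
qed

text \<open>Rolle's theorem for \<open>(x\<^sup>2 - 1) P\<^sub>n'\<close>, whose derivative is \<open>n (n + 1) P\<^sub>n\<close>.\<close>

lemma legendre_root_exists:
  assumes "1 \<le> n"
  shows "\<exists>x. -1 < x \<and> x < 1 \<and> poly (legendre n) x = 0"
proof -
  obtain x where "-1 < x" "x < (1::real)" "real (n * (n + 1)) * poly (legendre n) x = 0"
  proof -
    have "\<exists>l z. -1 < z \<and> z < (1::real) \<and>
        ((\<lambda>x. (x\<^sup>2 - 1) * poly (pderiv (legendre n)) x) has_real_derivative l) (at z) \<and>
        (1\<^sup>2 - 1) * poly (pderiv (legendre n)) 1 - ((-1)\<^sup>2 - 1) * poly (pderiv (legendre n)) (-1)
          = (1 - (-1)) * l"
      by (rule MVT) (use legendre_ode in \<open>auto intro!: continuous_intros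
          simp: real_differentiable_def\<close>)
    then show ?thesis
      using that DERIV_unique[OF _ legendre_ode] by force
  qed
  moreover have "real (n * (n + 1)) \<noteq> 0"
    using assms by (simp del: of_nat_mult)
  ultimately show ?thesis by auto
qed

text \<open>Rolle's theorem for \<open>(x\<^sup>2 - 1)\<^sup>2 P\<^sub>n''\<close>, written without second derivatives by means of the
  Legendre equation.\<close>

lemma pderiv_legendre_root_exists:
  assumes "2 \<le> n"
  shows "\<exists>x. -1 < x \<and> x < 1 \<and> poly (pderiv (legendre n)) x = 0"
proof -
  define c where "c = real (n * (n + 1))"
  define P where "P = poly (legendre n)"
  define D where "D = poly (pderiv (legendre n))"
  define g where "g x = c * (x\<^sup>2 - 1) * P x - 2 * x * ((x\<^sup>2 - 1) * D x)" for x
  have der: "(g has_real_derivative (c - 2) * (x\<^sup>2 - 1) * D x) (at x)" for x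
  proof -
    have "((\<lambda>x. (x\<^sup>2 - 1) * D x) has_real_derivative c * P x) (at x)"
      unfolding P_def D_def c_def by (rule legendre_ode)
    moreover have "(P has_real_derivative D x) (at x)"
      unfolding P_def D_def by (rule poly_DERIV)
    ultimately have "((\<lambda>x. c * (x\<^sup>2 - 1) * P x - 2 * x * ((x\<^sup>2 - 1) * D x)) has_real_derivative
        (c * (2 * x) * P x + D x * (c * (x\<^sup>2 - 1)))
        - (2 * ((x\<^sup>2 - 1) * D x) + c * P x * (2 * x))) (at x)"
      by (intro DERIV_diff DERIV_mult) (auto intro!: derivative_eq_intros)
    then show ?thesis
      unfolding g_def[abs_def] by (rule back_subst) (simp add: algebra_simps)
  qed
  have "\<exists>l z. -1 < z \<and> z < (1::real) \<and> (g has_real_derivative l) (at z) \<and>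
      g 1 - g (-1) = (1 - (-1)) * l"
    by (rule MVT) (use der in \<open>auto simp: real_differentiable_def
        intro!: continuous_at_imp_continuous_on DERIV_isCont[OF der]\<close>)
  then obtain z where z: "-1 < z" "z < 1" "(c - 2) * (z\<^sup>2 - 1) * D z = 0"
    using DERIV_unique[OF _ der] by (force simp: g_def)
  \<comment> \<open>Degree at least 2 enters here: for degree 1 one has c = 2, the derivative of
    \<open>g\<close> vanishes identically, and Rolle gives nothing.\<close>
  have "2 * 3 \<le> n * (n + 1)"
    using assms by (intro mult_mono) auto
  then have "2 < c"
    unfolding c_def by linarith
  moreover have "z\<^sup>2 < 1"
    using z by (simp add: abs_square_less_1 abs_if)
  ultimately show ?thesis
    using z by (auto simp: D_def)
qed

section \<open>Finiteness of the node sets and positivity of the weights\<close>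

lemma finite_LG: "finite (LG n)"
proof -
  have "legendre n \<noteq> 0"
    using legendre_one[of n] by auto
  then show ?thesis
    by (auto simp: LG_def intro: finite_subset[OF _ poly_roots_finite])
qed

lemma LG_nonempty: "1 \<le> n \<Longrightarrow> LG n \<noteq> {}"
  using legendre_root_exists[of n] by (auto simp: LG_def)

lemma LG_wt_pos:
  assumes "y \<in> LG n"
  shows "0 < LG_wt n y"
proof -
  have "y\<^sup>2 < 1" "poly (pderiv (legendre n)) y \<noteq> 0"
    using assms legendre_simple_root[of n y] by (auto simp: LG_def abs_square_less_1 abs_if)
  then show ?thesis by (simp add: LG_wt_def)
qed

lemma finite_LGL:
  assumes "2 \<le> m"
  shows "finite (LGL m)"
proof -
  obtain n where n: "m - 1 = Suc n"
    using assms by (cases "m - 1") auto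
  \<comment> \<open>A zero of the polynomial is simple, so the derivative is nonzero there and hence
    not the zero polynomial.\<close>
  have "pderiv (legendre (Suc n)) \<noteq> 0"
    using legendre_root_exists[of "Suc n"] legendre_simple_root[of "Suc n"] by auto
  then show ?thesis
    using n by (auto simp: LGL_def simp del: One_nat_def intro: finite_subset[OF _ poly_roots_finite])
qed

lemma LGL_bounds: "y \<in> LGL m \<Longrightarrow> -1 \<le> y \<and> y \<le> 1"
  by (auto simp: LGL_def)

text \<open>At an interior node the derivative vanishes, so the polynomial does not, its zeros being
  simple; at the endpoints it is 1 or -1.\<close>

lemma LGL_wt_pos:
  assumes "2 \<le> m" "y \<in> LGL m"
  shows "0 < LGL_wt m y"
proof -
  have "poly (legendre (m - 1)) y \<noteq> 0"
    using assms legendre_one legendre_minus_one legendre_simple_root by (auto simp: LGL_def)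
  with assms show ?thesis by (simp add: LGL_wt_def)
qed

lemma LGL_wt_minus_one: "LGL_wt m (-1) = LGL_wt m 1"
  by (simp add: LGL_wt_def legendre_one legendre_minus_one flip: power_mult)

lemma LGL_interior_nonempty: "3 \<le> m \<Longrightarrow> LGL m - {-1, 1} \<noteq> {}"
  using pderiv_legendre_root_exists[of "m - 1"] by (force simp: LGL_def)

section \<open>Tensor quadrature of cell averages\<close>

text \<open>Fubini for products: Lebesgue measure is the image of the product measure on coordinates
  under the map that sends coordinates to a linear combination of the basis.\<close>

lemma lborel_integral_prod_Basis:
  fixes G :: "'a::euclidean_space \<Rightarrow> real \<Rightarrow> real"
  assumes "\<And>b. b \<in> Basis \<Longrightarrow> integrable lborel (G b)"
  shows "has_bochner_integral lborel (\<lambda>x. \<Prod>b\<in>Basis. G b (x \<bullet> b)) (\<Prod>b\<in>Basis. \<integral>t. G b t \<partial>lborel)"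
proof -
  interpret product_sigma_finite "\<lambda>b::'a. lborel :: real measure"
    by standard
  have G [measurable]: "G b \<in> borel_measurable borel" if "b \<in> Basis" for b
    using assms[OF that] by auto
  let ?f = "\<lambda>y. \<Sum>b\<in>Basis. y b *\<^sub>R (b::'a)"
  have [measurable]: "?f \<in> measurable (\<Pi>\<^sub>M b\<in>Basis. lborel) borel"
    by measurable
  have "has_bochner_integral (\<Pi>\<^sub>M b\<in>Basis. lborel) (\<lambda>y. \<Prod>b\<in>Basis. G b (y b))
      (\<Prod>b\<in>Basis. \<integral>t. G b t \<partial>lborel)"
    using product_integrable_prod[of Basis G] product_integral_prod[of Basis G] assms
    by (simp add: has_bochner_integral_iff)
  also have "(\<lambda>y. \<Prod>b\<in>Basis. G b (y b)) = (\<lambda>y. \<Prod>b\<in>Basis. G b (?f y \<bullet> b))"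
    by (intro ext prod.cong refl) simp
  finally have "has_bochner_integral (\<Pi>\<^sub>M b\<in>Basis. lborel) (\<lambda>y. \<Prod>b\<in>Basis. G b (?f y \<bullet> b))
      (\<Prod>b\<in>Basis. \<integral>t. G b t \<partial>lborel)" .
  moreover have "(\<lambda>x. \<Prod>b\<in>Basis. G b (x \<bullet> b)) \<in> borel_measurable borel"
    by (intro borel_measurable_prod) measurable
  ultimately have "has_bochner_integral (distr (\<Pi>\<^sub>M b\<in>Basis. lborel) borel ?f)
      (\<lambda>x. \<Prod>b\<in>Basis. G b (x \<bullet> b)) (\<Prod>b\<in>Basis. \<integral>t. G b t \<partial>lborel)"
    by (intro has_bochner_integral_distr) auto
  then show ?thesis
    by (subst lborel_eq)
qed

text \<open>Cutting each factor off outside its interval cuts the product off outside the box, which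
  reduces the claim to an integral over the whole space.\<close>

lemma has_integral_prod_box:
  fixes f :: "'d::finite \<Rightarrow> real \<Rightarrow> real" and a b :: "real^'d"
  assumes cont: "\<And>l. continuous_on {a $ l..b $ l} (f l)"
  shows "((\<lambda>x. \<Prod>l\<in>UNIV. f l (x $ l)) has_integral (\<Prod>l\<in>UNIV. integral {a $ l..b $ l} (f l))) (cbox a b)"
proof -
  define h where "h l t = indicat_real {a $ l..b $ l} t * f l t" for l t
  define e where "e l = (axis l 1 :: real^'d)" for l
  have inj: "inj e"
    by (auto simp: inj_on_def e_def axis_eq_axis)
  have Basis: "Basis = range e"
    by (auto simp: Basis_vec_def e_def)
  have int: "integrable lborel (h l)" and val: "(\<integral>t. h l t \<partial>lborel) = integral {a $ l..b $ l} (f l)" for l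
  proof -
    have s: "set_integrable lborel {a $ l..b $ l} (f l)"
      by (intro borel_integrable_atLeastAtMost' cont)
    then show "integrable lborel (h l)"
      by (simp add: set_integrable_def h_def[abs_def])
    show "(\<integral>t. h l t \<partial>lborel) = integral {a $ l..b $ l} (f l)"
      using set_borel_integral_eq_integral(2)[OF s]
      by (simp add: set_lebesgue_integral_def h_def)
  qed
  have "has_bochner_integral lborel (\<lambda>x. \<Prod>b\<in>Basis. h (inv e b) (x \<bullet> b))
      (\<Prod>b\<in>Basis. \<integral>t. h (inv e b) t \<partial>lborel)"
    using int by (rule lborel_integral_prod_Basis)
  then have "has_bochner_integral lborel (\<lambda>x. \<Prod>l\<in>UNIV. h l (x \<bullet> e l))
      (\<Prod>l\<in>UNIV. \<integral>t. h l t \<partial>lborel)"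
    unfolding Basis prod.reindex[OF inj] by (simp add: inj)
  then have "((\<lambda>x. \<Prod>l\<in>UNIV. h l (x $ l)) has_integral (\<Prod>l\<in>UNIV. integral {a $ l..b $ l} (f l))) UNIV"
    unfolding e_def cart_eq_inner_axis[symmetric] val has_bochner_integral_iff
    by (auto dest: has_integral_integral_lborel)
  also have "(\<lambda>x. \<Prod>l\<in>UNIV. h l (x $ l)) = (\<lambda>x. if x \<in> cbox a b then \<Prod>l\<in>UNIV. f l (x $ l) else 0)"
    by (auto simp: h_def mem_box_cart fun_eq_iff indicator_def)
  finally show ?thesis
    by (simp only: has_integral_restrict_UNIV)
qed

lemma sum_PiE_insert:
  assumes "l \<notin> S"
  shows "(\<Sum>y\<in>Pi\<^sub>E (insert l S) T. h y) = (\<Sum>z\<in>T l. \<Sum>y\<in>Pi\<^sub>E S T. h (y(l := z)))"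
  using inj_combinator[OF assms, of T]
  by (simp add: PiE_insert_eq sum.reindex sum.cartesian_product case_prod_unfold comp_def)

lemma aff_mem: "a \<le> b \<Longrightarrow> -1 \<le> y \<Longrightarrow> y \<le> 1 \<Longrightarrow> aff a b y \<in> {a..b}"
proof -
  assume "a \<le> b" "-1 \<le> y" "y \<le> 1"
  then have "0 \<le> (b - a) * (1 + y)" "0 \<le> (b - a) * (1 - y)"
    by simp_all
  then show ?thesis
    by (simp add: aff_def field_simps)
qed

text \<open>Exactness is only assumed for \<open>g\<close> itself, not for the monomials in it.  So \<open>pm k S\<close>, the average of
  \<open>g\<close> over the coordinates in \<open>S\<close>, is computed one coordinate at a time, integrating the quadrature
  sum already obtained for the others.\<close>

lemma tensor_quadrature:
  fixes K :: "'d::finite cell" and g :: "real \<Rightarrow> real^'d \<Rightarrow> mom"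
    and c :: "nat \<Rightarrow> ('d \<Rightarrow> nat) \<Rightarrow> mom"
  defines "\<mu> \<equiv> \<lambda>l m. (1 / dx K l) * integral {xL K $ l..xH K $ l} (\<lambda>t. t ^ m)"
  defines "pm \<equiv> \<lambda>k S \<epsilon> x. \<Sum>a\<le>k. \<Sum>\<alpha>\<in>{\<alpha>. \<forall>l. \<alpha> l \<le> k}.
     (\<epsilon> ^ a * (\<Prod>l\<in>S. \<mu> l (\<alpha> l)) * (\<Prod>l\<in>-S. (x $ l) ^ \<alpha> l)) *\<^sub>R c a \<alpha>"
  assumes g: "\<And>\<epsilon> x. g \<epsilon> x = (\<Sum>a\<le>k. \<Sum>\<alpha>\<in>{\<alpha>. \<forall>l. \<alpha> l \<le> k}.
       (\<epsilon> ^ a * (\<Prod>l\<in>UNIV. (x $ l) ^ \<alpha> l)) *\<^sub>R c a \<alpha>)"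
    and lt: "\<And>l. xL K $ l < xH K $ l"
    and Nd: "\<And>l. Nd l \<subseteq> {-1..1}"
    and exact: "\<And>l. exact_x (Nd l) (w l) l K g"
    and \<epsilon>: "\<epsilon> \<in> {eL K..eH K}" and x: "x \<in> cbox (xL K) (xH K)"
  shows "pm k S \<epsilon> x = (\<Sum>y\<in>Pi\<^sub>E S Nd. (\<Prod>l\<in>S. w l (y l)) *\<^sub>R
      g \<epsilon> (\<chi> j. if j \<in> S then aff (xL K $ j) (xH K $ j) (y j) else x $ j))"
proof -
  have nodes: "-1 \<le> y \<and> y \<le> 1" if "y \<in> Nd l" for l y
    using Nd[of l] that by auto
  have "finite S" by simp
  then show ?thesis using x
  proof (induction S arbitrary: x rule: finite_induct)
    case empty
    then show ?case
      by (simp add: pm_def g)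
  next
    case (insert l S)
    let ?I = "{xL K $ l..xH K $ l}"
    let ?z = "\<lambda>y. \<chi> j. if j \<in> S then aff (xL K $ j) (xH K $ j) (y j) else x $ j"
    have dx: "0 < dx K l"
      using lt[of l] by (simp add: dx_def)
    have cont: "continuous_on A (\<lambda>t. g \<epsilon> (set_coord z l t))" for A z
    proof -
      have "continuous_on A (\<lambda>t. set_coord z l t $ j)" for j
        by (cases "j = l") (simp_all add: set_coord_def)
      then show ?thesis
        unfolding g
        by (intro continuous_on_sum continuous_on_scaleR continuous_on_mult continuous_on_prod
            continuous_on_power continuous_on_const)
    qed
    \<comment> \<open>Integration along \<open>l\<close> turns the power of t into its integral,
      which is \<open>dx K l\<close> times the mean \<open>\<mu>\<close>. This moves
      \<open>l\<close> from the free coordinates to the averaged ones.\<close>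
    have "integral ?I (\<lambda>t. pm k S \<epsilon> (set_coord x l t)) = dx K l *\<^sub>R pm k (insert l S) \<epsilon> x"
    proof -
      have "((\<lambda>t. \<Sum>a\<le>k. \<Sum>\<alpha>\<in>{\<alpha>. \<forall>l. \<alpha> l \<le> k}. (t ^ \<alpha> l) *\<^sub>R ((\<epsilon> ^ a * (\<Prod>l\<in>S. \<mu> l (\<alpha> l)) *
             (\<Prod>j\<in>-insert l S. (x $ j) ^ \<alpha> j)) *\<^sub>R c a \<alpha>)) has_integral
          (\<Sum>a\<le>k. \<Sum>\<alpha>\<in>{\<alpha>. \<forall>l. \<alpha> l \<le> k}. (integral ?I (\<lambda>t. t ^ \<alpha> l)) *\<^sub>R
             ((\<epsilon> ^ a * (\<Prod>l\<in>S. \<mu> l (\<alpha> l)) *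
             (\<Prod>j\<in>-insert l S. (x $ j) ^ \<alpha> j)) *\<^sub>R c a \<alpha>))) ?I"
        by (intro has_integral_sum has_integral_scaleR_left integrable_integral
            integrable_continuous_real continuous_intros)
          (auto intro: finite_subset[OF _ finite_PiE[of UNIV "\<lambda>_::'d. {..k}"]])
      moreover have "pm k S \<epsilon> (set_coord x l t) = (\<Sum>a\<le>k. \<Sum>\<alpha>\<in>{\<alpha>. \<forall>l. \<alpha> l \<le> k}.
         (t ^ \<alpha> l) *\<^sub>R ((\<epsilon> ^ a * (\<Prod>l\<in>S. \<mu> l (\<alpha> l)) *
             (\<Prod>j\<in>-insert l S. (x $ j) ^ \<alpha> j)) *\<^sub>R c a \<alpha>))" for t
      proof -
        have S: "- S = insert l (- insert l S)"
          using insert.hyps by auto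
        have "(\<Prod>j\<in>-S. (set_coord x l t $ j) ^ \<alpha> j)
            = t ^ \<alpha> l * (\<Prod>j\<in>-insert l S. (x $ j) ^ \<alpha> j)" for \<alpha>
        proof -
          have "(\<Prod>j\<in>-S. (set_coord x l t $ j) ^ \<alpha> j)
              = (set_coord x l t $ l) ^ \<alpha> l * (\<Prod>j\<in>-insert l S. (set_coord x l t $ j) ^ \<alpha> j)"
            by (subst S) (rule prod.insert, auto)
          also have "(\<Prod>j\<in>-insert l S. (set_coord x l t $ j) ^ \<alpha> j)
              = (\<Prod>j\<in>-insert l S. (x $ j) ^ \<alpha> j)"
            by (rule prod.cong) (auto simp: set_coord_def)
          finally show ?thesis
            by (simp add: set_coord_def)
        qed
        then show ?thesis
          by (simp add: pm_def mult_ac)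
      qed
      moreover have "dx K l *\<^sub>R pm k (insert l S) \<epsilon> x
        = (\<Sum>a\<le>k. \<Sum>\<alpha>\<in>{\<alpha>. \<forall>l. \<alpha> l \<le> k}. (integral ?I (\<lambda>t. t ^ \<alpha> l)) *\<^sub>R
             ((\<epsilon> ^ a * (\<Prod>l\<in>S. \<mu> l (\<alpha> l)) *
             (\<Prod>j\<in>-insert l S. (x $ j) ^ \<alpha> j)) *\<^sub>R c a \<alpha>))"
      proof -
        have "dx K l * (\<epsilon> ^ a * (\<Prod>l\<in>insert l S. \<mu> l (\<alpha> l)) * P)
            = integral ?I (\<lambda>t. t ^ \<alpha> l) * (\<epsilon> ^ a * (\<Prod>l\<in>S. \<mu> l (\<alpha> l)) * P)" for a \<alpha> P
          using insert.hyps dx by (simp add: \<mu>_def)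
        then show ?thesis
          by (simp only: pm_def scaleR_sum_right scaleR_scaleR)
      qed
      ultimately show ?thesis
        by (simp only:) (rule integral_unique)
    qed
    \<comment> \<open>The induction hypothesis replaces the integrand by a quadrature sum. Its terms
      are values of \<open>g\<close> along lines in direction \<open>l\<close>, and for these
      exactness is assumed.\<close>
    moreover have "integral ?I (\<lambda>t. pm k S \<epsilon> (set_coord x l t))
        = integral ?I (\<lambda>t. \<Sum>y\<in>Pi\<^sub>E S Nd. (\<Prod>l\<in>S. w l (y l)) *\<^sub>R g \<epsilon> (set_coord (?z y) l t))"
    proof (rule integral_cong)
      fix t assume "t \<in> ?I"
      with insert.prems have "set_coord x l t \<in> cbox (xL K) (xH K)"
        by (auto simp: mem_box_cart set_coord_def)
      moreover have "(\<chi> j. if j \<in> S then aff (xL K $ j) (xH K $ j) (y j) else set_coord x l t $ j)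
          = set_coord (?z y) l t" for y
        using insert.hyps by (auto simp: set_coord_def vec_eq_iff)
      ultimately show "pm k S \<epsilon> (set_coord x l t)
          = (\<Sum>y\<in>Pi\<^sub>E S Nd. (\<Prod>l\<in>S. w l (y l)) *\<^sub>R g \<epsilon> (set_coord (?z y) l t))"
        using insert.IH by simp
    qed
    also have "\<dots> = (\<Sum>y\<in>Pi\<^sub>E S Nd. (\<Prod>l\<in>S. w l (y l)) *\<^sub>R
        integral ?I (\<lambda>t. g \<epsilon> (set_coord (?z y) l t)))"
    \<comment> \<open>If the index set is infinite, both sums are 0 by convention.\<close>
    proof (cases "finite (Pi\<^sub>E S Nd)")
      case True
      then show ?thesis
        by (subst integral_sum) (auto intro!: integrable_continuous_real continuous_intros cont)
    qed simp
    also have "\<dots> = (\<Sum>y\<in>Pi\<^sub>E S Nd. (\<Prod>l\<in>S. w l (y l)) *\<^sub>R dx K l *\<^sub>R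
        (\<Sum>z\<in>Nd l. w l z *\<^sub>R g \<epsilon> (set_coord (?z y) l (aff (xL K $ l) (xH K $ l) z))))"
    proof (rule sum.cong)
      fix y assume y: "y \<in> Pi\<^sub>E S Nd"
      \<comment> \<open>Exactness is available only on lines through the closed cell; the nodes lie
        in [-1, 1], so the line in question qualifies.\<close>
      have "?z y \<in> cbox (xL K) (xH K)"
        using insert.prems y aff_mem[OF less_imp_le[OF lt]] nodes
        by (fastforce simp: mem_box_cart PiE_iff)
      with \<epsilon> have "(\<epsilon>, ?z y) \<in> cell_closed K"
        by (simp add: cell_closed_def)
      then have "(1 / dx K l) *\<^sub>R integral ?I (\<lambda>t. g \<epsilon> (set_coord (?z y) l t))
          = (\<Sum>z\<in>Nd l. w l z *\<^sub>R g \<epsilon> (set_coord (?z y) l (aff (xL K $ l) (xH K $ l) z)))"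
        using exact[of l] by (auto simp: exact_x_def quad_exact_def dx_def)
      from arg_cong[OF this, of "\<lambda>r. (\<Prod>l\<in>S. w l (y l)) *\<^sub>R dx K l *\<^sub>R r"]
      show "(\<Prod>l\<in>S. w l (y l)) *\<^sub>R integral ?I (\<lambda>t. g \<epsilon> (set_coord (?z y) l t))
        = (\<Prod>l\<in>S. w l (y l)) *\<^sub>R dx K l *\<^sub>R
        (\<Sum>z\<in>Nd l. w l z *\<^sub>R g \<epsilon> (set_coord (?z y) l (aff (xL K $ l) (xH K $ l) z)))"
        using dx by simp
    qed simp
    also have "\<dots> = dx K l *\<^sub>R (\<Sum>z\<in>Nd l. \<Sum>y\<in>Pi\<^sub>E S Nd. (\<Prod>l\<in>S. w l (y l)) *\<^sub>R w l z *\<^sub>R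
        g \<epsilon> (set_coord (?z y) l (aff (xL K $ l) (xH K $ l) z)))"
      by (subst sum.swap) (simp add: scaleR_sum_right mult_ac)
    also have "(\<Sum>z\<in>Nd l. \<Sum>y\<in>Pi\<^sub>E S Nd. (\<Prod>l\<in>S. w l (y l)) *\<^sub>R w l z *\<^sub>R
        g \<epsilon> (set_coord (?z y) l (aff (xL K $ l) (xH K $ l) z)))
      = (\<Sum>y\<in>Pi\<^sub>E (insert l S) Nd. (\<Prod>l\<in>insert l S. w l (y l)) *\<^sub>R
      g \<epsilon> (\<chi> j. if j \<in> insert l S then aff (xL K $ j) (xH K $ j) (y j) else x $ j))"
      unfolding sum_PiE_insert[OF insert.hyps(2)]
    proof (intro sum.cong refl)
      fix z y
      have "(\<Prod>j\<in>S. w j ((y(l := z)) j)) = (\<Prod>j\<in>S. w j (y j))"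
        using insert.hyps by (intro prod.cong) auto
      moreover have "set_coord (?z y) l (aff (xL K $ l) (xH K $ l) z) =
          (\<chi> j. if j \<in> insert l S then aff (xL K $ j) (xH K $ j) ((y(l := z)) j) else x $ j)"
        by (auto simp: set_coord_def vec_eq_iff)
      ultimately show "(\<Prod>l\<in>S. w l (y l)) *\<^sub>R w l z *\<^sub>R
          g \<epsilon> (set_coord (?z y) l (aff (xL K $ l) (xH K $ l) z))
        = (\<Prod>j\<in>insert l S. w j ((y(l := z)) j)) *\<^sub>R g \<epsilon> (\<chi> j. if j \<in> insert l S
            then aff (xL K $ j) (xH K $ j) ((y(l := z)) j) else x $ j)"
        using insert.hyps by (simp add: mult_ac)
    qed
    finally show ?case
      using dx by simp
  qed
qed

text \<open>Fubini separates energy from space. At fixed energy the monomials factor, and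
  \<open>tensor_quadrature\<close> over all coordinates evaluates the spatial integral; the energy
  integrals that remain are exact at each spatial node.\<close>

lemma cell_integral_quadrature:
  fixes K :: "'d::finite cell" and g :: "real \<Rightarrow> real^'d \<Rightarrow> mom"
  assumes poly: "tensor_poly k g"
    and lt_eps: "eL K < eH K" and lt: "\<And>l. xL K $ l < xH K $ l"
    and Nd: "\<And>l. Nd l \<subseteq> {-1..1}"
    and fin: "\<And>l. finite (Nd l)"
    and exact: "\<And>l. exact_x (Nd l) (w l) l K g"
    and exact_e: "exact_eps E we K g"
  shows "integral (cell_closed K) (\<lambda>(\<epsilon>, x). \<epsilon>\<^sup>2 *\<^sub>R g \<epsilon> x) =
    (de K * (\<Prod>l\<in>UNIV. dx K l)) *\<^sub>R (\<Sum>z\<in>E. \<Sum>y\<in>Pi\<^sub>E UNIV Nd.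
       (we z * (\<Prod>l\<in>UNIV. w l (y l))) *\<^sub>R ((aff (eL K) (eH K) z)\<^sup>2 *\<^sub>R
         g (aff (eL K) (eH K) z) (\<chi> j. aff (xL K $ j) (xH K $ j) (y j))))"
proof -
  have nodes: "-1 \<le> y \<and> y \<le> 1" if "y \<in> Nd l" for l y
    using Nd[of l] that by auto
  obtain c where g: "g \<epsilon> x = (\<Sum>a\<le>k. \<Sum>\<alpha>\<in>{\<alpha>. \<forall>l. \<alpha> l \<le> k}.
       (\<epsilon> ^ a * (\<Prod>l\<in>UNIV. (x $ l) ^ \<alpha> l)) *\<^sub>R c a \<alpha>)" for \<epsilon> x
    using poly by (auto simp: tensor_poly_def)
  let ?X = "\<Prod>l\<in>UNIV. dx K l"
  let ?z = "\<lambda>y. \<chi> j. aff (xL K $ j) (xH K $ j) (y j)"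
  let ?W = "\<lambda>y. \<Prod>l\<in>UNIV. w l (y l)"
  have fin': "finite (Pi\<^sub>E UNIV Nd)"
    using fin by (simp add: finite_PiE)
  have dx: "0 < dx K l" for l
    using lt[of l] by (simp add: dx_def)
  have inner: "integral (cbox (xL K) (xH K)) (g \<epsilon>) = ?X *\<^sub>R (\<Sum>y\<in>Pi\<^sub>E UNIV Nd. ?W y *\<^sub>R g \<epsilon> (?z y))"
    if "\<epsilon> \<in> {eL K..eH K}" for \<epsilon>
  proof -
    let ?mu = "\<lambda>l m. (1 / dx K l) * integral {xL K $ l..xH K $ l} (\<lambda>t. t ^ m)"
    have "(g \<epsilon> has_integral (\<Sum>a\<le>k. \<Sum>\<alpha>\<in>{\<alpha>. \<forall>l. \<alpha> l \<le> k}.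
        (\<epsilon> ^ a * (\<Prod>l\<in>UNIV. integral {xL K $ l..xH K $ l} (\<lambda>t. t ^ \<alpha> l))) *\<^sub>R c a \<alpha>))
        (cbox (xL K) (xH K))"
      unfolding g[abs_def]
      by (intro has_integral_sum has_integral_scaleR_left has_integral_mult_right
            has_integral_prod_box continuous_intros)
          (auto intro: finite_subset[OF _ finite_PiE[of UNIV "\<lambda>_::'d. {..k}"]])
    moreover have "(\<Prod>l\<in>UNIV. integral {xL K $ l..xH K $ l} (\<lambda>t. t ^ \<alpha> l))
        = ?X * (\<Prod>l\<in>UNIV. ?mu l (\<alpha> l))" for \<alpha>
      using dx by (simp add: less_imp_neq[symmetric] flip: prod.distrib)
    \<comment> \<open>The product over \<open>-UNIV\<close> is empty. It is kept to match
      \<open>pm\<close> in \<open>tensor_quadrature\<close>, whose base point may be any point of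
      the box; here it is the corner \<open>xL K\<close>.\<close>
    ultimately have "integral (cbox (xL K) (xH K)) (g \<epsilon>) = ?X *\<^sub>R (\<Sum>a\<le>k. \<Sum>\<alpha>\<in>{\<alpha>. \<forall>l. \<alpha> l \<le> k}.
        (\<epsilon> ^ a * (\<Prod>l\<in>UNIV. ?mu l (\<alpha> l)) * (\<Prod>l\<in>-UNIV. (xL K $ l) ^ \<alpha> l)) *\<^sub>R c a \<alpha>)"
      by (simp add: integral_unique scaleR_sum_right mult_ac)
    also have "(\<Sum>a\<le>k. \<Sum>\<alpha>\<in>{\<alpha>. \<forall>l. \<alpha> l \<le> k}.
        (\<epsilon> ^ a * (\<Prod>l\<in>UNIV. ?mu l (\<alpha> l)) * (\<Prod>l\<in>-UNIV. (xL K $ l) ^ \<alpha> l)) *\<^sub>R c a \<alpha>)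
      = (\<Sum>y\<in>Pi\<^sub>E UNIV Nd. ?W y *\<^sub>R
          g \<epsilon> (\<chi> j. if j \<in> UNIV then aff (xL K $ j) (xH K $ j) (y j) else xL K $ j))"
      by (rule tensor_quadrature[OF g lt Nd exact that])
        (use lt in \<open>auto simp: mem_box_cart less_imp_le\<close>)
    finally show ?thesis by simp
  qed
  have cont: "continuous_on A (\<lambda>(\<epsilon>, x). \<epsilon>\<^sup>2 *\<^sub>R g \<epsilon> x)" for A
    unfolding g split_def by (intro continuous_intros)
  have cont_e: "continuous_on A (\<lambda>\<epsilon>. \<epsilon>\<^sup>2 *\<^sub>R g \<epsilon> x)" for A x
    unfolding g by (intro continuous_intros)
  have cell: "cell_closed K = cbox (eL K, xL K) (eH K, xH K)"
    by (auto simp: cell_closed_def cbox_Pair_eq)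
  have "integral (cell_closed K) (\<lambda>(\<epsilon>, x). \<epsilon>\<^sup>2 *\<^sub>R g \<epsilon> x)
      = integral {eL K..eH K} (\<lambda>\<epsilon>. integral (cbox (xL K) (xH K)) (\<lambda>x. \<epsilon>\<^sup>2 *\<^sub>R g \<epsilon> x))"
    using integral_prod_continuous[OF cont] by (simp add: cell)
  also have "\<dots> = integral {eL K..eH K} (\<lambda>\<epsilon>. \<Sum>y\<in>Pi\<^sub>E UNIV Nd. (?X * ?W y) *\<^sub>R (\<epsilon>\<^sup>2 *\<^sub>R g \<epsilon> (?z y)))"
    by (rule integral_cong) (simp add: inner scaleR_sum_right mult_ac)
  also have "\<dots> = (\<Sum>y\<in>Pi\<^sub>E UNIV Nd. (?X * ?W y) *\<^sub>R integral {eL K..eH K} (\<lambda>\<epsilon>. \<epsilon>\<^sup>2 *\<^sub>R g \<epsilon> (?z y)))"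
    by (subst integral_sum[OF fin'])
      (auto intro!: integrable_continuous_real continuous_on_scaleR[OF continuous_on_const] cont_e
        simp del: scaleR_scaleR)
  also have "\<dots> = (\<Sum>y\<in>Pi\<^sub>E UNIV Nd. (?X * ?W y) *\<^sub>R (de K *\<^sub>R (\<Sum>z\<in>E. we z *\<^sub>R
         ((aff (eL K) (eH K) z)\<^sup>2 *\<^sub>R g (aff (eL K) (eH K) z) (?z y)))))"
  proof (rule sum.cong)
    fix y assume y: "y \<in> Pi\<^sub>E UNIV Nd"
    have "?z y \<in> cbox (xL K) (xH K)"
      using y aff_mem[OF less_imp_le[OF lt]] nodes by (fastforce simp: mem_box_cart PiE_iff)
    then have "(1 / de K) *\<^sub>R integral {eL K..eH K} (\<lambda>\<epsilon>. \<epsilon>\<^sup>2 *\<^sub>R g \<epsilon> (?z y))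
        = (\<Sum>z\<in>E. we z *\<^sub>R ((aff (eL K) (eH K) z)\<^sup>2 *\<^sub>R g (aff (eL K) (eH K) z) (?z y)))"
      using exact_e by (auto simp: exact_eps_def quad_exact_def de_def)
    from arg_cong[OF this, of "\<lambda>r. (?X * ?W y) *\<^sub>R de K *\<^sub>R r"]
    show "(?X * ?W y) *\<^sub>R integral {eL K..eH K} (\<lambda>\<epsilon>. \<epsilon>\<^sup>2 *\<^sub>R g \<epsilon> (?z y))
      = (?X * ?W y) *\<^sub>R (de K *\<^sub>R (\<Sum>z\<in>E. we z *\<^sub>R
         ((aff (eL K) (eH K) z)\<^sup>2 *\<^sub>R g (aff (eL K) (eH K) z) (?z y))))"
      using lt_eps by (simp add: de_def)
  qed simp
  also have "\<dots> = (de K * ?X) *\<^sub>R (\<Sum>z\<in>E. \<Sum>y\<in>Pi\<^sub>E UNIV Nd. (we z * ?W y) *\<^sub>R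
      ((aff (eL K) (eH K) z)\<^sup>2 *\<^sub>R g (aff (eL K) (eH K) z) (?z y)))"
    by (subst sum.swap) (simp add: scaleR_sum_right mult_ac)
  finally show ?thesis .
qed

section \<open>The cone of moments\<close>

definition mom_cone :: "mom set" where
  "mom_cone = {U. norm (snd U) \<le> fst U}"

lemma mom_cone_zero: "0 \<in> mom_cone"
  by (simp add: mom_cone_def)

lemma mom_cone_add: "U \<in> mom_cone \<Longrightarrow> V \<in> mom_cone \<Longrightarrow> U + V \<in> mom_cone"
  unfolding mom_cone_def using norm_triangle_ineq[of "snd U" "snd V"] by simp

lemma mom_cone_scaleR: "0 \<le> r \<Longrightarrow> U \<in> mom_cone \<Longrightarrow> r *\<^sub>R U \<in> mom_cone"
  by (simp add: mom_cone_def mult_left_mono)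

lemma mom_cone_sum: "(\<And>a. a \<in> A \<Longrightarrow> U a \<in> mom_cone) \<Longrightarrow> sum U A \<in> mom_cone"
  by (induction A rule: infinite_finite_induct) (auto simp: mom_cone_zero mom_cone_add)

lemma mom_cone_fst_nonneg: "U \<in> mom_cone \<Longrightarrow> 0 \<le> fst U"
  unfolding mom_cone_def using order_trans[OF norm_ge_zero] by auto

lemma closed_mom_cone: "closed mom_cone"
  unfolding mom_cone_def by (intro closed_Collect_le continuous_intros)

text \<open>The covector has no time component, so its Minkowski length is Euclidean, and the
  realizable set is the cone without its apex.\<close>

lemma eul_real_iff: "U \<in> eul_real \<longleftrightarrow> U \<in> mom_cone \<and> 0 < fst U"
  by (auto simp: eul_real_def realizable_def mink_def mom_cone_def norm_eq_sqrt_inner)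

text \<open>Strictness survives the addition of a cone element. All later sums therefore need just
  one strictly positive term.\<close>

lemma eul_real_add_cone: "U \<in> eul_real \<Longrightarrow> V \<in> mom_cone \<Longrightarrow> U + V \<in> eul_real"
  using mom_cone_fst_nonneg[of V] by (auto simp: eul_real_iff mom_cone_add)

lemma eul_real_scaleR: "0 < r \<Longrightarrow> U \<in> eul_real \<Longrightarrow> r *\<^sub>R U \<in> eul_real"
  by (auto simp: eul_real_iff mom_cone_scaleR)

lemma eul_real_sum:
  assumes "finite A" "b \<in> A" "U b \<in> eul_real" "\<And>a. a \<in> A \<Longrightarrow> U a \<in> mom_cone"
  shows "sum U A \<in> eul_real"
proof -
  have "sum U A = U b + sum U (A - {b})"
    using assms by (intro sum.remove)
  then show ?thesis
    using assms by (auto intro!: eul_real_add_cone mom_cone_sum)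
qed

section \<open>Kinematics and angular averages\<close>

lemma norm_lhat: "norm (lhat \<omega>) = 1"
proof -
  have "lhat \<omega> \<bullet> lhat \<omega> = (cos (fst \<omega>))\<^sup>2 + (sin (fst \<omega>) * cos (snd \<omega>))\<^sup>2
      + (sin (fst \<omega>) * sin (snd \<omega>))\<^sup>2"
    by (simp add: lhat_def inner_vec_def sum_3 power2_eq_square)
  also have "\<dots> = 1"
    using sin_cos_squared_add[of "fst \<omega>"] sin_cos_squared_add[of "snd \<omega>"] by algebra
  finally show ?thesis
    by (simp add: norm_eq_sqrt_inner)
qed

lemma inner_lhat_bound: "\<bar>v \<bullet> lhat \<omega>\<bar> \<le> norm v"
  using Cauchy_Schwarz_ineq2[of v "lhat \<omega>"] by (simp add: norm_lhat)

lemma continuous_lhat: "continuous_on UNIV lhat"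
proof -
  have "lhat = (\<lambda>\<omega>. cos (fst \<omega>) *\<^sub>R axis 1 1 + (sin (fst \<omega>) * cos (snd \<omega>)) *\<^sub>R axis 2 1
      + (sin (fst \<omega>) * sin (snd \<omega>)) *\<^sub>R axis 3 1)"
    by (auto simp: fun_eq_iff lhat_def vec_eq_iff forall_3 axis_def)
  moreover have "continuous_on UNIV (\<lambda>\<omega>. cos (fst \<omega>) *\<^sub>R axis 1 1
      + (sin (fst \<omega>) * cos (snd \<omega>)) *\<^sub>R axis 2 1
      + (sin (fst \<omega>) * sin (snd \<omega>)) *\<^sub>R (axis 3 1 :: real^3))"
    by (intro continuous_intros)
  ultimately show ?thesis
    by (simp only:)
qed

lemma lorentz_pos: "norm v < 1 \<Longrightarrow> 0 < lorentz v"
  by (simp add: lorentz_def abs_square_less_1)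

lemma lorentz_square: "norm v < 1 \<Longrightarrow> (lorentz v)\<^sup>2 * (1 - (norm v)\<^sup>2) = 1"
proof -
  assume "norm v < 1"
  then have "0 < 1 - (norm v)\<^sup>2"
    by (simp add: abs_square_less_1)
  then show ?thesis
    by (simp add: lorentz_def power_divide)
qed

text \<open>This is the orthogonality of \<open>u4\<close> and \<open>ell4\<close>: the right-hand
  side is the time component of \<open>ell4\<close>.\<close>

lemma inner_snd_ell4: "v \<bullet> snd (ell4 v \<omega>) = lorentz v * (v \<bullet> lhat \<omega>)"
  by (cases "v = 0") (simp add: ell4_def,
      simp add: ell4_def inner_add_right dot_square_norm, simp add: algebra_simps)

lemma energy_eq: "energy \<epsilon> v \<omega> = \<epsilon> * (lorentz v * (1 + v \<bullet> lhat \<omega>))"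
  by (simp add: energy_def mink_def n4_def p4_def u4_def ell4_def algebra_simps)

text \<open>By Cauchy-Schwarz the Doppler factor \<open>1 + v \<bullet> lhat \<omega>\<close>
  differs from 1 by at most \<open>norm v\<close>. The lower bound serves the energy time step
  condition, the upper one the bound on \<open>lam\<close>.\<close>

lemma energy_bounds:
  assumes "0 \<le> \<epsilon>" "norm v < 1"
  shows "\<epsilon> * (lorentz v * (1 - norm v)) \<le> energy \<epsilon> v \<omega>"
    and "energy \<epsilon> v \<omega> \<le> \<epsilon> * (lorentz v * (1 + norm v))"
  unfolding energy_eq using inner_lhat_bound[of v \<omega>] lorentz_pos[of v] assms
  by (auto intro!: mult_left_mono)

lemma energy_pos:
  assumes "0 < \<epsilon>" "norm v < 1"
  shows "0 < energy \<epsilon> v \<omega>"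
proof -
  have "0 < \<epsilon> * (lorentz v * (1 - norm v))"
    using assms lorentz_pos[of v] by simp
  then show ?thesis
    using energy_bounds(1)[of \<epsilon> v \<omega>] assms by simp
qed

lemma snd_L4: "snd (L4 \<epsilon> v \<omega>) = (\<epsilon> / energy \<epsilon> v \<omega>) *\<^sub>R (lorentz v *\<^sub>R v + snd (ell4 v \<omega>))"
  by (simp add: L4_def p4_def u4_def n4_def)

text \<open>Nullity of the momentum: the spatial length of \<open>u4 v + ell4 v \<omega>\<close>
  equals its time component.\<close>

lemma norm_spatial_momentum:
  assumes "norm v < 1"
  shows "norm (lorentz v *\<^sub>R v + snd (ell4 v \<omega>)) = lorentz v * (1 + v \<bullet> lhat \<omega>)"
proof -
  define W where "W = lorentz v"
  define s where "s = (norm v)\<^sup>2"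
  define c where "c = v \<bullet> lhat \<omega>"
  \<comment> \<open>The coefficient of \<open>v\<close> in the boost. For v = 0 division by zero
    makes it 0, and \<open>c\<close> is 0 as well, so the identities below cover both cases.\<close>
  define r where "r = (W - 1) * c / s"
  have W: "0 < W" "W\<^sup>2 * (1 - s) = 1"
    using assms lorentz_pos lorentz_square by (auto simp: W_def s_def)
  have c0: "s = 0 \<Longrightarrow> c = 0"
    by (simp add: s_def c_def)
  have rs: "r * s = (W - 1) * c"
    using c0 by (auto simp: r_def)
  \<comment> \<open>Multiplying by W + 1 produces W^2 - 1 = W^2 s, which removes the division by s
    from the expanded square.\<close>
  have rc: "r * (W + 1) * c = W\<^sup>2 * c\<^sup>2"
  proof (cases "s = 0")
    case True
    then show ?thesis using c0 by simp
  next
    case False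
    have "s * (r * (W + 1) * c) = (r * s) * (W + 1) * c"
      by simp
    also have "\<dots> = (W\<^sup>2 - 1) * c\<^sup>2"
      unfolding rs by (simp add: power2_eq_square algebra_simps)
    also have "W\<^sup>2 - 1 = W\<^sup>2 * s"
      using W(2) by (simp add: algebra_simps)
    finally have "s * (r * (W + 1) * c) = s * (W\<^sup>2 * c\<^sup>2)"
      by (simp only: mult_ac)
    with False show ?thesis
      by (metis mult_left_cancel)
  qed
  have eq: "lorentz v *\<^sub>R v + snd (ell4 v \<omega>) = lhat \<omega> + (W + r) *\<^sub>R v"
  proof -
    have "snd (ell4 v \<omega>) = lhat \<omega> + r *\<^sub>R v"
      by (simp add: ell4_def W_def r_def c_def s_def)
    then show ?thesis
      by (simp add: scaleR_add_left flip: W_def)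
  qed
  have gen: "(lhat \<omega> + a *\<^sub>R v) \<bullet> (lhat \<omega> + a *\<^sub>R v) = 1 + 2 * a * c + a\<^sup>2 * s" for a
  proof -
    have "lhat \<omega> \<bullet> lhat \<omega> = 1" "v \<bullet> v = s" "lhat \<omega> \<bullet> v = c" "v \<bullet> lhat \<omega> = c"
      by (simp_all add: dot_square_norm norm_lhat s_def c_def inner_commute)
    then have "(lhat \<omega> + a *\<^sub>R v) \<bullet> (lhat \<omega> + a *\<^sub>R v) = 1 + a * c + (a * c + a * (a * s))"
      unfolding inner_add_left inner_add_right inner_scaleR_left inner_scaleR_right
      by (simp only:) (simp add: distrib_left)
    then show ?thesis
      by (simp add: power2_eq_square)
  qed
  have "(norm (lorentz v *\<^sub>R v + snd (ell4 v \<omega>)))\<^sup>2 = 1 + 2 * (W + r) * c + (W + r)\<^sup>2 * s"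
    unfolding eq power2_norm_eq_inner by (rule gen)
  also have "\<dots> = 1 + W\<^sup>2 * s + 2 * W * c + 2 * r * c + 2 * W * (r * s) + r * (r * s)"
    by (simp add: power2_eq_square algebra_simps)
  also have "\<dots> = (1 + W\<^sup>2 * s) + 2 * W\<^sup>2 * c + r * (W + 1) * c"
    unfolding rs by (simp add: power2_eq_square algebra_simps)
  also have "1 + W\<^sup>2 * s = W\<^sup>2"
    using W(2) by (simp add: algebra_simps)
  also have "W\<^sup>2 + 2 * W\<^sup>2 * c + r * (W + 1) * c = (W * (1 + c))\<^sup>2"
    unfolding rc by (simp add: power2_eq_square algebra_simps)
  finally have "(norm (lorentz v *\<^sub>R v + snd (ell4 v \<omega>)))\<^sup>2 = (W * (1 + c))\<^sup>2" .
  moreover have "0 \<le> W * (1 + c)"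
  proof (rule mult_nonneg_nonneg)
    show "0 \<le> W"
      using W(1) by simp
    show "0 \<le> 1 + c"
      using inner_lhat_bound[of v \<omega>] assms unfolding c_def by linarith
  qed
  ultimately have "norm (lorentz v *\<^sub>R v + snd (ell4 v \<omega>)) = W * (1 + c)"
    using power2_eq_imp_eq norm_ge_zero by blast
  then show ?thesis
    by (simp add: W_def c_def)
qed

text \<open>Dividing the null momentum by its time component leaves a spatial unit vector.\<close>

lemma norm_L4:
  assumes "0 < \<epsilon>" "norm v < 1"
  shows "norm (snd (L4 \<epsilon> v \<omega>)) = 1"
proof -
  define X where "X = lorentz v * (1 + v \<bullet> lhat \<omega>)"
  have "energy \<epsilon> v \<omega> = \<epsilon> * X" "norm (lorentz v *\<^sub>R v + snd (ell4 v \<omega>)) = X"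
    using norm_spatial_momentum[OF assms(2)] by (simp_all add: X_def energy_eq)
  moreover from this have "0 < X"
    using energy_pos[OF assms, of \<omega>] assms by (simp add: zero_less_mult_iff)
  ultimately show ?thesis
    using assms unfolding snd_L4 by simp
qed

lemma L4_component_bound:
  assumes "0 < \<epsilon>" "norm v < 1"
  shows "\<bar>snd (L4 \<epsilon> v \<omega>) $ i\<bar> \<le> 1"
  using component_le_norm_cart[of "snd (L4 \<epsilon> v \<omega>)" i] norm_L4[OF assms] by simp

text \<open>Both sides are the time and space components of \<open>u4 v + ell4 v \<omega>\<close>,
  which is the momentum divided by \<open>\<epsilon>\<close>. So \<open>A_map\<close> turns
  Lagrangian integrands into multiples of the ray (1, L).\<close>

lemma A_map_ell4:
  assumes "0 < \<epsilon>" "norm v < 1"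
  shows "A_map v (1, snd (ell4 v \<omega>)) = (energy \<epsilon> v \<omega> / \<epsilon>) *\<^sub>R (1, snd (L4 \<epsilon> v \<omega>))"
proof (rule prod_eqI)
  show "fst (A_map v (1, snd (ell4 v \<omega>))) = fst ((energy \<epsilon> v \<omega> / \<epsilon>) *\<^sub>R (1, snd (L4 \<epsilon> v \<omega>)))"
    using assms(1) by (simp add: A_map_def inner_snd_ell4 energy_eq) (simp add: distrib_left)
  show "snd (A_map v (1, snd (ell4 v \<omega>))) = snd ((energy \<epsilon> v \<omega> / \<epsilon>) *\<^sub>R (1, snd (L4 \<epsilon> v \<omega>)))"
    using energy_pos[OF assms, of \<omega>] assms(1) by (simp add: A_map_def snd_L4 add.commute)
qed

lemma continuous_ell4: "continuous_on UNIV (ell4 v)"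
proof -
  have "ell4 v = (\<lambda>\<omega>. (lorentz v * (v \<bullet> lhat \<omega>),
     lhat \<omega> + ((lorentz v - 1) / (norm v)\<^sup>2 * (v \<bullet> lhat \<omega>)) *\<^sub>R v))"
    by (intro ext) (simp add: ell4_def)
  then show ?thesis
    by (rule ssubst) (intro continuous_intros continuous_lhat)
qed

lemma continuous_energy: "continuous_on UNIV (energy \<epsilon> v)"
  unfolding energy_eq[abs_def] by (intro continuous_intros continuous_lhat)

lemma continuous_snd_L4:
  assumes "0 < \<epsilon>" "norm v < 1"
  shows "continuous_on UNIV (\<lambda>\<omega>. snd (L4 \<epsilon> v \<omega>))"
  unfolding snd_L4 using energy_pos[OF assms]
  by (auto intro!: continuous_intros continuous_ell4 continuous_energy simp: less_imp_neq[symmetric])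

lemma continuous_qfac:
  assumes "bilinear G"
  shows "continuous_on UNIV (qfac G \<epsilon> v)"
proof -
  interpret bounded_bilinear G
    using assms by (simp add: bilinear_conv_bounded_bilinear)
  have "continuous_on UNIV (p4 \<epsilon> v)"
    unfolding p4_def[abs_def] by (intro continuous_intros continuous_ell4)
  then show ?thesis
    unfolding qfac_def[abs_def] divide_inverse
    by (intro continuous_on_mult continuous_on_const continuous_on)
qed

section \<open>Integration over the sphere and moments along rays\<close>

lemma space_sph: "space sph = {0..pi} \<times> {0..<2*pi}"
  by (simp add: sph_def space_restrict_space)

lemma measurable_sph_continuous:
  fixes \<phi> :: "real \<times> real \<Rightarrow> 'b::topological_space"
  assumes "continuous_on UNIV \<phi>"
  shows "\<phi> \<in> borel_measurable sph"
proof -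
  have "\<phi> \<in> borel_measurable lborel"
    unfolding measurable_lborel2 by (rule borel_measurable_continuous_onI[OF assms])
  then have "\<phi> \<in> borel_measurable (restrict_space lborel ({0..pi} \<times> {0..<2*pi}))"
    by (rule measurable_restrict_space1)
  then show ?thesis
    unfolding sph_def measurable_def by (simp only: space_density sets_density)
qed

text \<open>The half-open parameter rectangle of the sphere lies in a compact one, on which the
  continuous factor is bounded.\<close>

lemma integrable_sph_scaleR:
  fixes \<phi> :: "real \<times> real \<Rightarrow> 'b::{banach, second_countable_topology}"
  assumes f: "integrable sph f" and \<phi>: "continuous_on UNIV \<phi>"
  shows "integrable sph (\<lambda>\<omega>. f \<omega> *\<^sub>R \<phi> \<omega>)"
proof -
  have "compact (\<phi> ` ({0..pi} \<times> {0..2*pi}))"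
    using \<phi> by (intro compact_continuous_image compact_Times) (auto intro: continuous_on_subset)
  then have "bounded (\<phi> ` ({0..pi} \<times> {0..2*pi}))"
    by (rule compact_imp_bounded)
  then obtain C where C: "\<forall>y\<in>\<phi> ` ({0..pi} \<times> {0..2*pi}). norm y \<le> C"
    unfolding bounded_iff ..
  show ?thesis
  proof (rule Bochner_Integration.integrable_bound)
    show "integrable sph (\<lambda>\<omega>. C * f \<omega>)"
      using f by (rule integrable_mult_right)
    show "(\<lambda>\<omega>. f \<omega> *\<^sub>R \<phi> \<omega>) \<in> borel_measurable sph"
      by (rule borel_measurable_scaleR[OF borel_measurable_integrable[OF f]
            measurable_sph_continuous[OF \<phi>]])
    show "AE \<omega> in sph. norm (f \<omega> *\<^sub>R \<phi> \<omega>) \<le> norm (C * f \<omega>)"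
    proof (rule AE_I2)
      fix \<omega> assume "\<omega> \<in> space sph"
      then have "\<omega> \<in> {0..pi} \<times> {0..2*pi}"
        by (auto simp: space_sph)
      with C have "norm (\<phi> \<omega>) \<le> C"
        by blast
      then have "norm (\<phi> \<omega>) * \<bar>f \<omega>\<bar> \<le> \<bar>C\<bar> * \<bar>f \<omega>\<bar>"
        by (intro mult_right_mono) auto
      then show "norm (f \<omega> *\<^sub>R \<phi> \<omega>) \<le> norm (C * f \<omega>)"
        by (simp add: abs_mult mult.commute)
    qed
  qed
qed

lemma sphavg_bounded_linear:
  assumes "bounded_linear T" "integrable sph g"
  shows "T (sphavg g) = sphavg (\<lambda>\<omega>. T (g \<omega>))"
  using integral_bounded_linear[OF assms] linear_cmul[OF bounded_linear.linear[OF assms(1)]]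
  by (simp add: sphavg_def)

text \<open>The common form of all Eulerian densities and fluxes: they differ only in the scalar
  weight \<open>\<psi>\<close> in front of (1, L), so cone membership becomes a question about the
  sign of that weight.\<close>

definition ray_mom :: "real \<Rightarrow> real^3 \<Rightarrow> (real \<times> real \<Rightarrow> real) \<Rightarrow> (real \<times> real \<Rightarrow> real) \<Rightarrow> mom" where
  "ray_mom \<epsilon> v f \<psi> = sphavg (\<lambda>\<omega>. (f \<omega> * \<psi> \<omega>) *\<^sub>R (1, snd (L4 \<epsilon> v \<omega>)))"

lemma integrable_ray_mom:
  assumes "0 < \<epsilon>" "norm v < 1" "integrable sph f" "continuous_on UNIV \<psi>"
  shows "integrable sph (\<lambda>\<omega>. (f \<omega> * \<psi> \<omega>) *\<^sub>R (1::real, snd (L4 \<epsilon> v \<omega>)))"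
proof -
  have "continuous_on UNIV (\<lambda>\<omega>. \<psi> \<omega> *\<^sub>R (1::real, snd (L4 \<epsilon> v \<omega>)))"
    by (intro continuous_intros continuous_snd_L4 assms)
  from integrable_sph_scaleR[OF assms(3) this] show ?thesis
    by simp
qed

lemma ray_mom_linear:
  assumes "0 < \<epsilon>" "norm v < 1" "integrable sph f" "continuous_on UNIV \<psi>" "continuous_on UNIV \<psi>'"
  shows "ray_mom \<epsilon> v f (\<lambda>\<omega>. a * \<psi> \<omega> + b * \<psi>' \<omega>) = a *\<^sub>R ray_mom \<epsilon> v f \<psi> + b *\<^sub>R ray_mom \<epsilon> v f \<psi>'"
proof -
  let ?R = "\<lambda>\<omega>. (1::real, snd (L4 \<epsilon> v \<omega>))"
  have "(f \<omega> * (a * \<psi> \<omega> + b * \<psi>' \<omega>)) *\<^sub>R ?R \<omega>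
      = a *\<^sub>R ((f \<omega> * \<psi> \<omega>) *\<^sub>R ?R \<omega>) + b *\<^sub>R ((f \<omega> * \<psi>' \<omega>) *\<^sub>R ?R \<omega>)" for \<omega>
    by (simp add: algebra_simps)
  then show ?thesis
    using integrable_ray_mom[OF assms(1-4)] integrable_ray_mom[OF assms(1-3,5)]
    by (simp add: ray_mom_def sphavg_def scaleR_add_right scaleR_left_commute
        del: scaleR_Pair scaleR_scaleR)
qed

text \<open>The norm of the integral is at most the integral of the norm, and since L has unit
  length that integral is the scalar component.\<close>

lemma ray_mom_cone:
  assumes "0 < \<epsilon>" "norm v < 1" "f \<in> real_dist" "continuous_on UNIV \<psi>"
    and nonneg: "\<And>\<omega>. \<omega> \<in> space sph \<Longrightarrow> 0 \<le> \<psi> \<omega>"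
  shows "ray_mom \<epsilon> v f \<psi> \<in> mom_cone"
proof -
  let ?g = "\<lambda>\<omega>. (f \<omega> * \<psi> \<omega>) *\<^sub>R (1::real, snd (L4 \<epsilon> v \<omega>))"
  have f: "integrable sph f" "\<And>\<omega>. \<omega> \<in> space sph \<Longrightarrow> 0 \<le> f \<omega>"
    using assms(3) by (auto simp: real_dist_def)
  have int: "integrable sph ?g"
    using assms f by (intro integrable_ray_mom)
  have "norm (snd (\<integral>\<omega>. ?g \<omega> \<partial>sph)) = norm (\<integral>\<omega>. snd (?g \<omega>) \<partial>sph)"
    using integral_bounded_linear[OF bounded_linear_snd int] by simp
  also have "\<dots> \<le> (\<integral>\<omega>. norm (snd (?g \<omega>)) \<partial>sph)"
    by (rule integral_norm_bound)
  also have "\<dots> = (\<integral>\<omega>. fst (?g \<omega>) \<partial>sph)"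
    using f nonneg norm_L4[OF assms(1,2)] by (intro Bochner_Integration.integral_cong) auto
  also have "\<dots> = fst (\<integral>\<omega>. ?g \<omega> \<partial>sph)"
    using integral_bounded_linear[OF bounded_linear_fst int] by simp
  finally have "(\<integral>\<omega>. ?g \<omega> \<partial>sph) \<in> mom_cone"
    by (simp add: mom_cone_def)
  then show ?thesis
    unfolding ray_mom_def sphavg_def by (intro mom_cone_scaleR) auto
qed

lemma U_mom_ray: "U_mom \<epsilon> v f = ray_mom \<epsilon> v f (\<lambda>\<omega>. (energy \<epsilon> v \<omega>)\<^sup>2 / \<epsilon>)"
  by (simp add: U_mom_def ray_mom_def mult.commute)

lemma F_mom_ray:
  "F_mom i \<epsilon> v f = ray_mom \<epsilon> v f (\<lambda>\<omega>. (energy \<epsilon> v \<omega>)\<^sup>2 / \<epsilon> * (snd (L4 \<epsilon> v \<omega>) $ i))"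
  by (simp add: F_mom_def ray_mom_def mult_ac)

lemma Ut_mom_ray: "Ut_mom \<epsilon> v f = ray_mom \<epsilon> v f (energy \<epsilon> v)"
  by (simp add: Ut_mom_def ray_mom_def mult.commute)

lemma Feps_mom_ray:
  "Feps_mom G \<epsilon> v f = - ray_mom \<epsilon> v f (\<lambda>\<omega>. qfac G \<epsilon> v \<omega> * energy \<epsilon> v \<omega>)"
  by (simp add: Feps_mom_def ray_mom_def mult_ac)

section \<open>Lagrangian and Eulerian moments\<close>

lemma linear_A_map: "linear (A_map v)"
  by (rule linearI) (simp_all add: A_map_def inner_add_right algebra_simps)

text \<open>The witness is the explicit solution J = W (e - v.F), H = F - W J v, found by pairing
  with v and using W^2 (1 - v^2) = 1. Surjectivity makes \<open>inv (A_map v)\<close> a right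
  inverse.\<close>

lemma surj_A_map:
  assumes "norm v < 1"
  shows "surj (A_map v)"
proof -
  have "A_map v (lorentz v * (e - v \<bullet> F), F - ((lorentz v)\<^sup>2 * (e - v \<bullet> F)) *\<^sub>R v) = (e, F)" for e F
  proof -
    have "lorentz v * (lorentz v * (e - v \<bullet> F)) + (v \<bullet> F - (lorentz v)\<^sup>2 * (e - v \<bullet> F) * (norm v)\<^sup>2) = e"
      using lorentz_square[OF assms] by algebra
    then show ?thesis
      by (simp add: A_map_def inner_diff_right dot_square_norm) (simp add: power2_eq_square)
  qed
  then show ?thesis
    by (metis surjI surj_pair surj_def)
qed

text \<open>\<open>A_map v\<close> lists the Eulerian components of the four-vector J u + H. As u
  has Minkowski square -1 and H is orthogonal to it, both sides are minus the Minkowski square of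
  that vector.\<close>

lemma A_map_invariant:
  assumes "norm v < 1"
  shows "(fst (A_map v M))\<^sup>2 - (norm (snd (A_map v M)))\<^sup>2
     = (fst M)\<^sup>2 - ((norm (snd M))\<^sup>2 - (v \<bullet> snd M)\<^sup>2)"
proof -
  have "(norm (snd (A_map v M)))\<^sup>2 = (norm (snd M))\<^sup>2 + 2 * (lorentz v * fst M) * (v \<bullet> snd M)
      + (lorentz v * fst M)\<^sup>2 * (norm v)\<^sup>2"
    unfolding power2_norm_eq_inner
    by (simp add: A_map_def inner_add_left inner_add_right inner_commute[of "snd M" v])
      (simp add: algebra_simps power2_eq_square)
  moreover have "fst (A_map v M) = lorentz v * fst M + v \<bullet> snd M"
    by (simp add: A_map_def)
  ultimately show ?thesis
    using lorentz_square[OF assms] by algebra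
qed

text \<open>By \<open>A_map_invariant\<close> the norm inequality is the same on both sides; what
  remains is that, under this inequality, the two scalars are positive together.\<close>

lemma lag_real_iff_A_map:
  assumes v: "norm v < 1"
  shows "M \<in> lag_real v \<longleftrightarrow> A_map v M \<in> eul_real"
proof -
  define W where "W = lorentz v"
  define a where "a = fst M"
  define t where "t = v \<bullet> snd M"
  define s where "s = (norm v)\<^sup>2"
  define E where "E = fst (A_map v M)"
  define F where "F = snd (A_map v M)"
  have W: "0 < W" "W\<^sup>2 * (1 - s) = 1"
    using v lorentz_pos lorentz_square by (auto simp: W_def s_def)
  have s: "0 \<le> s" "s < 1"
    using v by (auto simp: s_def abs_square_less_1)
  have inv: "E\<^sup>2 - (norm F)\<^sup>2 = a\<^sup>2 - ((norm (snd M))\<^sup>2 - t\<^sup>2)"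
    unfolding E_def F_def a_def t_def by (rule A_map_invariant[OF v])
  have E: "E = W * a + t"
    by (simp add: E_def A_map_def W_def a_def t_def)
  have vF: "v \<bullet> F = t + W * a * s"
    by (simp add: F_def A_map_def W_def a_def t_def s_def inner_add_right dot_square_norm)
  have lag: "M \<in> lag_real v \<longleftrightarrow> 0 < a \<and> (norm (snd M))\<^sup>2 - t\<^sup>2 \<le> a\<^sup>2"
  proof -
    have "sqrt ((norm (snd M))\<^sup>2 - t\<^sup>2) \<le> a \<longleftrightarrow> (norm (snd M))\<^sup>2 - t\<^sup>2 \<le> a\<^sup>2" if "0 < a"
      using that by (metis less_imp_le real_le_lsqrt real_sqrt_abs real_sqrt_le_iff abs_of_pos)
    then show ?thesis
      by (auto simp: lag_real_def realizable_def mink_def a_def t_def dot_square_norm power2_eq_square)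
  qed
  have eul: "A_map v M \<in> eul_real \<longleftrightarrow> 0 < E \<and> (norm (snd M))\<^sup>2 - t\<^sup>2 \<le> a\<^sup>2"
  proof -
    have "norm F \<le> E \<longleftrightarrow> (norm F)\<^sup>2 \<le> E\<^sup>2" if "0 < E"
      using that power_mono_iff[of "norm F" E 2] by simp
    moreover have "A_map v M \<in> eul_real \<longleftrightarrow> norm F \<le> E \<and> 0 < E"
      by (simp add: eul_real_iff mom_cone_def E_def F_def)
    moreover have "(norm F)\<^sup>2 \<le> E\<^sup>2 \<longleftrightarrow> (norm (snd M))\<^sup>2 - t\<^sup>2 \<le> a\<^sup>2"
      using inv by linarith
    ultimately show ?thesis
      by blast
  qed
  have "0 < a \<longleftrightarrow> 0 < E" if le: "(norm (snd M))\<^sup>2 - t\<^sup>2 \<le> a\<^sup>2"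
  proof
    assume "0 < a"
    \<comment> \<open>Cauchy-Schwarz and the norm inequality bound t^2 by W^2 s a^2, which is below
      (W a)^2 because s < 1. Hence t cannot outweigh W a.\<close>
    have "t\<^sup>2 \<le> s * (norm (snd M))\<^sup>2"
      using Cauchy_Schwarz_ineq[of v "snd M"] by (simp add: t_def s_def dot_square_norm)
    also have "\<dots> \<le> s * (a\<^sup>2 + t\<^sup>2)"
      using le s by (intro mult_left_mono) auto
    finally have "t\<^sup>2 * (1 - s) \<le> s * a\<^sup>2"
      by (simp add: algebra_simps)
    then have "W\<^sup>2 * (t\<^sup>2 * (1 - s)) \<le> W\<^sup>2 * (s * a\<^sup>2)"
      by (intro mult_left_mono) auto
    moreover have "W\<^sup>2 * (t\<^sup>2 * (1 - s)) = t\<^sup>2"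
      using W(2) by algebra
    moreover have "W\<^sup>2 * (s * a\<^sup>2) < W\<^sup>2 * (1 * a\<^sup>2)"
      using W s \<open>0 < a\<close> by (intro mult_strict_left_mono mult_strict_right_mono) auto
    ultimately have "t\<^sup>2 < (W * a)\<^sup>2"
      by (simp add: power_mult_distrib)
    then have "\<bar>t\<bar> < W * a"
      using W(1) \<open>0 < a\<close>
      by (metis power2_abs power2_less_imp_less less_imp_le mult_pos_pos)
    then show "0 < E"
      by (simp add: E)
  next
    assume E0: "0 < E"
    then have "norm F \<le> E"
      using eul le by (auto simp: eul_real_iff mom_cone_def E_def F_def)
    \<comment> \<open>The difference of \<open>E\<close> and \<open>v \<bullet> F\<close> is W a (1
      - s), so the sign of a can be read off from v.F < E.\<close>
    have "v \<bullet> F \<le> norm v * E"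
      using norm_cauchy_schwarz[of v F] mult_left_mono[OF \<open>norm F \<le> E\<close>, of "norm v"] by simp
    also have "\<dots> < 1 * E"
      using v E0 by (intro mult_strict_right_mono)
    finally have "0 < W * a * (1 - s)"
      by (simp add: E vF algebra_simps)
    then show "0 < a"
      using W s by (simp add: zero_less_mult_iff)
  qed
  then show ?thesis
    using lag eul by auto
qed

section \<open>Moments of a closing distribution in the Eulerian frame\<close>

lemma A_map_lag_mom:
  assumes "0 < \<epsilon>" "norm v < 1" "integrable sph f"
  shows "A_map v (lag_mom \<epsilon> v f) = ray_mom \<epsilon> v f (energy \<epsilon> v)"
proof -
  have A: "bounded_linear (A_map v)"
    using linear_A_map by (simp add: linear_conv_bounded_linear)
  have int: "integrable sph (\<lambda>\<omega>. f \<omega> *\<^sub>R (1::real, snd (ell4 v \<omega>)))"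
    by (intro integrable_sph_scaleR assms continuous_intros continuous_ell4)
  have "A_map v (lag_mom \<epsilon> v f) = \<epsilon> *\<^sub>R sphavg (\<lambda>\<omega>. A_map v (f \<omega> *\<^sub>R (1, snd (ell4 v \<omega>))))"
    unfolding lag_mom_def linear_cmul[OF linear_A_map] sphavg_bounded_linear[OF A int] ..
  also have "\<dots> = ray_mom \<epsilon> v f (energy \<epsilon> v)"
    using assms(1) by (simp add: linear_cmul[OF linear_A_map] A_map_ell4[OF assms(1,2)] ray_mom_def
        sphavg_def del: scaleR_Pair flip: integral_scaleR_right)
  finally show ?thesis .
qed

text \<open>\<open>U_hat\<close> is W M plus the average of f (v.ell)(1, ell). Under
  \<open>A_map\<close> the two parts get the weights W E and (v.ell) E, whose sum is E^2 /
  \<open>\<epsilon>\<close> because E = \<open>\<epsilon>\<close> (W + v.ell).\<close>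

lemma A_map_U_hat:
  assumes "0 < \<epsilon>" "norm v < 1" "closed_lag cl \<epsilon> v M"
  shows "A_map v (U_hat cl \<epsilon> v M) = U_mom \<epsilon> v (cl \<epsilon> v M)"
proof -
  define f where "f = cl \<epsilon> v M"
  have f: "integrable sph f" and M: "M = lag_mom \<epsilon> v f"
    using assms(3) by (auto simp: closed_lag_def real_dist_def f_def)
  let ?l = "\<lambda>\<omega>. snd (ell4 v \<omega>)"
  have int: "integrable sph (\<lambda>\<omega>. f \<omega> *\<^sub>R \<phi> \<omega>)" if "continuous_on UNIV \<phi>"
    for \<phi> :: "real \<times> real \<Rightarrow> 'b::{banach, second_countable_topology}"
    using f that by (rule integrable_sph_scaleR)
  have ce: "continuous_on UNIV ?l"
    by (intro continuous_intros continuous_ell4)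
  have int1: "integrable sph (\<lambda>\<omega>. f \<omega> *\<^sub>R (1::real, ?l \<omega>))"
    by (intro int continuous_intros ce)
  have int2: "integrable sph (\<lambda>\<omega>. f \<omega> *\<^sub>R ((v \<bullet> ?l \<omega>) *\<^sub>R (1::real, ?l \<omega>)))"
    by (intro int continuous_intros ce)
  have int3: "integrable sph (\<lambda>\<omega>. f \<omega> * (?l \<omega> $ i) * (?l \<omega> $ j))" for i j
    using int[of "\<lambda>\<omega>. (?l \<omega> $ i) * (?l \<omega> $ j)"]
    by (simp add: mult.assoc continuous_intros ce)
  have A: "bounded_linear (A_map v)"
    using linear_A_map by (simp add: linear_conv_bounded_linear)
  have second: "(v \<bullet> snd M, v v* K_mom \<epsilon> v f)
      = \<epsilon> *\<^sub>R sphavg (\<lambda>\<omega>. f \<omega> *\<^sub>R ((v \<bullet> ?l \<omega>) *\<^sub>R (1, ?l \<omega>)))" (is "_ = \<epsilon> *\<^sub>R sphavg ?g")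
  proof (rule prod_eqI)
    have "v \<bullet> snd M = \<epsilon> * sphavg (\<lambda>\<omega>. v \<bullet> snd (f \<omega> *\<^sub>R (1::real, ?l \<omega>)))"
      using sphavg_bounded_linear[OF bounded_linear_compose[OF bounded_linear_inner_right[of v]
            bounded_linear_snd] int1]
      by (simp add: M lag_mom_def)
    then show "fst (v \<bullet> snd M, v v* K_mom \<epsilon> v f) = fst (\<epsilon> *\<^sub>R sphavg ?g)"
      using sphavg_bounded_linear[OF bounded_linear_fst int2] by simp
    show "snd (v \<bullet> snd M, v v* K_mom \<epsilon> v f) = snd (\<epsilon> *\<^sub>R sphavg ?g)"
    proof (rule vec_eq_iff[THEN iffD2], rule allI)
      fix j
      have "snd (sphavg ?g) $ j = sphavg (\<lambda>\<omega>. snd (?g \<omega>) $ j)"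
        using sphavg_bounded_linear[OF bounded_linear_compose[OF bounded_linear_vec_nth[of j]
            bounded_linear_snd] int2] .
      also have "\<dots> = sphavg (\<lambda>\<omega>. \<Sum>i\<in>UNIV. v $ i * (f \<omega> * (?l \<omega> $ i) * (?l \<omega> $ j)))"
        by (simp add: inner_vec_def sum_distrib_left sum_distrib_right mult_ac)
      also have "\<dots> = (\<Sum>i\<in>UNIV. v $ i * sphavg (\<lambda>\<omega>. f \<omega> * (?l \<omega> $ i) * (?l \<omega> $ j)))"
        unfolding sphavg_def
        by (subst Bochner_Integration.integral_sum)
          (simp_all only: integrable_mult_right int3 scaleR_sum_right integral_mult_right_zero
            mult_scaleR_right)
      finally show "snd (v \<bullet> snd M, v v* K_mom \<epsilon> v f) $ j = snd (\<epsilon> *\<^sub>R sphavg ?g) $ j"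
        by (simp add: vector_matrix_mult_def K_mom_def sum_distrib_left mult_ac)
    qed
  qed
  have "U_hat cl \<epsilon> v M = lorentz v *\<^sub>R M + (v \<bullet> snd M, v v* K_mom \<epsilon> v f)"
    by (simp add: U_hat_def f_def prod_eq_iff)
  then have "A_map v (U_hat cl \<epsilon> v M) = lorentz v *\<^sub>R ray_mom \<epsilon> v f (energy \<epsilon> v)
      + \<epsilon> *\<^sub>R sphavg (\<lambda>\<omega>. A_map v (f \<omega> *\<^sub>R ((v \<bullet> ?l \<omega>) *\<^sub>R (1, ?l \<omega>))))"
    unfolding second sphavg_bounded_linear[OF A int2, symmetric]
    by (simp add: linear_add[OF linear_A_map] linear_cmul[OF linear_A_map]
        A_map_lag_mom[OF assms(1,2) f] M)
  also have "\<epsilon> *\<^sub>R sphavg (\<lambda>\<omega>. A_map v (f \<omega> *\<^sub>R ((v \<bullet> ?l \<omega>) *\<^sub>R (1, ?l \<omega>))))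
      = ray_mom \<epsilon> v f (\<lambda>\<omega>. (v \<bullet> ?l \<omega>) * energy \<epsilon> v \<omega>)"
    using assms(1) by (simp add: linear_cmul[OF linear_A_map] A_map_ell4[OF assms(1,2)] ray_mom_def
        sphavg_def mult_ac del: scaleR_Pair flip: integral_scaleR_right)
  also have "lorentz v *\<^sub>R ray_mom \<epsilon> v f (energy \<epsilon> v)
      + ray_mom \<epsilon> v f (\<lambda>\<omega>. (v \<bullet> ?l \<omega>) * energy \<epsilon> v \<omega>)
      = ray_mom \<epsilon> v f (\<lambda>\<omega>. lorentz v * energy \<epsilon> v \<omega> + 1 * ((v \<bullet> ?l \<omega>) * energy \<epsilon> v \<omega>))"
    by (subst ray_mom_linear) (auto intro!: assms f continuous_intros continuous_energy ce)
  also have "(\<lambda>\<omega>. lorentz v * energy \<epsilon> v \<omega> + 1 * ((v \<bullet> ?l \<omega>) * energy \<epsilon> v \<omega>))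
      = (\<lambda>\<omega>. (energy \<epsilon> v \<omega>)\<^sup>2 / \<epsilon>)"
    using assms(1) by (simp add: fun_eq_iff inner_snd_ell4 energy_eq power2_eq_square field_simps)
  finally show ?thesis
    by (simp add: U_mom_ray f_def)
qed

text \<open>The Lagrangian scalar is recovered by contracting J u + H with -u.\<close>

lemma fst_eq_A_map:
  assumes "norm v < 1"
  shows "fst M = lorentz v * (fst (A_map v M) - v \<bullet> snd (A_map v M))"
proof -
  have "lorentz v * (fst (A_map v M) - v \<bullet> snd (A_map v M))
      = (lorentz v)\<^sup>2 * (1 - (norm v)\<^sup>2) * fst M"
    by (simp add: A_map_def inner_add_right dot_square_norm power2_eq_square algebra_simps)
  then show ?thesis
    by (simp add: lorentz_square[OF assms])
qed

text \<open>In J = W (E - v.F) the bracket is nonnegative, as |v| < 1 and |F| is at most E.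
  Positivity of the iterates' scalar part will rest on this.\<close>

lemma fst_nonneg_A_map:
  assumes v: "norm v < 1" and M: "A_map v M \<in> mom_cone"
  shows "0 \<le> fst M"
proof -
  have "v \<bullet> snd (A_map v M) \<le> norm v * norm (snd (A_map v M))"
    by (rule norm_cauchy_schwarz)
  also have "\<dots> \<le> 1 * norm (snd (A_map v M))"
    using v by (intro mult_right_mono) auto
  also have "\<dots> \<le> fst (A_map v M)"
    using M by (simp add: mom_cone_def)
  finally show ?thesis
    using lorentz_pos[OF v] by (subst fst_eq_A_map[OF v]) simp
qed

text \<open>The combined weight is E (a E / \<open>\<epsilon>\<close> - b), nonnegative by the lower
  energy bound. This compares the two densities and explains the factor W (1 - v) in the time step
  condition.\<close>

lemma U_mom_Ut_mom_cone:
  assumes \<epsilon>: "0 < \<epsilon>" and v: "norm v < 1" and f: "f \<in> real_dist"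
    and a: "0 \<le> a" and b: "b \<le> a * (lorentz v * (1 - norm v))"
  shows "a *\<^sub>R U_mom \<epsilon> v f - b *\<^sub>R Ut_mom \<epsilon> v f \<in> mom_cone"
proof -
  have int: "integrable sph f"
    using f by (simp add: real_dist_def)
  have cont: "continuous_on UNIV (\<lambda>\<omega>. (energy \<epsilon> v \<omega>)\<^sup>2 / \<epsilon>)"
    using \<epsilon> by (auto intro!: continuous_intros continuous_energy)
  have "a *\<^sub>R U_mom \<epsilon> v f - b *\<^sub>R Ut_mom \<epsilon> v f
      = ray_mom \<epsilon> v f (\<lambda>\<omega>. a * ((energy \<epsilon> v \<omega>)\<^sup>2 / \<epsilon>) + (- b) * energy \<epsilon> v \<omega>)"
    by (subst ray_mom_linear[OF \<epsilon> v int cont continuous_energy])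
      (simp add: U_mom_ray Ut_mom_ray)
  also have "\<dots> \<in> mom_cone"
  proof (rule ray_mom_cone[OF \<epsilon> v f])
    show "continuous_on UNIV (\<lambda>\<omega>. a * ((energy \<epsilon> v \<omega>)\<^sup>2 / \<epsilon>) + (- b) * energy \<epsilon> v \<omega>)"
      by (intro continuous_intros cont continuous_energy)
    fix \<omega>
    have "a * (\<epsilon> * (lorentz v * (1 - norm v))) \<le> a * energy \<epsilon> v \<omega>"
      using energy_bounds(1)[of \<epsilon> v \<omega>] \<epsilon> v a by (intro mult_left_mono) auto
    moreover have "\<epsilon> * b \<le> \<epsilon> * (a * (lorentz v * (1 - norm v)))"
      using b \<epsilon> by (intro mult_left_mono) auto
    ultimately have "b * \<epsilon> \<le> a * energy \<epsilon> v \<omega>"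
      by (simp add: mult_ac)
    then have "b \<le> a * energy \<epsilon> v \<omega> / \<epsilon>"
      using \<epsilon> by (simp add: pos_le_divide_eq)
    then have "b * energy \<epsilon> v \<omega> \<le> a * energy \<epsilon> v \<omega> / \<epsilon> * energy \<epsilon> v \<omega>"
      using energy_pos[OF \<epsilon> v, of \<omega>] by (intro mult_right_mono) auto
    then show "0 \<le> a * ((energy \<epsilon> v \<omega>)\<^sup>2 / \<epsilon>) + (- b) * energy \<epsilon> v \<omega>"
      by (simp add: power2_eq_square mult.assoc)
  qed
  finally show ?thesis .
qed

section \<open>Explicit update\<close>

lemma aff_one: "aff a b 1 = b" and aff_minus_one: "aff a b (-1) = a"
  by (simp_all add: aff_def field_simps)

text \<open>The combined weight is E (a - s q). Both signs of \<open>s\<close> occur, one for each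
  of the two opposite energy faces.\<close>

lemma Ut_Feps_cone:
  assumes \<epsilon>: "0 < \<epsilon>" and v: "norm v < 1" and f: "f \<in> real_dist" and G: "bilinear G"
    and q: "\<And>\<omega>. \<omega> \<in> space sph \<Longrightarrow> \<bar>qfac G \<epsilon> v \<omega>\<bar> \<le> a" and s: "\<bar>s\<bar> = 1"
  shows "a *\<^sub>R Ut_mom \<epsilon> v f + s *\<^sub>R Feps_mom G \<epsilon> v f \<in> mom_cone"
proof -
  have int: "integrable sph f"
    using f by (simp add: real_dist_def)
  have cont: "continuous_on UNIV (\<lambda>\<omega>. qfac G \<epsilon> v \<omega> * energy \<epsilon> v \<omega>)"
    by (intro continuous_intros continuous_qfac G continuous_energy)
  have "a *\<^sub>R Ut_mom \<epsilon> v f + s *\<^sub>R Feps_mom G \<epsilon> v f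
      = ray_mom \<epsilon> v f (\<lambda>\<omega>. a * energy \<epsilon> v \<omega> + (- s) * (qfac G \<epsilon> v \<omega> * energy \<epsilon> v \<omega>))"
    by (subst ray_mom_linear[OF \<epsilon> v int continuous_energy cont])
      (simp add: Feps_mom_ray Ut_mom_ray)
  also have "\<dots> \<in> mom_cone"
  proof (rule ray_mom_cone[OF \<epsilon> v f])
    show "continuous_on UNIV (\<lambda>\<omega>. a * energy \<epsilon> v \<omega> + (- s) * (qfac G \<epsilon> v \<omega> * energy \<epsilon> v \<omega>))"
      by (intro continuous_intros cont continuous_energy)
    fix \<omega> assume "\<omega> \<in> space sph"
    then have "\<bar>s * qfac G \<epsilon> v \<omega>\<bar> \<le> a"
      using q s by (simp add: abs_mult)
    then have "0 \<le> (a - s * qfac G \<epsilon> v \<omega>) * energy \<epsilon> v \<omega>"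
      using energy_pos[OF \<epsilon> v, of \<omega>] by (intro mult_nonneg_nonneg) auto
    then show "0 \<le> a * energy \<epsilon> v \<omega> + (- s) * (qfac G \<epsilon> v \<omega> * energy \<epsilon> v \<omega>)"
      by (simp add: left_diff_distrib mult.assoc)
  qed
  finally show ?thesis .
qed

text \<open>The combined weight is E^2 / \<open>\<epsilon>\<close> times a + s L_i, and the
  components of a unit vector are at most 1 in absolute value.\<close>

lemma U_F_cone:
  assumes \<epsilon>: "0 < \<epsilon>" and v: "norm v < 1" and f: "f \<in> real_dist"
    and a: "1 \<le> a" and s: "\<bar>s\<bar> = 1"
  shows "a *\<^sub>R U_mom \<epsilon> v f + s *\<^sub>R F_mom i \<epsilon> v f \<in> mom_cone"
proof -
  have int: "integrable sph f"
    using f by (simp add: real_dist_def)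
  have cont: "continuous_on UNIV (\<lambda>\<omega>. (energy \<epsilon> v \<omega>)\<^sup>2 / \<epsilon>)"
    using \<epsilon> by (auto intro!: continuous_intros continuous_energy)
  have cont': "continuous_on UNIV (\<lambda>\<omega>. (energy \<epsilon> v \<omega>)\<^sup>2 / \<epsilon> * (snd (L4 \<epsilon> v \<omega>) $ i))"
    by (intro continuous_on_mult cont continuous_on_component continuous_snd_L4 \<epsilon> v)
  have "a *\<^sub>R U_mom \<epsilon> v f + s *\<^sub>R F_mom i \<epsilon> v f
      = ray_mom \<epsilon> v f (\<lambda>\<omega>. a * ((energy \<epsilon> v \<omega>)\<^sup>2 / \<epsilon>)
          + s * ((energy \<epsilon> v \<omega>)\<^sup>2 / \<epsilon> * (snd (L4 \<epsilon> v \<omega>) $ i)))"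
    by (subst ray_mom_linear[OF \<epsilon> v int cont cont']) (simp add: U_mom_ray F_mom_ray)
  also have "\<dots> \<in> mom_cone"
  proof (rule ray_mom_cone[OF \<epsilon> v f])
    show "continuous_on UNIV (\<lambda>\<omega>. a * ((energy \<epsilon> v \<omega>)\<^sup>2 / \<epsilon>)
          + s * ((energy \<epsilon> v \<omega>)\<^sup>2 / \<epsilon> * (snd (L4 \<epsilon> v \<omega>) $ i)))"
      by (intro continuous_on_add continuous_on_mult cont cont' continuous_on_const)
    fix \<omega>
    have "\<bar>s * (snd (L4 \<epsilon> v \<omega>) $ i)\<bar> \<le> 1"
      using L4_component_bound[OF \<epsilon> v] s by (simp add: abs_mult)
    then have "0 \<le> (a + s * (snd (L4 \<epsilon> v \<omega>) $ i)) * ((energy \<epsilon> v \<omega>)\<^sup>2 / \<epsilon>)"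
      using a \<epsilon> by (intro mult_nonneg_nonneg) auto
    then show "0 \<le> a * ((energy \<epsilon> v \<omega>)\<^sup>2 / \<epsilon>)
        + s * ((energy \<epsilon> v \<omega>)\<^sup>2 / \<epsilon> * (snd (L4 \<epsilon> v \<omega>) $ i))"
      by (simp only: distrib_right mult.assoc
          mult.commute[of "(energy \<epsilon> v \<omega>)\<^sup>2 / \<epsilon>" "snd (L4 \<epsilon> v \<omega>) $ i"])
  qed
  finally show ?thesis .
qed

text \<open>Lax-Friedrichs splitting: the endpoint term minus its flux is (w - h a) U plus h / 2
  times a U - F(U) on each side of the face, and with the signs of F reversed at the lower face.
  Here \<open>w\<close> stands for a scaled quadrature weight and \<open>h\<close> for a scaled time
  step.\<close>

lemma flux_x_cone:
  assumes \<epsilon>: "0 < \<epsilon>" and v: "norm (v x) < 1"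
    and Um: "closed_eul cl pr \<epsilon> (v x) Um" and Up: "closed_eul cl pr \<epsilon> (v x) Up"
    and a: "1 \<le> a" and h: "0 \<le> h" "h * a \<le> w"
  shows "w *\<^sub>R Um - h *\<^sub>R flux_x cl pr v i a \<epsilon> x Um Up \<in> mom_cone"
    and "w *\<^sub>R Up + h *\<^sub>R flux_x cl pr v i a \<epsilon> x Um Up \<in> mom_cone"
proof -
  define F where "F U = F_mom i \<epsilon> (v x) (cl \<epsilon> (v x) (pr \<epsilon> (v x) U))" for U
  have cone: "U \<in> mom_cone" "a *\<^sub>R U + F U \<in> mom_cone" "a *\<^sub>R U - F U \<in> mom_cone"
    if U: "closed_eul cl pr \<epsilon> (v x) U" for U
  proof -
    define f where "f = cl \<epsilon> (v x) (pr \<epsilon> (v x) U)"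
    have f: "f \<in> real_dist" "U_mom \<epsilon> (v x) f = U"
      using U by (auto simp: closed_eul_def closed_lag_def f_def)
    show "a *\<^sub>R U + F U \<in> mom_cone"
      using U_F_cone[OF \<epsilon> v f(1) a, of 1 i] by (simp add: F_def f flip: f_def)
    show "a *\<^sub>R U - F U \<in> mom_cone"
      using U_F_cone[OF \<epsilon> v f(1) a, of "-1" i] by (simp add: F_def f flip: f_def)
    show "U \<in> mom_cone"
      using U_mom_Ut_mom_cone[OF \<epsilon> v f(1), of 1 0] lorentz_pos[OF v] v by (simp add: f)
  qed
  have "w *\<^sub>R Um - h *\<^sub>R flux_x cl pr v i a \<epsilon> x Um Up
      = (w - h * a) *\<^sub>R Um + ((h / 2) *\<^sub>R (a *\<^sub>R Um - F Um) + (h / 2) *\<^sub>R (a *\<^sub>R Up - F Up))"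
    by (simp add: flux_x_def Let_def flip: F_def) (simp add: algebra_simps flip: scaleR_add_left)
  also have "\<dots> \<in> mom_cone"
    using h by (intro mom_cone_add mom_cone_scaleR cone Um Up) auto
  finally show "w *\<^sub>R Um - h *\<^sub>R flux_x cl pr v i a \<epsilon> x Um Up \<in> mom_cone" .
  have "w *\<^sub>R Up + h *\<^sub>R flux_x cl pr v i a \<epsilon> x Um Up
      = (w - h * a) *\<^sub>R Up + ((h / 2) *\<^sub>R (a *\<^sub>R Up + F Up) + (h / 2) *\<^sub>R (a *\<^sub>R Um + F Um))"
    by (simp add: flux_x_def Let_def flip: F_def) (simp add: algebra_simps flip: scaleR_add_left)
  also have "\<dots> \<in> mom_cone"
    using h by (intro mom_cone_add mom_cone_scaleR cone Um Up) auto
  finally show "w *\<^sub>R Up + h *\<^sub>R flux_x cl pr v i a \<epsilon> x Um Up \<in> mom_cone" .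
qed

text \<open>The splitting is as in space, but the dissipation acts on \<open>Ut_mom\<close> instead
  of the evolved density. The remainder w U - h a Ut is handled by
  \<open>U_mom_Ut_mom_cone\<close>.\<close>

lemma flux_eps_cone:
  assumes \<epsilon>: "0 < \<epsilon>" and v: "norm (v x) < 1" and G: "bilinear (G x)"
    and q: "\<And>\<omega>. \<omega> \<in> space sph \<Longrightarrow> \<bar>qfac (G x) \<epsilon> (v x) \<omega>\<bar> \<le> a x"
    and Um: "closed_eul cl pr \<epsilon> (v x) Um" and Up: "closed_eul cl pr \<epsilon> (v x) Up"
    and h: "0 \<le> h" "h * a x \<le> w * (lorentz (v x) * (1 - norm (v x)))" and w: "0 \<le> w"
  shows "w *\<^sub>R Um - h *\<^sub>R flux_eps cl pr v G a \<epsilon> x Um Up \<in> mom_cone"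
    and "w *\<^sub>R Up + h *\<^sub>R flux_eps cl pr v G a \<epsilon> x Um Up \<in> mom_cone"
proof -
  define F where "F U = Feps_mom (G x) \<epsilon> (v x) (cl \<epsilon> (v x) (pr \<epsilon> (v x) U))" for U
  define V where "V U = Ut_mom \<epsilon> (v x) (cl \<epsilon> (v x) (pr \<epsilon> (v x) U))" for U
  have cone: "w *\<^sub>R U - (h * a x) *\<^sub>R V U \<in> mom_cone" "a x *\<^sub>R V U + F U \<in> mom_cone"
      "a x *\<^sub>R V U - F U \<in> mom_cone"
    if U: "closed_eul cl pr \<epsilon> (v x) U" for U
  proof -
    define f where "f = cl \<epsilon> (v x) (pr \<epsilon> (v x) U)"
    have f: "f \<in> real_dist" "U_mom \<epsilon> (v x) f = U"
      using U by (auto simp: closed_eul_def closed_lag_def f_def)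
    show "a x *\<^sub>R V U + F U \<in> mom_cone"
      using Ut_Feps_cone[where s = 1, OF \<epsilon> v f(1) G q] by (simp add: F_def V_def flip: f_def)
    show "a x *\<^sub>R V U - F U \<in> mom_cone"
      using Ut_Feps_cone[where s = "-1", OF \<epsilon> v f(1) G q] by (simp add: F_def V_def flip: f_def)
    show "w *\<^sub>R U - (h * a x) *\<^sub>R V U \<in> mom_cone"
      using U_mom_Ut_mom_cone[OF \<epsilon> v f(1) w h(2)] by (simp add: V_def f flip: f_def)
  qed
  have "w *\<^sub>R Um - h *\<^sub>R flux_eps cl pr v G a \<epsilon> x Um Up
      = (w *\<^sub>R Um - (h * a x) *\<^sub>R V Um)
        + ((h / 2) *\<^sub>R (a x *\<^sub>R V Um - F Um) + (h / 2) *\<^sub>R (a x *\<^sub>R V Up - F Up))"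
    by (simp add: flux_eps_def Let_def flip: F_def V_def)
      (simp add: algebra_simps flip: scaleR_add_left)
  also have "\<dots> \<in> mom_cone"
    using h(1) by (intro mom_cone_add mom_cone_scaleR cone Um Up) auto
  finally show "w *\<^sub>R Um - h *\<^sub>R flux_eps cl pr v G a \<epsilon> x Um Up \<in> mom_cone" .
  have "w *\<^sub>R Up + h *\<^sub>R flux_eps cl pr v G a \<epsilon> x Um Up
      = (w *\<^sub>R Up - (h * a x) *\<^sub>R V Up)
        + ((h / 2) *\<^sub>R (a x *\<^sub>R V Up + F Up) + (h / 2) *\<^sub>R (a x *\<^sub>R V Um + F Um))"
    by (simp add: flux_eps_def Let_def flip: F_def V_def)
      (simp add: algebra_simps flip: scaleR_add_left)
  also have "\<dots> \<in> mom_cone"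
    using h(1) by (intro mom_cone_add mom_cone_scaleR cone Um Up) auto
  finally show "w *\<^sub>R Up + h *\<^sub>R flux_eps cl pr v G a \<epsilon> x Um Up \<in> mom_cone" .
qed

section \<open>Nodes along one direction and element geometry\<close>

lemma sum_LGL_split:
  assumes "2 \<le> m"
  shows "(\<Sum>z\<in>LGL m. F z) = F 1 + F (-1) + (\<Sum>z\<in>LGL m - {-1, 1}. F z :: 'a::ab_group_add)"
proof -
  have "(\<Sum>z\<in>LGL m. F z) = (\<Sum>z\<in>LGL m - {-1, 1}. F z) + (\<Sum>z\<in>{-1, 1}. F z)"
    by (rule sum.subset_diff[OF _ finite_LGL[OF assms]]) (auto simp: LGL_def)
  then show ?thesis
    by (simp add: add_ac)
qed

lemma LG_bounds: "y \<in> LG N \<Longrightarrow> -1 \<le> y \<and> y \<le> 1"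
  by (auto simp: LG_def)

lemma LG_weight_prod_pos:
  assumes "y \<in> Pi\<^sub>E S (\<lambda>_. LG N)"
  shows "0 < (\<Prod>j\<in>S. LG_wt N (y j))"
  using assms by (intro prod_pos) (auto intro!: LG_wt_pos)

text \<open>Lobatto nodes in direction \<open>l\<close> and Gauss nodes elsewhere. The outer sums
  are arranged as in \<open>face_x\<close>, so the inner Lobatto sum can be compared with the face
  fluxes line by line.\<close>

lemma cell_integral_LGL_x:
  fixes K :: "'d::finite cell"
  assumes poly: "tensor_poly k g"
    and lt_eps: "eL K < eH K" and lt: "\<And>l. xL K $ l < xH K $ l"
    and Mx: "2 \<le> Mx"
    and LG_e: "exact_eps (LG N) (LG_wt N) K g" and LG_x: "\<And>l. exact_x (LG N) (LG_wt N) l K g"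
    and LGL_x: "exact_x (LGL Mx) (LGL_wt Mx) l K g"
  shows "integral (cell_closed K) (\<lambda>(\<epsilon>, x). \<epsilon>\<^sup>2 *\<^sub>R g \<epsilon> x) =
    (de K * (\<Prod>j\<in>UNIV - {l}. dx K j)) *\<^sub>R (\<Sum>y0\<in>LG N. \<Sum>y\<in>Pi\<^sub>E (UNIV - {l}) (\<lambda>_. LG N).
       (LG_wt N y0 * (\<Prod>j\<in>UNIV - {l}. LG_wt N (y j))) *\<^sub>R ((aff (eL K) (eH K) y0)\<^sup>2 *\<^sub>R
         (dx K l *\<^sub>R (\<Sum>z\<in>LGL Mx. LGL_wt Mx z *\<^sub>R g (aff (eL K) (eH K) y0)
           (\<chi> j. if j = l then aff (xL K $ l) (xH K $ l) z else aff (xL K $ j) (xH K $ j) (y j))))))"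
    (is "_ = (_ * ?P) *\<^sub>R (\<Sum>y0\<in>_. \<Sum>y\<in>_. (_ * ?W y) *\<^sub>R (?e y0 *\<^sub>R (_ *\<^sub>R (\<Sum>z\<in>_. ?g y0 y z))))")
proof -
  define Nd where "Nd = ((\<lambda>_. LG N)(l := LGL Mx))"
  define w where "w = ((\<lambda>_. LG_wt N)(l := LGL_wt Mx))"
  have nodes: "Nd i \<subseteq> {-1..1}" for i
    using LG_bounds LGL_bounds by (auto simp: Nd_def)
  have fin: "finite (Nd i)" for i
    using finite_LG finite_LGL[OF Mx] by (auto simp: Nd_def)
  have exact: "exact_x (Nd i) (w i) i K g" for i
    using LG_x LGL_x by (auto simp: Nd_def w_def)
  have U: "UNIV = insert l (UNIV - {l})"
    by auto
  have Pi: "Pi\<^sub>E (UNIV - {l}) Nd = Pi\<^sub>E (UNIV - {l}) (\<lambda>_. LG N)"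
    by (rule PiE_cong) (simp add: Nd_def)
  have Nl: "Nd l = LGL Mx"
    by (simp add: Nd_def)
  have X: "(\<Prod>j\<in>UNIV. dx K j) = dx K l * ?P"
    by (subst U, rule prod.insert) auto
  have W: "(\<Prod>j\<in>UNIV. w j ((y(l := z)) j)) = LGL_wt Mx z * ?W y" for y z
  proof -
    have "(\<Prod>j\<in>UNIV. w j ((y(l := z)) j)) = w l z * (\<Prod>j\<in>UNIV - {l}. w j ((y(l := z)) j))"
      by (subst U, subst prod.insert) auto
    also have "(\<Prod>j\<in>UNIV - {l}. w j ((y(l := z)) j)) = ?W y"
      by (rule prod.cong) (auto simp: w_def)
    finally show ?thesis
      by (simp add: w_def)
  qed
  have split: "sum h (Pi\<^sub>E UNIV Nd) = (\<Sum>z\<in>Nd l. \<Sum>y\<in>Pi\<^sub>E (UNIV - {l}) Nd. h (y(l := z)))"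
    for h :: "('d \<Rightarrow> real) \<Rightarrow> mom"
    using sum_PiE_insert[of l "UNIV - {l}" h Nd] unfolding U[symmetric] by simp
  have pt: "(\<chi> j. aff (xL K $ j) (xH K $ j) ((y(l := z)) j))
      = (\<chi> j. if j = l then aff (xL K $ l) (xH K $ l) z else aff (xL K $ j) (xH K $ j) (y j))" for y z
    by (simp add: vec_eq_iff)
  have inner: "(\<Sum>y\<in>Pi\<^sub>E UNIV Nd. (LG_wt N y0 * (\<Prod>j\<in>UNIV. w j (y j))) *\<^sub>R (?e y0 *\<^sub>R
         g (aff (eL K) (eH K) y0) (\<chi> j. aff (xL K $ j) (xH K $ j) (y j))))
      = (\<Sum>y\<in>Pi\<^sub>E (UNIV - {l}) (\<lambda>_. LG N). \<Sum>z\<in>LGL Mx.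
          (LG_wt N y0 * ?W y) *\<^sub>R (?e y0 *\<^sub>R ?g y0 y z))" for y0
  proof -
    have "(\<Sum>y\<in>Pi\<^sub>E UNIV Nd. (LG_wt N y0 * (\<Prod>j\<in>UNIV. w j (y j))) *\<^sub>R (?e y0 *\<^sub>R
         g (aff (eL K) (eH K) y0) (\<chi> j. aff (xL K $ j) (xH K $ j) (y j))))
      = (\<Sum>z\<in>Nd l. \<Sum>y\<in>Pi\<^sub>E (UNIV - {l}) Nd. (LG_wt N y0 * (\<Prod>j\<in>UNIV. w j ((y(l := z)) j))) *\<^sub>R
         (?e y0 *\<^sub>R g (aff (eL K) (eH K) y0) (\<chi> j. aff (xL K $ j) (xH K $ j) ((y(l := z)) j))))"
      by (rule split)
    then show ?thesis
      unfolding W pt Pi Nl by (subst sum.swap) (simp add: mult_ac)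
  qed
  show ?thesis
    unfolding cell_integral_quadrature[OF poly lt_eps lt nodes fin exact LG_e] inner X
    by (simp add: scaleR_sum_right mult_ac)
qed

lemma aff_interior: "a < b \<Longrightarrow> y \<in> LG N \<Longrightarrow> a < aff a b y \<and> aff a b y < b"
proof -
  assume "a < b" "y \<in> LG N"
  then have "0 < (b - a) * (1 + y)" "0 < (b - a) * (1 - y)"
    by (auto simp: LG_def)
  then show ?thesis
    by (simp add: aff_def field_simps)
qed

text \<open>Interior nodes have positive energy even when the element starts at energy 0.\<close>

lemma aff_LGL_interior:
  assumes "a < b" "y \<in> LGL m - {-1, 1}"
  shows "a < aff a b y"
proof -
  have "0 < (b - a) * (1 + y)"
    using assms by (auto simp: LGL_def)
  then show ?thesis
    by (simp add: aff_def field_simps)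
qed

lemma S_all_x:
  assumes "y0 \<in> LG N" "z \<in> LGL Mx" "y \<in> Pi\<^sub>E (UNIV - {l}) (\<lambda>_. LG N)"
  shows "(aff (eL K) (eH K) y0, \<chi> j. if j = l then aff (xL K $ l) (xH K $ l) z
      else aff (xL K $ j) (xH K $ j) (y j)) \<in> S_all N Me Mx K"
proof -
  have "(aff (eL K) (eH K) y0, \<chi> j. if j = l then aff (xL K $ l) (xH K $ l) z
      else aff (xL K $ j) (xH K $ j) (y j)) \<in> tensor_nodes K (LG N) ((\<lambda>_. LG N)(l := LGL Mx))"
    using assms by (auto simp: tensor_nodes_def PiE_iff)
  then show ?thesis
    unfolding S_all_def by blast
qed

lemma S_all_eps:
  assumes "z \<in> LGL Me" "y \<in> Pi\<^sub>E UNIV (\<lambda>_. LG N)"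
  shows "(aff (eL K) (eH K) z, \<chi> j. aff (xL K $ j) (xH K $ j) (y j)) \<in> S_all N Me Mx K"
proof -
  have "(aff (eL K) (eH K) z, \<chi> j. aff (xL K $ j) (xH K $ j) (y j))
      \<in> tensor_nodes K (LGL Me) (\<lambda>_. LG N)"
    using assms by (auto simp: tensor_nodes_def PiE_iff)
  then show ?thesis
    unfolding S_all_def by blast
qed

lemma vol_eps_pos:
  assumes "0 \<le> eL K" "eL K < eH K"
  shows "0 < vol_eps K"
proof -
  have "((\<lambda>t. t\<^sup>2) has_integral ((eH K) ^ 3 / 3 - (eL K) ^ 3 / 3)) {eL K..eH K}"
    using assms(2)
    by (intro fundamental_theorem_of_calculus)
      (auto intro!: derivative_eq_intros simp flip: has_real_derivative_iff_has_vector_derivative)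
  then have "vol_eps K = (eH K) ^ 3 / 3 - (eL K) ^ 3 / 3"
    by (simp add: vol_eps_def integral_unique)
  moreover have "(eL K) ^ 3 < (eH K) ^ 3"
    using assms by (intro power_strict_mono) auto
  ultimately show ?thesis
    by simp
qed

text \<open>Otherwise the open cell would contain a point of negative energy over its spatial
  midpoint.\<close>

lemma mesh_energy_nonneg:
  assumes mesh: "mesh \<Omega>e \<Omega>x T" and K: "K \<in> T"
  shows "0 \<le> eL K"
proof (rule ccontr)
  have lt: "eL K < eH K" "xL K $ l < xH K $ l" for l
    using mesh K by (auto simp: mesh_def)
  assume "\<not> 0 \<le> eL K"
  then obtain \<epsilon> where \<epsilon>: "eL K < \<epsilon>" "\<epsilon> < min 0 (eH K)"
    using dense[of "eL K" "min 0 (eH K)"] lt(1) by auto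
  have "cell_open K \<subseteq> \<Omega>e \<times> \<Omega>x" "\<Omega>e \<subseteq> {0<..}"
    using mesh K by (auto simp: mesh_def)
  moreover have "(\<epsilon>, (\<chi> j. (xL K $ j + xH K $ j) / 2)) \<in> cell_open K"
    using \<epsilon> lt(2) by (simp add: cell_open_def mem_box_cart)
  ultimately have "0 < \<epsilon>"
    by auto
  with \<epsilon> show False by simp
qed

text \<open>One stage with its field \<open>U\<close> and boundary data \<open>B\<close> frozen, to
  be instantiated for every earlier stage. The closure is asked for at positive energies only, since
  an element may start at energy 0.\<close>

locale dg_field =
  fixes \<Omega>e :: "real set" and \<Omega>x :: "(real^'d::finite) set" and T :: "'d cell set"
    and v :: "real^'d \<Rightarrow> real^3" and G :: "real^'d \<Rightarrow> four \<Rightarrow> four \<Rightarrow> real"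
    and cl :: closure and pr :: conversion
    and aeps :: "real^'d \<Rightarrow> real" and ax :: "'d \<Rightarrow> real"
    and k N Me Mx :: nat and U B :: "'d field"
  assumes mesh: "mesh \<Omega>e \<Omega>x T"
    and velocity: "\<forall>x\<in>closure \<Omega>x. norm (v x) < 1"
    and gradient: "\<forall>x\<in>closure \<Omega>x. bilinear (G x)"
    and aeps: "\<forall>x\<in>closure \<Omega>x. \<forall>\<epsilon>>0. \<forall>\<omega>\<in>space sph. \<bar>qfac (G x) \<epsilon> (v x) \<omega>\<bar> \<le> aeps x"
    and ax: "\<forall>l. 1 \<le> ax l"
    and points: "1 \<le> N" "3 \<le> Me" "2 \<le> Mx"
    and poly: "\<forall>K\<in>T. tensor_poly k (U K)"
    and LG_eps_exact: "\<forall>K\<in>T. exact_eps (LG N) (LG_wt N) K (U K)"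
    and LG_x_exact: "\<forall>K\<in>T. \<forall>l. exact_x (LG N) (LG_wt N) l K (U K)"
    and LGL_x_exact: "\<forall>K\<in>T. \<forall>l. exact_x (LGL Mx) (LGL_wt Mx) l K (U K)"
    and LGL_eps_exact: "\<forall>K\<in>T. exact_eps (LGL Me) (LGL_wt Me) K (U K)"
    and closed_bdry: "\<And>K \<epsilon> x. K \<in> T \<Longrightarrow> (\<epsilon>, x) \<in> cell_closed K \<Longrightarrow>
        (\<epsilon>, x) \<in> frontier (\<Omega>e \<times> \<Omega>x) \<Longrightarrow> 0 < \<epsilon> \<Longrightarrow> closed_eul cl pr \<epsilon> (v x) (B K \<epsilon> x)"
    and realizable_values: "\<And>K \<epsilon> x. K \<in> T \<Longrightarrow> (\<epsilon>, x) \<in> S_all N Me Mx K \<Longrightarrow> U K \<epsilon> x \<in> eul_real"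
    and closed_inner: "\<And>K \<epsilon> x. K \<in> T \<Longrightarrow> (\<epsilon>, x) \<in> S_all N Me Mx K \<Longrightarrow> 0 < \<epsilon> \<Longrightarrow>
        closed_eul cl pr \<epsilon> (v x) (U K \<epsilon> x)"
begin

section \<open>Forward Euler step for the average on one element\<close>

lemma cell_lt:
  assumes "K \<in> T"
  shows "eL K < eH K" "xL K $ l < xH K $ l"
  using mesh assms by (auto simp: mesh_def)

lemma cell_energy:
  assumes K: "K \<in> T"
  shows "0 \<le> eL K" "0 < eH K"
  using mesh_energy_nonneg[OF mesh K] cell_lt(1)[OF K] by auto

lemma cell_space:
  assumes K: "K \<in> T" and x: "x \<in> cbox (xL K) (xH K)"
  shows "x \<in> closure \<Omega>x"
proof -
  have "(eL K, x) \<in> cell_closed K"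
    using x cell_lt(1)[OF K] by (simp add: cell_closed_def)
  then have "(eL K, x) \<in> closure (\<Omega>e \<times> \<Omega>x)"
    using mesh K unfolding mesh_def by blast
  then show ?thesis
    by (simp add: closure_Times)
qed

text \<open>A face node is either a node of the neighbour too, or carries boundary data. The
  assumption covers every neighbour, hence also the one picked by \<open>SOME\<close>.\<close>

lemma ext_trace_closed:
  assumes "K \<in> T" "0 < \<epsilon>" "(\<epsilon>, x) \<in> cell_closed K"
    and nbr: "\<And>K'. K' \<in> T \<Longrightarrow> P K' \<Longrightarrow> (\<epsilon>, x) \<in> S_all N Me Mx K'"
    and bdry: "(\<exists>K'\<in>T. P K') \<or> (\<epsilon>, x) \<in> frontier (\<Omega>e \<times> \<Omega>x)"
  shows "closed_eul cl pr \<epsilon> (v x) (ext_trace T U B K P \<epsilon> x)"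
proof (cases "\<exists>K'\<in>T. P K'")
  case True
  define K' where "K' = (SOME K'. K' \<in> T \<and> P K')"
  have "K' \<in> T \<and> P K'"
    unfolding K'_def by (rule someI_ex) (use True in blast)
  then have "closed_eul cl pr \<epsilon> (v x) (U K' \<epsilon> x)"
    using nbr[of K'] closed_inner \<open>0 < \<epsilon>\<close> by blast
  then show ?thesis
    using True by (simp add: ext_trace_def K'_def)
next
  case False
  then show ?thesis
    using assms(1-3) bdry closed_bdry by (simp add: ext_trace_def)
qed

text \<open>The copy of the average assigned to direction \<open>l\<close>. On each line of nodes
  the two endpoint terms absorb the two face fluxes, and the interior terms already lie in the
  cone.\<close>

lemma x_bracket_cone:
  assumes K: "K \<in> T" and H: "0 \<le> H" "H * ax l \<le> LGL_wt Mx 1 * dx K l"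
  shows "integral (cell_closed K) (\<lambda>(\<epsilon>, x). \<epsilon>\<^sup>2 *\<^sub>R U K \<epsilon> x)
      - H *\<^sub>R (face_x N l K (xH K $ l) (\<lambda>\<epsilon> x. flux_x cl pr v i (ax l) \<epsilon> x
              (U K \<epsilon> x) (ext_trace T U B K (\<lambda>K'. next_x l K K') \<epsilon> x))
        - face_x N l K (xL K $ l) (\<lambda>\<epsilon> x. flux_x cl pr v i (ax l) \<epsilon> x
              (ext_trace T U B K (\<lambda>K'. next_x l K' K) \<epsilon> x) (U K \<epsilon> x))) \<in> mom_cone"
proof -
  let ?Y = "Pi\<^sub>E (UNIV - {l}) (\<lambda>_. LG N)"
  define C where "C = de K * (\<Prod>j\<in>UNIV - {l}. dx K j)"
  define w where "w y0 y = LG_wt N y0 * (\<Prod>j\<in>UNIV - {l}. LG_wt N (y j))" for y0 and y :: "'d \<Rightarrow> real"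
  define e where "e y0 = aff (eL K) (eH K) y0" for y0
  define p where "p t y = (\<chi> j. if j = l then t else aff (xL K $ j) (xH K $ j) (y j))" for t y
  define FH where "FH y0 y = flux_x cl pr v i (ax l) (e y0) (p (xH K $ l) y) (U K (e y0) (p (xH K $ l) y))
      (ext_trace T U B K (\<lambda>K'. next_x l K K') (e y0) (p (xH K $ l) y))" for y0 y
  define FL where "FL y0 y = flux_x cl pr v i (ax l) (e y0) (p (xL K $ l) y)
      (ext_trace T U B K (\<lambda>K'. next_x l K' K) (e y0) (p (xL K $ l) y)) (U K (e y0) (p (xL K $ l) y))" for y0 y
  define g where "g y0 y z = U K (e y0) (p (aff (xL K $ l) (xH K $ l) z) y)" for y0 y z
  have I: "integral (cell_closed K) (\<lambda>(\<epsilon>, x). \<epsilon>\<^sup>2 *\<^sub>R U K \<epsilon> x)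
    = C *\<^sub>R (\<Sum>y0\<in>LG N. \<Sum>y\<in>?Y. w y0 y *\<^sub>R ((e y0)\<^sup>2 *\<^sub>R
         (dx K l *\<^sub>R (\<Sum>z\<in>LGL Mx. LGL_wt Mx z *\<^sub>R g y0 y z))))"
    unfolding C_def w_def e_def p_def g_def
    using K poly cell_lt[OF K] points LG_eps_exact LG_x_exact LGL_x_exact
    by (intro cell_integral_LGL_x) auto
  have cone: "dx K l *\<^sub>R (\<Sum>z\<in>LGL Mx. LGL_wt Mx z *\<^sub>R g y0 y z) - H *\<^sub>R (FH y0 y - FL y0 y) \<in> mom_cone"
    if y0: "y0 \<in> LG N" and y: "y \<in> ?Y" for y0 y
  proof -
    have \<epsilon>: "0 < e y0"
      using aff_interior[OF cell_lt(1)[OF K] y0] cell_energy(1)[OF K] by (simp add: e_def)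
    have S: "(e y0, p (aff (xL K $ l) (xH K $ l) z) y) \<in> S_all N Me Mx K" if "z \<in> LGL Mx" for z
      unfolding e_def p_def by (rule S_all_x[OF y0 that y])
    have ends: "1 \<in> LGL Mx" "-1 \<in> LGL Mx"
      by (auto simp: LGL_def)
    have yj: "aff (xL K $ j) (xH K $ j) (y j) \<in> {xL K $ j..xH K $ j}" if "j \<noteq> l" for j
    proof -
      have "y j \<in> LG N"
        using y that by (auto simp: PiE_iff)
      then show ?thesis
        using aff_interior[OF cell_lt(2)[OF K, of j], of "y j" N] by simp
    qed
    have box: "p t y \<in> cbox (xL K) (xH K)" if "t \<in> {xL K $ l..xH K $ l}" for t
      using yj that by (auto simp: p_def mem_box_cart)
    have xH: "xH K $ l \<in> {xL K $ l..xH K $ l}" and xL: "xL K $ l \<in> {xL K $ l..xH K $ l}"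
      using cell_lt(2)[OF K, of l] by auto
    have closed: "(e y0, p t y) \<in> cell_closed K" if "t \<in> {xL K $ l..xH K $ l}" for t
      using box[OF that] aff_interior[OF cell_lt(1)[OF K] y0] by (simp add: cell_closed_def e_def)
    have v: "norm (v (p t y)) < 1" if "t \<in> {xL K $ l..xH K $ l}" for t
      using velocity cell_space[OF K box[OF that]] by blast
    have inner: "closed_eul cl pr (e y0) (v (p t y)) (U K (e y0) (p t y))"
      if "t = xL K $ l \<or> t = xH K $ l" for t
      using that S[OF ends(1)] S[OF ends(2)] closed_inner K \<epsilon> by (auto simp: aff_one aff_minus_one)
    have upper: "closed_eul cl pr (e y0) (v (p (xH K $ l) y))
        (ext_trace T U B K (\<lambda>K'. next_x l K K') (e y0) (p (xH K $ l) y))"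
    proof (rule ext_trace_closed[OF K \<epsilon> closed[OF xH]])
      show "(\<exists>K'\<in>T. next_x l K K') \<or> (e y0, p (xH K $ l) y) \<in> frontier (\<Omega>e \<times> \<Omega>x)"
      proof -
        have "(e y0, p (xH K $ l) y) \<in> {z \<in> cell_closed K. snd z $ l = xH K $ l}"
          using closed[OF xH] by (simp add: p_def)
        then show ?thesis
          using mesh K unfolding mesh_def by blast
      qed
      fix K' assume K': "K' \<in> T" "next_x l K K'"
      \<comment> \<open>The upper end of this cell is the lower end, node -1, of the neighbour; the
        transverse Gauss nodes agree because the cells agree in all other coordinates.\<close>
      have "(e y0, p (xH K $ l) y) = (aff (eL K') (eH K') y0, \<chi> j. if j = l
          then aff (xL K' $ l) (xH K' $ l) (-1) else aff (xL K' $ j) (xH K' $ j) (y j))"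
        using K' by (auto simp: e_def p_def next_x_def aff_minus_one vec_eq_iff)
      then show "(e y0, p (xH K $ l) y) \<in> S_all N Me Mx K'"
        using S_all_x[OF y0 ends(2) y, of K' Me] by simp
    qed
    have lower: "closed_eul cl pr (e y0) (v (p (xL K $ l) y))
        (ext_trace T U B K (\<lambda>K'. next_x l K' K) (e y0) (p (xL K $ l) y))"
    proof (rule ext_trace_closed[OF K \<epsilon> closed[OF xL]])
      show "(\<exists>K'\<in>T. next_x l K' K) \<or> (e y0, p (xL K $ l) y) \<in> frontier (\<Omega>e \<times> \<Omega>x)"
      proof -
        have "(e y0, p (xL K $ l) y) \<in> {z \<in> cell_closed K. snd z $ l = xL K $ l}"
          using closed[OF xL] by (simp add: p_def)
        then show ?thesis
          using mesh K unfolding mesh_def by blast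
      qed
      fix K' assume K': "K' \<in> T" "next_x l K' K"
      have "(e y0, p (xL K $ l) y) = (aff (eL K') (eH K') y0, \<chi> j. if j = l
          then aff (xL K' $ l) (xH K' $ l) 1 else aff (xL K' $ j) (xH K' $ j) (y j))"
        using K' by (auto simp: e_def p_def next_x_def aff_one vec_eq_iff)
      then show "(e y0, p (xL K $ l) y) \<in> S_all N Me Mx K'"
        using S_all_x[OF y0 ends(1) y, of K' Me] by simp
    qed
    have axl: "1 \<le> ax l"
      using ax by simp
    define a where "a = LGL_wt Mx 1 * dx K l"
    have c1: "a *\<^sub>R g y0 y 1 - H *\<^sub>R FH y0 y \<in> mom_cone"
      unfolding FH_def g_def aff_one a_def
      by (rule flux_x_cone(1)[where v = v and x = "p (xH K $ l) y", OF \<epsilon> v[OF xH]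
            inner[OF disjI2[OF refl]] upper axl H])
    have c2: "a *\<^sub>R g y0 y (-1) + H *\<^sub>R FL y0 y \<in> mom_cone"
      unfolding FL_def g_def aff_minus_one a_def
      by (rule flux_x_cone(2)[where v = v and x = "p (xL K $ l) y", OF \<epsilon> v[OF xL] lower
            inner[OF disjI1[OF refl]] axl H])
    have c3: "dx K l *\<^sub>R (\<Sum>z\<in>LGL Mx - {-1, 1}. LGL_wt Mx z *\<^sub>R g y0 y z) \<in> mom_cone"
    proof (intro mom_cone_scaleR mom_cone_sum)
      show "0 \<le> dx K l"
        using cell_lt(2)[OF K, of l] by (simp add: dx_def)
      fix z assume z: "z \<in> LGL Mx - {-1, 1}"
      show "0 \<le> LGL_wt Mx z"
        using LGL_wt_pos[of Mx z] z points(3) by auto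
      show "g y0 y z \<in> mom_cone"
        using realizable_values K S[of z] z unfolding g_def eul_real_iff by blast
    qed
    have "dx K l *\<^sub>R (\<Sum>z\<in>LGL Mx. LGL_wt Mx z *\<^sub>R g y0 y z) - H *\<^sub>R (FH y0 y - FL y0 y)
      = (a *\<^sub>R g y0 y 1 - H *\<^sub>R FH y0 y) + (a *\<^sub>R g y0 y (-1) + H *\<^sub>R FL y0 y)
        + dx K l *\<^sub>R (\<Sum>z\<in>LGL Mx - {-1, 1}. LGL_wt Mx z *\<^sub>R g y0 y z)"
      unfolding sum_LGL_split[OF points(3)] LGL_wt_minus_one a_def
      by (simp add: scaleR_add_right scaleR_diff_right mult.commute)
    then show ?thesis
      using c1 c2 c3 by (simp only: mom_cone_add)
  qed
  have "face_x N l K (xH K $ l) (\<lambda>\<epsilon> x. flux_x cl pr v i (ax l) \<epsilon> x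
              (U K \<epsilon> x) (ext_trace T U B K (\<lambda>K'. next_x l K K') \<epsilon> x))
      = C *\<^sub>R (\<Sum>y0\<in>LG N. \<Sum>y\<in>?Y. w y0 y *\<^sub>R ((e y0)\<^sup>2 *\<^sub>R FH y0 y))"
    unfolding face_x_def C_def w_def FH_def e_def p_def ..
  moreover have "face_x N l K (xL K $ l) (\<lambda>\<epsilon> x. flux_x cl pr v i (ax l) \<epsilon> x
              (ext_trace T U B K (\<lambda>K'. next_x l K' K) \<epsilon> x) (U K \<epsilon> x))
      = C *\<^sub>R (\<Sum>y0\<in>LG N. \<Sum>y\<in>?Y. w y0 y *\<^sub>R ((e y0)\<^sup>2 *\<^sub>R FL y0 y))"
    unfolding face_x_def C_def w_def FL_def e_def p_def ..
  moreover have "C *\<^sub>R (\<Sum>y0\<in>LG N. \<Sum>y\<in>?Y. w y0 y *\<^sub>R ((e y0)\<^sup>2 *\<^sub>R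
         (dx K l *\<^sub>R (\<Sum>z\<in>LGL Mx. LGL_wt Mx z *\<^sub>R g y0 y z))))
      - H *\<^sub>R (C *\<^sub>R (\<Sum>y0\<in>LG N. \<Sum>y\<in>?Y. w y0 y *\<^sub>R ((e y0)\<^sup>2 *\<^sub>R FH y0 y))
        - C *\<^sub>R (\<Sum>y0\<in>LG N. \<Sum>y\<in>?Y. w y0 y *\<^sub>R ((e y0)\<^sup>2 *\<^sub>R FL y0 y)))
      = C *\<^sub>R (\<Sum>y0\<in>LG N. \<Sum>y\<in>?Y. w y0 y *\<^sub>R ((e y0)\<^sup>2 *\<^sub>R
         (dx K l *\<^sub>R (\<Sum>z\<in>LGL Mx. LGL_wt Mx z *\<^sub>R g y0 y z) - H *\<^sub>R (FH y0 y - FL y0 y))))"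
    (is "?lhs = ?rhs")
    by (simp add: scaleR_diff_right scaleR_sum_right sum_subtractf sum.distrib mult_ac)
  moreover have "?rhs \<in> mom_cone"
  proof (intro mom_cone_scaleR mom_cone_sum cone)
    show "0 \<le> C"
      using cell_lt[OF K] unfolding C_def
      by (intro mult_nonneg_nonneg prod_nonneg) (auto simp: de_def dx_def less_imp_le)
    fix y0 y assume "y0 \<in> LG N" "y \<in> ?Y"
    then show "0 \<le> w y0 y"
      using LG_wt_pos[of y0 N] LG_weight_prod_pos[of y "UNIV - {l}" N] by (simp add: w_def)
  qed auto
  ultimately show ?thesis
    unfolding I by (simp only:)
qed

text \<open>Faces carry the cube of the energy and nodes its square. Pulling out the square leaves
  \<open>H\<close> times the face energy as the effective step, which is why \<open>eH K\<close>
  enters the condition.\<close>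

lemma eps_bracket_realizable:
  assumes K: "K \<in> T" and H: "0 \<le> H"
    and cfl: "\<And>x. x \<in> box (xL K) (xH K) \<Longrightarrow>
      H * (eH K * aeps x) \<le> lorentz (v x) * (1 - norm (v x)) * (LGL_wt Me 1 * de K)"
  shows "integral (cell_closed K) (\<lambda>(\<epsilon>, x). \<epsilon>\<^sup>2 *\<^sub>R U K \<epsilon> x)
      - H *\<^sub>R (face_eps N K (\<lambda>x. (eH K)^3 *\<^sub>R flux_eps cl pr v G aeps (eH K) x
              (U K (eH K) x) (ext_trace T U B K (\<lambda>K'. next_eps K K') (eH K) x))
        - face_eps N K (\<lambda>x. (eL K)^3 *\<^sub>R flux_eps cl pr v G aeps (eL K) x
              (ext_trace T U B K (\<lambda>K'. next_eps K' K) (eL K) x) (U K (eL K) x))) \<in> eul_real"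
proof -
  let ?Y = "Pi\<^sub>E (UNIV :: 'd set) (\<lambda>_. LG N)"
  define X where "X = (\<Prod>j\<in>UNIV. dx K j)"
  define w where "w y = (\<Prod>j\<in>UNIV. LG_wt N (y j))" for y :: "'d \<Rightarrow> real"
  define p where "p y = (\<chi> j. aff (xL K $ j) (xH K $ j) (y j))" for y
  define e where "e z = aff (eL K) (eH K) z" for z
  define FH where "FH y = flux_eps cl pr v G aeps (eH K) (p y) (U K (eH K) (p y))
      (ext_trace T U B K (\<lambda>K'. next_eps K K') (eH K) (p y))" for y
  define FL where "FL y = flux_eps cl pr v G aeps (eL K) (p y)
      (ext_trace T U B K (\<lambda>K'. next_eps K' K) (eL K) (p y)) (U K (eL K) (p y))" for y
  have Me: "2 \<le> Me"
    using points by simp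
  have finY: "finite ?Y"
    by (simp add: finite_PiE finite_LG)
  have I: "integral (cell_closed K) (\<lambda>(\<epsilon>, x). \<epsilon>\<^sup>2 *\<^sub>R U K \<epsilon> x)
    = X *\<^sub>R (\<Sum>y\<in>?Y. w y *\<^sub>R (de K *\<^sub>R (\<Sum>z\<in>LGL Me. LGL_wt Me z *\<^sub>R ((e z)\<^sup>2 *\<^sub>R U K (e z) (p y)))))"
  proof -
    have "integral (cell_closed K) (\<lambda>(\<epsilon>, x). \<epsilon>\<^sup>2 *\<^sub>R U K \<epsilon> x)
      = (de K * X) *\<^sub>R (\<Sum>z\<in>LGL Me. \<Sum>y\<in>?Y. (LGL_wt Me z * w y) *\<^sub>R ((e z)\<^sup>2 *\<^sub>R U K (e z) (p y)))"
      unfolding X_def w_def e_def p_def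
      using K poly cell_lt[OF K] LGL_eps_exact LG_x_exact finite_LG LG_bounds
      by (intro cell_integral_quadrature) auto
    then show ?thesis
      by (subst (asm) sum.swap) (simp add: scaleR_sum_right mult_ac)
  qed
  have inner: "de K *\<^sub>R (\<Sum>z\<in>LGL Me. LGL_wt Me z *\<^sub>R ((e z)\<^sup>2 *\<^sub>R U K (e z) (p y)))
      - H *\<^sub>R ((eH K)^3 *\<^sub>R FH y - (eL K)^3 *\<^sub>R FL y) \<in> eul_real"
    if y: "y \<in> ?Y" for y
  proof -
    have de: "0 < de K"
      using cell_lt(1)[OF K] by (simp add: de_def)
    have S: "(e z, p y) \<in> S_all N Me Mx K" if "z \<in> LGL Me" for z
      unfolding e_def p_def by (rule S_all_eps[OF that y])
    have ends: "1 \<in> LGL Me" "-1 \<in> LGL Me"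
      by (auto simp: LGL_def)
    have box: "p y \<in> box (xL K) (xH K)"
      using y aff_interior[OF cell_lt(2)[OF K]] by (auto simp: p_def mem_box_cart PiE_iff)
    then have cbox: "p y \<in> cbox (xL K) (xH K)"
      using box_subset_cbox by blast
    have px: "p y \<in> closure \<Omega>x"
      by (rule cell_space[OF K cbox])
    have v: "norm (v (p y)) < 1" and G: "bilinear (G (p y))"
      and q: "0 < \<epsilon> \<Longrightarrow> \<omega> \<in> space sph \<Longrightarrow> \<bar>qfac (G (p y)) \<epsilon> (v (p y)) \<omega>\<bar> \<le> aeps (p y)" for \<epsilon> \<omega>
      using velocity gradient aeps px by blast+
    \<comment> \<open>Any point of the sphere will do: a bound on an absolute value is
      nonnegative.\<close>
    have "(0, 0) \<in> space sph"
      by (simp add: space_sph)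
    from q[OF zero_less_one this] have a0: "0 \<le> aeps (p y)"
      by linarith
    have closed: "(\<epsilon>, p y) \<in> cell_closed K" if "\<epsilon> \<in> {eL K..eH K}" for \<epsilon>
      using that cbox by (simp add: cell_closed_def)
    define a where "a = LGL_wt Me 1 * de K"
    have a: "0 \<le> a"
      using de LGL_wt_pos[OF Me ends(1)] by (simp add: a_def)
    have cflH: "(H * eH K) * aeps (p y) \<le> a * (lorentz (v (p y)) * (1 - norm (v (p y))))"
      using cfl[OF box] by (simp add: a_def mult_ac)
    have c1: "a *\<^sub>R U K (eH K) (p y) - (H * eH K) *\<^sub>R FH y \<in> mom_cone"
      unfolding FH_def
    proof (rule flux_eps_cone(1)[where v = v and x = "p y" and G = G and a = aeps, OF cell_energy(2)[OF K] v G q[OF cell_energy(2)[OF K]] _ _ _ cflH a])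
      show "closed_eul cl pr (eH K) (v (p y)) (U K (eH K) (p y))"
        using S[OF ends(1)] closed_inner K cell_energy(2)[OF K] by (auto simp: e_def aff_one)
      show "closed_eul cl pr (eH K) (v (p y)) (ext_trace T U B K (\<lambda>K'. next_eps K K') (eH K) (p y))"
      proof (rule ext_trace_closed[OF K cell_energy(2)[OF K]])
        show *: "(eH K, p y) \<in> cell_closed K"
          using closed[of "eH K"] cell_lt(1)[OF K] by simp
        then have "(eH K, p y) \<in> {z \<in> cell_closed K. fst z = eH K}"
          by simp
        then show "(\<exists>K'\<in>T. next_eps K K') \<or> (eH K, p y) \<in> frontier (\<Omega>e \<times> \<Omega>x)"
          using mesh K unfolding mesh_def by blast
        fix K' assume K': "K' \<in> T" "next_eps K K'"
        then have "(eH K, p y) = (aff (eL K') (eH K') (-1), \<chi> j. aff (xL K' $ j) (xH K' $ j) (y j))"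
          by (simp add: next_eps_def aff_minus_one p_def)
        then show "(eH K, p y) \<in> S_all N Me Mx K'"
          using S_all_eps[OF ends(2) y, of K' Mx] by simp
      qed
      show "0 \<le> H * eH K"
        using H cell_energy(2)[OF K] by simp
    qed simp
    have c2: "(eL K)\<^sup>2 *\<^sub>R (a *\<^sub>R U K (eL K) (p y) + (H * eL K) *\<^sub>R FL y) \<in> mom_cone"
    proof (cases "eL K = 0")
      case True
      then show ?thesis
        by (simp add: mom_cone_zero)
    next
      case False
      then have pos: "0 < eL K"
        using cell_energy(1)[OF K] by simp
      \<comment> \<open>Because \<open>aeps\<close> is nonnegative, the condition stated at the
        upper energy implies the one at the lower energy.\<close>
      have "H * eL K * aeps (p y) \<le> H * eH K * aeps (p y)"
        using H a0 cell_lt(1)[OF K] by (intro mult_right_mono mult_left_mono) auto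
      then have cflL: "(H * eL K) * aeps (p y) \<le> a * (lorentz (v (p y)) * (1 - norm (v (p y))))"
        using cflH by linarith
      have "a *\<^sub>R U K (eL K) (p y) + (H * eL K) *\<^sub>R FL y \<in> mom_cone"
        unfolding FL_def
      proof (rule flux_eps_cone(2)[where v = v and x = "p y" and G = G and a = aeps, OF pos v G q[OF pos] _ _ _ cflL a])
        show "closed_eul cl pr (eL K) (v (p y)) (U K (eL K) (p y))"
          using S[OF ends(2)] closed_inner K pos by (auto simp: e_def aff_minus_one)
        show "closed_eul cl pr (eL K) (v (p y)) (ext_trace T U B K (\<lambda>K'. next_eps K' K) (eL K) (p y))"
        proof (rule ext_trace_closed[OF K pos])
          show *: "(eL K, p y) \<in> cell_closed K"
            using closed[of "eL K"] cell_lt(1)[OF K] by simp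
          then have "(eL K, p y) \<in> {z \<in> cell_closed K. fst z = eL K}"
            by simp
          then show "(\<exists>K'\<in>T. next_eps K' K) \<or> (eL K, p y) \<in> frontier (\<Omega>e \<times> \<Omega>x)"
            using mesh K unfolding mesh_def by blast
          fix K' assume K': "K' \<in> T" "next_eps K' K"
          then have "(eL K, p y) = (aff (eL K') (eH K') 1, \<chi> j. aff (xL K' $ j) (xH K' $ j) (y j))"
            by (simp add: next_eps_def aff_one p_def)
          then show "(eL K, p y) \<in> S_all N Me Mx K'"
            using S_all_eps[OF ends(1) y, of K' Mx] by simp
        qed
        show "0 \<le> H * eL K"
          using H pos by simp
      qed simp
      then show ?thesis
        by (rule mom_cone_scaleR[rotated]) simp
    qed
    obtain z0 where z0: "z0 \<in> LGL Me - {-1, 1}"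
      using LGL_interior_nonempty[OF points(2)] by blast
    \<comment> \<open>The source of strictness: an interior node has positive weight, positive
      energy and a realizable value.\<close>
    have c3: "de K *\<^sub>R (\<Sum>z\<in>LGL Me - {-1, 1}. (LGL_wt Me z * (e z)\<^sup>2) *\<^sub>R U K (e z) (p y)) \<in> eul_real"
    proof (rule eul_real_scaleR[OF de], rule eul_real_sum[OF _ z0])
      have *: "(LGL_wt Me z * (e z)\<^sup>2) *\<^sub>R U K (e z) (p y) \<in> eul_real" if z: "z \<in> LGL Me - {-1, 1}" for z
      proof (rule eul_real_scaleR)
        have "0 < e z"
          using aff_LGL_interior[OF cell_lt(1)[OF K] z] cell_energy(1)[OF K] by (simp add: e_def)
        then show "0 < LGL_wt Me z * (e z)\<^sup>2"
          using LGL_wt_pos[OF Me] z by simp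
        show "U K (e z) (p y) \<in> eul_real"
          using realizable_values K S[of z] z by blast
      qed
      show "(LGL_wt Me z0 * (e z0)\<^sup>2) *\<^sub>R U K (e z0) (p y) \<in> eul_real"
        by (rule *[OF z0])
      show "(LGL_wt Me z * (e z)\<^sup>2) *\<^sub>R U K (e z) (p y) \<in> mom_cone" if "z \<in> LGL Me - {-1, 1}" for z
        using *[OF that] by (simp only: eul_real_iff)
    qed (simp add: finite_LGL[OF Me])
    have "de K *\<^sub>R (\<Sum>z\<in>LGL Me. LGL_wt Me z *\<^sub>R ((e z)\<^sup>2 *\<^sub>R U K (e z) (p y)))
        - H *\<^sub>R ((eH K)^3 *\<^sub>R FH y - (eL K)^3 *\<^sub>R FL y)
      = de K *\<^sub>R (\<Sum>z\<in>LGL Me - {-1, 1}. (LGL_wt Me z * (e z)\<^sup>2) *\<^sub>R U K (e z) (p y))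
        + ((eH K)\<^sup>2 *\<^sub>R (a *\<^sub>R U K (eH K) (p y) - (H * eH K) *\<^sub>R FH y)
        + (eL K)\<^sup>2 *\<^sub>R (a *\<^sub>R U K (eL K) (p y) + (H * eL K) *\<^sub>R FL y))"
    proof -
      have "e 1 = eH K" "e (-1) = eL K"
        by (simp_all add: e_def aff_one aff_minus_one)
      then show ?thesis
        unfolding sum_LGL_split[OF Me] LGL_wt_minus_one a_def
        by (simp add: scaleR_add_right scaleR_diff_right power2_eq_square power3_eq_cube mult_ac)
    qed
    also have "\<dots> \<in> eul_real"
      by (intro eul_real_add_cone c3 mom_cone_add c2 mom_cone_scaleR c1) simp
    finally show ?thesis .
  qed
  have "face_eps N K (\<lambda>x. (eH K)^3 *\<^sub>R flux_eps cl pr v G aeps (eH K) x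
              (U K (eH K) x) (ext_trace T U B K (\<lambda>K'. next_eps K K') (eH K) x))
      = X *\<^sub>R (\<Sum>y\<in>?Y. w y *\<^sub>R ((eH K)^3 *\<^sub>R FH y))"
    unfolding face_eps_def X_def w_def FH_def p_def ..
  moreover have "face_eps N K (\<lambda>x. (eL K)^3 *\<^sub>R flux_eps cl pr v G aeps (eL K) x
              (ext_trace T U B K (\<lambda>K'. next_eps K' K) (eL K) x) (U K (eL K) x))
      = X *\<^sub>R (\<Sum>y\<in>?Y. w y *\<^sub>R ((eL K)^3 *\<^sub>R FL y))"
    unfolding face_eps_def X_def w_def FL_def p_def ..
  moreover have "X *\<^sub>R (\<Sum>y\<in>?Y. w y *\<^sub>R (de K *\<^sub>R (\<Sum>z\<in>LGL Me. LGL_wt Me z *\<^sub>R ((e z)\<^sup>2 *\<^sub>R U K (e z) (p y)))))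
      - H *\<^sub>R (X *\<^sub>R (\<Sum>y\<in>?Y. w y *\<^sub>R ((eH K)^3 *\<^sub>R FH y)) - X *\<^sub>R (\<Sum>y\<in>?Y. w y *\<^sub>R ((eL K)^3 *\<^sub>R FL y)))
      = X *\<^sub>R (\<Sum>y\<in>?Y. w y *\<^sub>R (de K *\<^sub>R (\<Sum>z\<in>LGL Me. LGL_wt Me z *\<^sub>R ((e z)\<^sup>2 *\<^sub>R U K (e z) (p y)))
      - H *\<^sub>R ((eH K)^3 *\<^sub>R FH y - (eL K)^3 *\<^sub>R FL y)))" (is "?lhs = ?rhs")
    by (simp add: scaleR_diff_right scaleR_sum_right sum_subtractf mult_ac)
  moreover have "?rhs \<in> eul_real"
  proof -
    \<comment> \<open>The sum over spatial Gauss nodes is nonempty as N is at least 1, so strictness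
      is passed on.\<close>
    obtain t where "t \<in> LG N"
      using LG_nonempty[OF points(1)] by blast
    then have y0: "(\<lambda>_. t) \<in> ?Y"
      by (simp add: PiE_iff)
    have wpos: "0 < w y" if "y \<in> ?Y" for y
      using LG_weight_prod_pos[OF that] by (simp add: w_def)
    define R where "R y = w y *\<^sub>R (de K *\<^sub>R (\<Sum>z\<in>LGL Me. LGL_wt Me z *\<^sub>R ((e z)\<^sup>2 *\<^sub>R U K (e z) (p y)))
      - H *\<^sub>R ((eH K)^3 *\<^sub>R FH y - (eL K)^3 *\<^sub>R FL y))" for y
    have *: "R y \<in> eul_real" if "y \<in> ?Y" for y
      unfolding R_def by (rule eul_real_scaleR[OF wpos[OF that] inner[OF that]])
    have "sum R ?Y \<in> eul_real"
      by (rule eul_real_sum[of _ _ R, OF finY y0 *[OF y0]]) (use * eul_real_iff in blast)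
    have "0 < X"
      using cell_lt(2)[OF K] unfolding X_def by (intro prod_pos) (auto simp: dx_def)
    then show ?thesis
      using \<open>sum R ?Y \<in> eul_real\<close> unfolding R_def by (rule eul_real_scaleR)
  qed
  ultimately show ?thesis
    unfolding I by (simp only:)
qed

text \<open>Multiplied by d + 1, the step splits into one energy bracket and d spatial ones, each
  with step (d + 1) h. The energy bracket is realizable and the spatial ones lie in the
  cone.\<close>

lemma euler_step_realizable:
  assumes K: "K \<in> T" and h: "0 \<le> h"
    and cfl_eps: "\<And>x. x \<in> box (xL K) (xH K) \<Longrightarrow>
      h * (real (CARD('d) + 1) * eH K * aeps x)
        \<le> lorentz (v x) * (1 - norm (v x)) * (LGL_wt Me 1 * de K)"
    and cfl_x: "\<And>l. h * (real (CARD('d) + 1) * ax l) \<le> LGL_wt Mx 1 * dx K l"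
  shows "cell_avg K (U K) + h *\<^sub>R transport cl pr v G aeps ax dir N T B U K \<in> eul_real"
proof -
  define n where "n = real (CARD('d) + 1)"
  define I where "I = integral (cell_closed K) (\<lambda>(\<epsilon>, x). \<epsilon>\<^sup>2 *\<^sub>R U K \<epsilon> x)"
  define E where "E = face_eps N K (\<lambda>x. (eH K)^3 *\<^sub>R flux_eps cl pr v G aeps (eH K) x
              (U K (eH K) x) (ext_trace T U B K (\<lambda>K'. next_eps K K') (eH K) x))
        - face_eps N K (\<lambda>x. (eL K)^3 *\<^sub>R flux_eps cl pr v G aeps (eL K) x
              (ext_trace T U B K (\<lambda>K'. next_eps K' K) (eL K) x) (U K (eL K) x))"
  define F where "F l = face_x N l K (xH K $ l) (\<lambda>\<epsilon> x. flux_x cl pr v (dir l) (ax l) \<epsilon> x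
              (U K \<epsilon> x) (ext_trace T U B K (\<lambda>K'. next_x l K K') \<epsilon> x))
        - face_x N l K (xL K $ l) (\<lambda>\<epsilon> x. flux_x cl pr v (dir l) (ax l) \<epsilon> x
              (ext_trace T U B K (\<lambda>K'. next_x l K' K) \<epsilon> x) (U K \<epsilon> x))" for l
  have n: "0 < n"
    by (simp add: n_def)
  have vol: "0 < vol K"
    using vol_eps_pos[OF cell_energy(1)[OF K] cell_lt(1)[OF K]] cell_lt(2)[OF K]
    unfolding vol_def by (intro mult_pos_pos prod_pos) (auto simp: dx_def)
  have "I - (n * h) *\<^sub>R E \<in> eul_real"
    unfolding I_def E_def
  proof (rule eps_bracket_realizable[OF K])
    show "0 \<le> n * h"
      using n h by simp
    show "n * h * (eH K * aeps x) \<le> lorentz (v x) * (1 - norm (v x)) * (LGL_wt Me 1 * de K)"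
      if "x \<in> box (xL K) (xH K)" for x
      using cfl_eps[OF that] unfolding n_def by (simp only: mult_ac)
  qed
  moreover have "I - (n * h) *\<^sub>R F l \<in> mom_cone" for l
    unfolding I_def F_def
  proof (rule x_bracket_cone[OF K])
    show "0 \<le> n * h"
      using n h by simp
    show "n * h * ax l \<le> LGL_wt Mx 1 * dx K l"
      using cfl_x[of l] unfolding n_def by (simp only: mult_ac)
  qed
  ultimately have "(1 / (n * vol K)) *\<^sub>R
      ((I - (n * h) *\<^sub>R E) + (\<Sum>l\<in>UNIV. I - (n * h) *\<^sub>R F l)) \<in> eul_real"
    using n vol by (intro eul_real_scaleR eul_real_add_cone mom_cone_sum) auto
  also have "(I - (n * h) *\<^sub>R E) + (\<Sum>l\<in>UNIV. I - (n * h) *\<^sub>R F l)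
      = n *\<^sub>R (I - h *\<^sub>R E - h *\<^sub>R (\<Sum>l\<in>UNIV. F l))"
  proof -
    have "(\<Sum>l\<in>(UNIV::'d set). I) = real CARD('d) *\<^sub>R I"
      by (simp add: sum_constant_scaleR)
    then show ?thesis
      by (simp add: sum_subtractf n_def scaleR_sum_right scaleR_diff_right scaleR_add_left)
  qed
  also have "(1 / (n * vol K)) *\<^sub>R n *\<^sub>R (I - h *\<^sub>R E - h *\<^sub>R (\<Sum>l\<in>UNIV. F l))
      = (1 / vol K) *\<^sub>R (I - h *\<^sub>R E - h *\<^sub>R (\<Sum>l\<in>UNIV. F l))"
    using n by simp
  also have "\<dots> = (1 / vol K) *\<^sub>R I
      + h *\<^sub>R (- (1 / vol K) *\<^sub>R E - (\<Sum>l\<in>UNIV. (1 / vol K) *\<^sub>R F l))"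
    unfolding scaleR_sum_right[symmetric] by (simp add: scaleR_diff_right mult.commute)
  finally show ?thesis
    unfolding cell_avg_def transport_def I_def E_def F_def .
qed

end

section \<open>Implicit update\<close>

text \<open>The preconditioner denominators absorb the collision terms that are linear in M. What
  they divide is a combination of M and \<open>U_hat\<close> with nonnegative weight, a positive
  multiple of the start value, and a nonnegative source.\<close>

lemma richardson_step_realizable:
  fixes M Us :: mom
  assumes \<epsilon>: "0 < \<epsilon>" and v: "norm v < 1" and cl: "closed_lag cl \<epsilon> v M"
    and lam: "0 < lam" "lam \<le> 1 / (1 + norm v)"
    and d\<tau>: "0 \<le> d\<tau>" and op: "0 \<le> chi" "chi \<le> \<kappa>" "0 \<le> Jeq"
    and Us: "Us \<in> lag_real v"
  defines "M' \<equiv> M - lam *\<^sub>R precond v lam d\<tau> chi \<kappa>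
     (U_hat cl \<epsilon> v M - Us - d\<tau> *\<^sub>R C_hat chi \<kappa> Jeq M)"
  shows "M' \<in> lag_real v" and "lam * fst Us / (lorentz v + lam * d\<tau> * chi) \<le> fst M'"
proof -
  define W where "W = lorentz v"
  define f where "f = cl \<epsilon> v M"
  define dJ where "dJ = W + lam * d\<tau> * chi"
  define dH where "dH = W + lam * d\<tau> * \<kappa>"
  have W: "0 < W"
    using lorentz_pos[OF v] by (simp add: W_def)
  have "lam * d\<tau> * chi \<le> lam * d\<tau> * \<kappa>" "0 \<le> lam * d\<tau> * chi"
    using lam(1) d\<tau> op by (auto intro: mult_left_mono)
  then have d: "0 < dJ" "dJ \<le> dH"
    using W by (auto simp: dJ_def dH_def)
  have f: "f \<in> real_dist" "integrable sph f" and M: "M = lag_mom \<epsilon> v f"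
    using cl by (auto simp: closed_lag_def real_dist_def f_def)
  have AM: "A_map v M = ray_mom \<epsilon> v f (energy \<epsilon> v)"
    unfolding M by (rule A_map_lag_mom[OF \<epsilon> v f(2)])
  have AU: "A_map v (U_hat cl \<epsilon> v M) = ray_mom \<epsilon> v f (\<lambda>\<omega>. (energy \<epsilon> v \<omega>)\<^sup>2 / \<epsilon>)"
    using A_map_U_hat[OF \<epsilon> v cl] by (simp add: f_def U_mom_ray)
  have cont: "continuous_on UNIV (\<lambda>\<omega>. (energy \<epsilon> v \<omega>)\<^sup>2 / \<epsilon>)"
    using \<epsilon> by (auto intro!: continuous_intros continuous_energy)
  define P where "P = W *\<^sub>R M - lam *\<^sub>R U_hat cl \<epsilon> v M"
  have "A_map v P = W *\<^sub>R ray_mom \<epsilon> v f (energy \<epsilon> v)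
      + (- lam) *\<^sub>R ray_mom \<epsilon> v f (\<lambda>\<omega>. (energy \<epsilon> v \<omega>)\<^sup>2 / \<epsilon>)"
    by (simp add: P_def linear_diff[OF linear_A_map] linear_cmul[OF linear_A_map] AM AU)
  also have "\<dots> = ray_mom \<epsilon> v f (\<lambda>\<omega>. W * energy \<epsilon> v \<omega> + (- lam) * ((energy \<epsilon> v \<omega>)\<^sup>2 / \<epsilon>))"
    by (intro ray_mom_linear[symmetric] \<epsilon> v f continuous_energy cont)
  also have "\<dots> \<in> mom_cone"
  proof (rule ray_mom_cone[OF \<epsilon> v f(1)])
    show "continuous_on UNIV (\<lambda>\<omega>. W * energy \<epsilon> v \<omega> + (- lam) * ((energy \<epsilon> v \<omega>)\<^sup>2 / \<epsilon>))"
      by (intro continuous_intros cont continuous_energy)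
    fix \<omega>
    have E: "0 < energy \<epsilon> v \<omega>"
      by (rule energy_pos[OF \<epsilon> v])
    have "lam * energy \<epsilon> v \<omega> \<le> lam * (\<epsilon> * (W * (1 + norm v)))"
      using energy_bounds(2)[of \<epsilon> v \<omega>] \<epsilon> v lam(1) by (intro mult_left_mono) (auto simp: W_def)
    also have "\<dots> = \<epsilon> * W * (lam * (1 + norm v))"
      by simp
    also have "\<dots> \<le> \<epsilon> * W * 1"
    proof (rule mult_left_mono)
      have "0 < 1 + norm v"
        using norm_ge_zero[of v] by linarith
      then show "lam * (1 + norm v) \<le> 1"
        using lam(2) by (simp add: pos_le_divide_eq)
    qed (use \<epsilon> W in simp)
    finally have "lam * energy \<epsilon> v \<omega> / \<epsilon> \<le> W"
      using \<epsilon> by (simp add: divide_le_eq mult.commute)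
    then have "(lam * energy \<epsilon> v \<omega> / \<epsilon>) * energy \<epsilon> v \<omega> \<le> W * energy \<epsilon> v \<omega>"
      using E by (intro mult_right_mono) auto
    then show "0 \<le> W * energy \<epsilon> v \<omega> + (- lam) * ((energy \<epsilon> v \<omega>)\<^sup>2 / \<epsilon>)"
      by (simp add: power2_eq_square mult.assoc)
  qed
  finally have AP: "A_map v P \<in> mom_cone" .
  \<comment> \<open>The image of (1, 0) is the four-velocity, which is timelike.\<close>
  have one: "A_map v (1, 0) \<in> mom_cone"
    using W v by (simp add: A_map_def mom_cone_def mult_left_le flip: W_def)
  have AUs: "A_map v Us \<in> eul_real"
    using Us lag_real_iff_A_map[OF v] by simp
  \<comment> \<open>The undivided update: its scalar part is \<open>dJ\<close> times that of
    \<open>M'\<close>, its vector part \<open>dH\<close> times that of \<open>M'\<close>.\<close>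
  define Q where "Q = P + lam *\<^sub>R Us + (lam * d\<tau> * chi * Jeq) *\<^sub>R (1, 0)"
  define R where "R = U_hat cl \<epsilon> v M - Us - d\<tau> *\<^sub>R C_hat chi \<kappa> Jeq M"
  have M': "M' = (fst Q / dJ, (1 / dH) *\<^sub>R snd Q)"
  proof (rule prod_eqI)
    have "dJ * fst M' = dJ * fst M - lam * fst R"
      using d by (simp add: M'_def precond_def right_diff_distrib flip: W_def dJ_def R_def)
    also have "\<dots> = fst Q"
      by (simp add: R_def C_hat_def Q_def P_def dJ_def algebra_simps)
    finally have "dJ * fst M' = fst Q" .
    then show "fst M' = fst (fst Q / dJ, (1 / dH) *\<^sub>R snd Q)"
      using d by (simp flip: \<open>dJ * fst M' = fst Q\<close>)
    have "dH *\<^sub>R snd M' = dH *\<^sub>R snd M - lam *\<^sub>R snd R"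
      using d by (simp add: M'_def precond_def scaleR_diff_right flip: W_def dH_def R_def)
    also have "\<dots> = snd Q"
      by (simp add: R_def C_hat_def Q_def P_def dH_def algebra_simps)
    finally have "snd Q = dH *\<^sub>R snd M'" ..
    then show "snd M' = snd (fst Q / dJ, (1 / dH) *\<^sub>R snd Q)"
      using d by simp
  qed
  have AQ: "A_map v Q \<in> eul_real"
  proof -
    have "A_map v Q = lam *\<^sub>R A_map v Us + (A_map v P + (lam * d\<tau> * chi * Jeq) *\<^sub>R A_map v (1, 0))"
      by (simp add: Q_def linear_add[OF linear_A_map] linear_cmul[OF linear_A_map] del: scaleR_Pair)
    also have "\<dots> \<in> eul_real"
      using lam(1) d\<tau> op AP AUs one
      by (intro eul_real_add_cone eul_real_scaleR mom_cone_add mom_cone_scaleR) auto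
    finally show ?thesis .
  qed
  have "0 \<le> fst P"
    by (rule fst_nonneg_A_map[OF v AP])
  then have Q: "lam * fst Us \<le> fst Q"
    using lam(1) d\<tau> op by (simp add: Q_def)
  then show "lam * fst Us / (lorentz v + lam * d\<tau> * chi) \<le> fst M'"
    unfolding M' using d(1) by (simp add: divide_right_mono flip: W_def dJ_def)
  have "0 < lam * fst Us"
    using Us lam(1) by (simp add: lag_real_def realizable_def)
  then have "0 < fst Q"
    using Q by linarith
  moreover have "1 / dH \<le> 1 / dJ"
    using d by (simp add: frac_le)
  ultimately have r: "0 \<le> (1 / dJ - 1 / dH) * fst Q"
    by simp
  \<comment> \<open>Since \<open>chi\<close> is at most \<open>\<kappa>\<close>, the scalar has the
    smaller denominator. Relative to division by \<open>dH\<close> throughout, this adds a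
    nonnegative multiple of (1, 0).\<close>
  have "M' = (1 / dH) *\<^sub>R Q + ((1 / dJ - 1 / dH) * fst Q) *\<^sub>R (1, 0)"
    unfolding M' by (rule prod_eqI) (simp_all add: left_diff_distrib)
  then have "A_map v M' = (1 / dH) *\<^sub>R A_map v Q + ((1 / dJ - 1 / dH) * fst Q) *\<^sub>R A_map v (1, 0)"
    by (simp only: linear_add[OF linear_A_map] linear_cmul[OF linear_A_map])
  also have "\<dots> \<in> eul_real"
    by (intro eul_real_add_cone eul_real_scaleR mom_cone_scaleR AQ one r) (use d in simp)
  finally show "M' \<in> lag_real v"
    by (simp only: lag_real_iff_A_map[OF v])
qed

text \<open>The cone is closed but the realizable set is not, so the limit must be kept away from
  the apex. A positive lower bound on the scalar part, uniform in the iteration index, does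
  this.\<close>

lemma richardson_limit_realizable:
  assumes \<epsilon>: "0 < \<epsilon>" and v: "norm v < 1"
    and lam: "0 < lam" "lam \<le> 1 / (1 + norm v)"
    and d\<tau>: "0 \<le> d\<tau>" and op: "0 \<le> chi" "chi \<le> \<kappa>" "0 \<le> Jeq"
    and UEx: "UEx \<in> eul_real"
    and Mit: "Mit = richardson cl \<epsilon> v lam d\<tau> chi \<kappa> Jeq (inv (A_map v) UEx)"
    and conv: "Mit \<longlonglongrightarrow> M"
    and cl: "\<And>m. m \<in> insert M (range Mit) \<Longrightarrow> m \<in> lag_real v \<Longrightarrow> closed_lag cl \<epsilon> v m"
  shows "A_map v (U_hat cl \<epsilon> v M) \<in> eul_real"
proof -
  define Us where "Us = inv (A_map v) UEx"
  have "A_map v Us = UEx"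
    unfolding Us_def by (rule surj_f_inv_f[OF surj_A_map[OF v]])
  then have Us: "Us \<in> lag_real v"
    using UEx lag_real_iff_A_map[OF v] by simp
  define step where "step M = M - lam *\<^sub>R precond v lam d\<tau> chi \<kappa>
     (U_hat cl \<epsilon> v M - Us - d\<tau> *\<^sub>R C_hat chi \<kappa> Jeq M)" for M
  have Mit': "Mit n = (step ^^ n) Us" for n
    by (simp add: Mit richardson_def step_def[abs_def] Us_def)
  have lag: "Mit n \<in> lag_real v" for n
  proof (induction n)
    case 0
    then show ?case by (simp add: Mit' Us)
  next
    case (Suc n)
    have "closed_lag cl \<epsilon> v (Mit n)"
      using Suc cl by blast
    from richardson_step_realizable(1)[OF \<epsilon> v this lam d\<tau> op Us] show ?case
      by (simp add: Mit' step_def)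
  qed
  define m where "m = lam * fst Us / (lorentz v + lam * d\<tau> * chi)"
  \<comment> \<open>The bound comes from the update formula, so it holds from the first update on;
    the limit is then taken along the shifted sequence.\<close>
  have bound: "m \<le> fst (Mit (Suc n))" for n
  proof -
    have "closed_lag cl \<epsilon> v (Mit n)"
      using lag cl by blast
    from richardson_step_realizable(2)[OF \<epsilon> v this lam d\<tau> op Us] show ?thesis
      by (simp add: Mit' step_def m_def)
  qed
  have "0 < m"
    using Us lam(1) d\<tau> op lorentz_pos[OF v] unfolding m_def
    by (intro divide_pos_pos mult_pos_pos add_pos_nonneg) (auto simp: lag_real_def realizable_def)
  also have "m \<le> fst M"
    using tendsto_fst[OF LIMSEQ_Suc[OF conv]] bound by (intro LIMSEQ_le_const) auto
  finally have "0 < fst M" .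
  have "continuous_on UNIV (A_map v)"
    using linear_A_map by (simp add: linear_continuous_on linear_conv_bounded_linear)
  then have "(\<lambda>n. A_map v (Mit n)) \<longlonglongrightarrow> A_map v M"
    by (intro continuous_on_tendsto_compose[OF _ conv]) auto
  moreover have "A_map v (Mit n) \<in> mom_cone" for n
    using lag[of n] lag_real_iff_A_map[OF v] by (simp add: eul_real_iff)
  ultimately have AM: "A_map v M \<in> mom_cone"
    by (rule closed_sequentially[OF closed_mom_cone, rotated])
  \<comment> \<open>In the cone a vanishing scalar forces the apex, whose Lagrangian scalar is
    0.\<close>
  moreover have "fst (A_map v M) \<noteq> 0"
  proof
    assume "fst (A_map v M) = 0"
    moreover from this AM have "snd (A_map v M) = 0"
      by (simp add: mom_cone_def)
    ultimately have "fst M = 0"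
      using fst_eq_A_map[OF v, of M] by simp
    with \<open>0 < fst M\<close> show False by simp
  qed
  ultimately have AM': "A_map v M \<in> eul_real"
    using mom_cone_fst_nonneg[OF AM] by (simp add: eul_real_iff)
  then have closed: "closed_lag cl \<epsilon> v M"
    using cl lag_real_iff_A_map[OF v] by simp
  define f where "f = cl \<epsilon> v M"
  have f: "f \<in> real_dist" "M = lag_mom \<epsilon> v f"
    using closed by (auto simp: closed_lag_def f_def)
  then have Ut: "Ut_mom \<epsilon> v f = A_map v M"
    using A_map_lag_mom[OF \<epsilon> v, of f] by (simp add: real_dist_def Ut_mom_ray)
  define r where "r = lorentz v * (1 - norm v)"
  have "0 < r"
    using lorentz_pos[OF v] v by (simp add: r_def)
  \<comment> \<open>The Eulerian density dominates r times \<open>A_map v M\<close>, so it inherits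
    strict positivity from the realizable limit.\<close>
  have "1 *\<^sub>R U_mom \<epsilon> v f - r *\<^sub>R Ut_mom \<epsilon> v f \<in> mom_cone"
    by (rule U_mom_Ut_mom_cone[OF \<epsilon> v f(1)]) (simp_all add: r_def)
  then have "r *\<^sub>R A_map v M + (U_mom \<epsilon> v f - r *\<^sub>R A_map v M) \<in> eul_real"
    using AM' \<open>0 < r\<close> by (intro eul_real_add_cone eul_real_scaleR) (simp_all add: Ut)
  then show ?thesis
    using A_map_U_hat[OF \<epsilon> v closed] by (simp add: f_def)
qed

section \<open>Assembly of the explicit and implicit updates\<close>

theorem proposition6:
  fixes \<Omega>e :: "real set" and \<Omega>x :: "(real^'d::finite) set" and T :: "'d cell set"
    and dir :: "'d \<Rightarrow> 3"
    and v :: "real^'d \<Rightarrow> real^3" and G :: "real^'d \<Rightarrow> four \<Rightarrow> four \<Rightarrow> real"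
    and cl :: closure and pr :: conversion
    and aeps :: "real^'d \<Rightarrow> real" and ax :: "'d \<Rightarrow> real"
    and k N Me Mx s i :: nat
    and c ch :: "nat \<Rightarrow> nat \<Rightarrow> real" and aii :: "nat \<Rightarrow> real" and dt :: real
    and Uh B :: "nat \<Rightarrow> 'd field"
    and K :: "'d cell"
    and eK chi \<kappa> Jeq lam :: real and vK :: "real^3"
    and UEx UK M :: mom and Mit :: "nat \<Rightarrow> mom"
  assumes mesh: "mesh \<Omega>e \<Omega>x T" and dir: "inj dir"
    and velocity: "\<forall>x\<in>closure \<Omega>x. norm (v x) < 1"
    and gradient: "\<forall>x\<in>closure \<Omega>x. bilinear (G x)"
    and aeps: "\<forall>x\<in>closure \<Omega>x. \<forall>\<epsilon>>0. \<forall>\<omega>\<in>space sph. \<bar>qfac (G x) \<epsilon> (v x) \<omega>\<bar> \<le> aeps x"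
    and ax: "\<forall>l. 1 \<le> ax l"
    and points: "1 \<le> N" "(real k + 5) / 2 \<le> real Me" "(real k + 3) / 2 \<le> real Mx"
    and stage: "1 \<le> i" "i \<le> s"
    and coeffs: "\<forall>i\<in>{1..s}. (\<forall>j<i. 0 \<le> c i j \<and> 0 \<le> ch i j) \<and> (\<Sum>j<i. c i j) = 1 \<and> 0 \<le> aii i"
    and poly: "\<forall>j<i. \<forall>K\<in>T. tensor_poly k (Uh j K)"
    and LG_exact: "\<forall>j<i. \<forall>K\<in>T. exact_eps (LG N) (LG_wt N) K (Uh j K) \<and>
                     (\<forall>l. exact_x (LG N) (LG_wt N) l K (Uh j K))"
    and boundary: "\<forall>j<i. \<forall>K\<in>T. \<forall>(\<epsilon>, x)\<in>cell_closed K \<inter> frontier (\<Omega>e \<times> \<Omega>x). B j K \<epsilon> x \<in> eul_real"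
    and closure_inner: "\<forall>j<i. \<forall>K\<in>T. \<forall>(\<epsilon>, x)\<in>S_all N Me Mx K. 0 < \<epsilon> \<longrightarrow> Uh j K \<epsilon> x \<in> eul_real \<longrightarrow>
                     closed_eul cl pr \<epsilon> (v x) (Uh j K \<epsilon> x)"
    and closure_bdry: "\<forall>j<i. \<forall>K\<in>T. \<forall>(\<epsilon>, x)\<in>cell_closed K \<inter> frontier (\<Omega>e \<times> \<Omega>x). 0 < \<epsilon> \<longrightarrow>
                     B j K \<epsilon> x \<in> eul_real \<longrightarrow> closed_eul cl pr \<epsilon> (v x) (B j K \<epsilon> x)"
    and LGL_x_exact: "\<forall>j<i. \<forall>K\<in>T. \<forall>l. exact_x (LGL Mx) (LGL_wt Mx) l K (Uh j K)"
    and LGL_eps_exact: "\<forall>j<i. \<forall>K\<in>T. exact_eps (LGL Me) (LGL_wt Me) K (Uh j K)"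
    and realizable_values: "\<forall>j<i. \<forall>K\<in>T. \<forall>(\<epsilon>, x)\<in>S_all N Me Mx K. Uh j K \<epsilon> x \<in> eul_real"
    and time_step: "0 < dt" "time_step_ok v aeps ax Me Mx T ch s dt"
  \<comment> \<open>stage \<open>i\<close> on the cell \<open>K\<close>; \<open>eK\<close> and \<open>vK\<close> are the energy and velocity of its implicit solve\<close>
    and K: "K \<in> T"
    and UEx: "UEx = explicit_stage c ch dt (\<lambda>j. cell_avg K (Uh j K))
                      (\<lambda>j. transport cl pr v G aeps ax dir N T (B j) (Uh j) K) i"
    and solve_point: "eL K < eK" "eK < eH K" "norm vK < 1"
    and opacities: "0 \<le> chi" "chi \<le> \<kappa>" "0 \<le> Jeq"
    and lam: "0 < lam" "lam \<le> 1 / (1 + norm vK)"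
    and Mit: "Mit = richardson cl eK vK lam (aii i * dt) chi \<kappa> Jeq (inv (A_map vK) UEx)"
    and conv: "Mit \<longlonglongrightarrow> M"
    and closure_implicit: "\<forall>m\<in>insert M (range Mit). m \<in> lag_real vK \<longrightarrow> closed_lag cl eK vK m"
    and UK: "UK = A_map vK (U_hat cl eK vK M)"
    and solves: "UK = UEx + (aii i * dt) *\<^sub>R A_map vK (C_hat chi \<kappa> Jeq M)"
  shows "UK \<in> eul_real"
proof -
  \<comment> \<open>Even for k = 0 the point counts are at least 5/2 and 3/2, which round up to 3
    and 2. Three points in energy guarantee an interior Lobatto node.\<close>
  have "real 5 \<le> real (2 * Me)" "real 3 \<le> real (2 * Mx)"
    using points(2,3) by (simp_all add: field_simps)
  then have points': "3 \<le> Me" "2 \<le> Mx"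
    unfolding of_nat_le_iff by arith+
  have i: "i \<in> {1..s}"
    using stage by simp
  have coeff: "0 \<le> c i j" "0 \<le> ch i j" if "j < i" for j
    using coeffs i that by blast+
  have c_sum: "(\<Sum>j<i. c i j) = 1" and aii: "0 \<le> aii i"
    using coeffs i by blast+
  have eK: "0 < eK"
    using mesh_energy_nonneg[OF mesh K] solve_point(1) by simp
  define V where "V j = cell_avg K (Uh j K) + (ch i j * dt) *\<^sub>R
      transport cl pr v G aeps ax dir N T (B j) (Uh j) K" for j
  have V: "V j \<in> eul_real" if j: "j < i" for j
  proof -
    interpret dg_field \<Omega>e \<Omega>x T v G cl pr aeps ax k N Me Mx "Uh j" "B j"
    proof
      fix K' \<epsilon> x assume K': "K' \<in> T"
      show "closed_eul cl pr \<epsilon> (v x) (B j K' \<epsilon> x)"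
        if "(\<epsilon>, x) \<in> cell_closed K'" "(\<epsilon>, x) \<in> frontier (\<Omega>e \<times> \<Omega>x)" "0 < \<epsilon>"
        using boundary closure_bdry j K' that by fastforce
      show "Uh j K' \<epsilon> x \<in> eul_real" if "(\<epsilon>, x) \<in> S_all N Me Mx K'"
        using realizable_values j K' that by fastforce
      then show "closed_eul cl pr \<epsilon> (v x) (Uh j K' \<epsilon> x)"
        if "(\<epsilon>, x) \<in> S_all N Me Mx K'" "0 < \<epsilon>"
        using closure_inner j K' that by fastforce
    qed (use mesh velocity gradient aeps ax points(1) points' poly LG_exact LGL_x_exact
        LGL_eps_exact j in blast)+
    have "0 \<le> ch i j * dt"
      using coeff(2)[OF j] time_step(1) by simp
    moreover have "ch i j * dt * (real (CARD('d) + 1) * eH K * aeps x)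
        \<le> lorentz (v x) * (1 - norm (v x)) * (LGL_wt Me 1 * de K)"
      if "x \<in> box (xL K) (xH K)" for x
      using time_step(2) i j K that unfolding time_step_ok_def by blast
    moreover have "ch i j * dt * (real (CARD('d) + 1) * ax l) \<le> LGL_wt Mx 1 * dx K l" for l
      using time_step(2) i j K unfolding time_step_ok_def by blast
    ultimately show ?thesis
      unfolding V_def by (rule euler_step_realizable[OF K])
  qed
  have UEx_real: "UEx \<in> eul_real"
  proof -
    \<comment> \<open>The coefficients sum to 1, so one of them is positive and carries strictness
      into the convex combination.\<close>
    obtain j0 where j0: "j0 \<in> {..<i}" "0 < c i j0"
    proof -
      have "\<not> (\<Sum>j<i. c i j) \<le> 0"
        using c_sum by simp
      then show ?thesis
        using that sum_nonpos[of "{..<i}" "c i"] not_le by blast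
    qed
    have "(\<Sum>j<i. c i j *\<^sub>R V j) \<in> eul_real"
    proof (rule eul_real_sum[of _ j0 "\<lambda>j. c i j *\<^sub>R V j"])
      show "c i j0 *\<^sub>R V j0 \<in> eul_real"
        using j0 V by (intro eul_real_scaleR) auto
      show "c i j *\<^sub>R V j \<in> mom_cone" if "j \<in> {..<i}" for j
        using that V[of j] coeff(1)[of j] by (intro mom_cone_scaleR) (auto simp: eul_real_iff)
    qed (use j0 in auto)
    then show ?thesis
      unfolding UEx explicit_stage_def V_def .
  qed
  show ?thesis
    unfolding UK
  proof (rule richardson_limit_realizable[OF eK solve_point(3) lam _ opacities UEx_real Mit conv])
    show "0 \<le> aii i * dt"
      using aii time_step(1) by simp
  qed (use closure_implicit in blast)
qed

end
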